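(* Let $\Gamma_{\{3,4,3,4\}}$ be the group of isometries of $\mathbf H^1_{\mathbb H}$ generated by the hyperbolic reflections in the five 3-dimensional faces of the hyperbolic 4-simplex $\Delta_{\mathfrak L}$ with vertices $A=1$, $B=\frac12(\sqrt3+\mathbf i)$, $C=\frac1{\sqrt2}+\frac12(\mathbf i+\mathbf j)$, $D=\frac12(1+\mathbf i+\mathbf j+\mathbf k)$ and the ideal vertex $\infty$. Then $\Gamma_{\{3,4,3,4\}}$ is a discrete group of finite covolume, and $$PSL(2,\mathfrak L)\subset PSL(2,\mathfrak H)\subset\Gamma_{\{3,4,3,4\}}$$ with $[\Gamma_{\{3,4,3,4\}}:PSL(2,\mathfrak H)]=4$, $[\Gamma_{\{3,4,3,4\}}:PSL(2,\mathfrak L)]=12$ and $[PSL(2,\mathfrak H):PSL(2,\mathfrak L)]=3$.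
   Context: $\mathbf H^1_{\mathbb H}=\{q\in\mathbb H:\Re q>0\}$ with the hyperbolic metric $|dq|^2/(\Re q)^2$ (a model of real hyperbolic 4-space, with ideal boundary $\{\Re q=0\}\cup\{\infty\}$). $T(q)=q^{-1}$, $\tau_\omega(q)=q+\omega$. $PSL(2,\mathfrak L)$ is generated by $T$ and $\tau_\omega$ for $\omega\in\{b\mathbf i+c\mathbf j+d\mathbf k:b,c,d\in\mathbb Z\}$. $PSL(2,\mathfrak H)$ is generated by $T$, these $\tau_\omega$, and the maps $q\mapsto uqu^{-1}$ for the 24 Hurwitz units $u\in\{\pm1,\pm\mathbf i,\pm\mathbf j,\pm\mathbf k,\frac12(\pm1\pm\mathbf i\pm\mathbf j\pm\mathbf k)\}$. (The dihedral angles of $\Delta_{\mathfrak L}$ are $\pi/2,\pi/3,\pi/4$, its Coxeter diagram being the linear diagram with labels $3,4,3,4$.) *)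

theory Defs
  imports "HOL-Analysis.Analysis" "HOL-Algebra.Generated_Groups" "HOL-Algebra.Bij"
begin

text \<open>The quaternion z + w j (z, w complex) is the pair (z, w); thus
  a + b i + c j + d k corresponds to (Complex a b, Complex c d).  Addition,
  real scaling, norm, inner product and Lebesgue measure are those of
  complex x complex = R^4 (Euclidean).\<close>

type_synonym quat = "complex \<times> complex"

definition quat_of :: "real \<Rightarrow> real \<Rightarrow> real \<Rightarrow> real \<Rightarrow> quat" where
  "quat_of a b c d = (Complex a b, Complex c d)"

definition qmult :: "quat \<Rightarrow> quat \<Rightarrow> quat" where
  "qmult p q = (fst p * fst q - snd p * cnj (snd q), fst p * snd q + snd p * cnj (fst q))"

definition qconj :: "quat \<Rightarrow> quat" where
  "qconj q = (cnj (fst q), - snd q)"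

definition qinv :: "quat \<Rightarrow> quat" where
  "qinv q = (1 / (norm q)\<^sup>2) *\<^sub>R qconj q"

definition qRe :: "quat \<Rightarrow> real" where
  "qRe q = Re (fst q)"

definition HH :: "quat set" where
  "HH = {q. qRe q > 0}"

text \<open>Hyperbolic distance of the metric |dq|^2/(Re q)^2 (for reference).\<close>
definition hdist :: "quat \<Rightarrow> quat \<Rightarrow> real" where
  "hdist p q = arcosh (1 + (norm (p - q))\<^sup>2 / (2 * qRe p * qRe q))"

definition hvol :: "quat measure" where
  "hvol = density lborel (\<lambda>q. indicator HH q * ennreal (1 / (qRe q) ^ 4))"

abbreviation BH :: "(quat \<Rightarrow> quat) monoid" where
  "BH \<equiv> BijGroup HH"

definition gen_grp :: "(quat \<Rightarrow> quat) set \<Rightarrow> (quat \<Rightarrow> quat) set" where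
  "gen_grp S = generate BH ((\<lambda>f. restrict f HH) ` S)"

definition grp_index :: "(quat \<Rightarrow> quat) set \<Rightarrow> (quat \<Rightarrow> quat) set \<Rightarrow> nat" where
  "grp_index G H = card (rcosets\<^bsub>BH\<lparr>carrier := G\<rparr>\<^esub> H)"

text \<open>Discreteness: the identity is isolated in the compact-open topology
  (topology of uniform convergence on compact subsets of HH).\<close>
definition discrete_grp :: "(quat \<Rightarrow> quat) set \<Rightarrow> bool" where
  "discrete_grp G \<longleftrightarrow>
     \<not> (\<exists>g :: nat \<Rightarrow> quat \<Rightarrow> quat.
          (\<forall>n. g n \<in> G \<and> g n \<noteq> restrict id HH) \<and>
          (\<forall>K. compact K \<and> K \<subseteq> HH \<longrightarrow> uniform_limit K g id sequentially))"

definition fundamental_domain :: "(quat \<Rightarrow> quat) set \<Rightarrow> quat set \<Rightarrow> bool" where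
  "fundamental_domain G F \<longleftrightarrow>
     F \<in> sets hvol \<and> F \<subseteq> HH \<and> (\<Union>g\<in>G. g ` F) = HH \<and>
     (\<forall>g\<in>G. \<forall>h\<in>G. g \<noteq> h \<longrightarrow> g ` F \<inter> h ` F \<in> null_sets hvol)"

definition finite_covolume :: "(quat \<Rightarrow> quat) set \<Rightarrow> bool" where
  "finite_covolume G \<longleftrightarrow> (\<exists>F. fundamental_domain G F \<and> emeasure hvol F < \<infinity>)"

text \<open>VPlane n c: the vertical hyperplane {q. n . q = c}, n a nonzero purely
  imaginary quaternion (these are exactly the hyperplanes with ideal point infinity);
  HSphere c r: the hemisphere {q. |q - c| = r}, Re c = 0, r > 0.\<close>
datatype hplane = VPlane quat real | HSphere quat real

fun wf_hplane :: "hplane \<Rightarrow> bool" where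
  "wf_hplane (VPlane n c) \<longleftrightarrow> n \<noteq> 0 \<and> qRe n = 0"
| "wf_hplane (HSphere c r) \<longleftrightarrow> qRe c = 0 \<and> r > 0"

fun hpset :: "hplane \<Rightarrow> quat set" where
  "hpset (VPlane n c) = {q \<in> HH. inner n q = c}"
| "hpset (HSphere c r) = {q \<in> HH. dist q c = r}"

fun hrefl :: "hplane \<Rightarrow> quat \<Rightarrow> quat" where
  "hrefl (VPlane n c) q = q - (2 * (inner n q - c) / (norm n)\<^sup>2) *\<^sub>R n"
| "hrefl (HSphere c r) q = c + (r\<^sup>2 / (norm (q - c))\<^sup>2) *\<^sub>R (q - c)"

datatype vtx = Fin quat | Infty

fun on_hplane :: "vtx \<Rightarrow> hplane \<Rightarrow> bool" where
  "on_hplane (Fin p) H \<longleftrightarrow> p \<in> hpset H"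
| "on_hplane Infty (VPlane n c) \<longleftrightarrow> True"
| "on_hplane Infty (HSphere c r) \<longleftrightarrow> False"

definition face_reflections :: "vtx set \<Rightarrow> (quat \<Rightarrow> quat) set" where
  "face_reflections V =
     {hrefl H | H v. v \<in> V \<and> wf_hplane H \<and> (\<forall>w \<in> V - {v}. on_hplane w H)}"

definition vA :: quat where "vA = quat_of 1 0 0 0"
definition vB :: quat where "vB = quat_of (sqrt 3 / 2) (1/2) 0 0"
definition vC :: quat where "vC = quat_of (1 / sqrt 2) (1/2) (1/2) 0"
definition vD :: quat where "vD = quat_of (1/2) (1/2) (1/2) (1/2)"

definition Delta_L :: "vtx set" where
  "Delta_L = {Fin vA, Fin vB, Fin vC, Fin vD, Infty}"

definition Gamma_3434 :: "(quat \<Rightarrow> quat) set" where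
  "Gamma_3434 = gen_grp (face_reflections Delta_L)"

definition lattice_L :: "quat set" where
  "lattice_L = {quat_of 0 (of_int b) (of_int c) (of_int d) | b c d. True}"

definition hurwitz_units :: "quat set" where
  "hurwitz_units =
     {quat_of a b c d | a b c d. {a, b, c, d} \<subseteq> {-1, 0, 1} \<and> a\<^sup>2 + b\<^sup>2 + c\<^sup>2 + d\<^sup>2 = 1}
   \<union> {quat_of a b c d | a b c d. {a, b, c, d} \<subseteq> {-1/2, 1/2}}"

definition PSL2_L :: "(quat \<Rightarrow> quat) set" where
  "PSL2_L = gen_grp ({qinv} \<union> {(\<lambda>q. q + \<omega>) | \<omega>. \<omega> \<in> lattice_L})"

definition PSL2_H :: "(quat \<Rightarrow> quat) set" where
  "PSL2_H = gen_grp ({qinv} \<union> {(\<lambda>q. q + \<omega>) | \<omega>. \<omega> \<in> lattice_L}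
                      \<union> {(\<lambda>q. qmult (qmult u q) (qinv u)) | u. u \<in> hurwitz_units})"

end

theory Submission
  imports Defs
begin

text \<open>The vertices involve \<open>sqrt 2\<close> and \<open>sqrt 3\<close>, but the mirrors do
  not: for imaginary coordinates x, y, z they are the unit sphere and x = 1/2, x = y, y = z, z = 0,
  so each face reflection has an integral matrix. The arithmetic rests on one fact: for the dual
  form a null row satisfies |v|^2 = 4 A B, and three integer squares add up to a multiple of 4 only
  if all three numbers are even. This makes the spatial block modulo 2 multiplicative and explains
  the 2m in the first row. Residues modulo 2 cannot see signs, so the inversion and all sign changes
  look trivial there; the determinant separates the orientation-reversing ones, and the remaining
  sign changes already lie in PSL(2,L). That the simplex is a fundamental domain is not read off
  from its dihedral angles. If B > 0, an interior point strictly loses height under g, although the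
  inverse of g cannot raise a point of the simplex; so an element taking an interior point into the
  simplex has B = 0. It then fixes infinity and is a signed permutation followed by a translation,
  which strict inequalities force to be trivial.\<close>

text \<open>In the hyperboloid model \<open>q = t + v \<mapsto> (1/t)(1, v, |q|\<^sup>2)\<close> for the form \<open>|v|\<^sup>2 - a b\<close> the reflection
  group acts by integral Lorentz matrices, which gives discreteness.  The first row of such a matrix
  is a null vector \<open>(A, 2m, B)\<close> and determines the height of images of points; maximising the height over
  an orbit shows that the simplex meets every orbit, and estimating it from below on the simplex shows that
  the interior of the simplex meets every orbit at most once.

  For the indices, every group element is a product of an element of \<open>PSL(2,L)\<close> and a signed permutation
  of the imaginary axes. The pair consisting of the spatial block modulo 2, which is a permutation matrix, and the
  determinant is a (contravariant) homomorphism onto \<open>S\<^sub>3 \<times> {\<plusminus>1}\<close> with kernel \<open>PSL(2,L)\<close>, under which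
  \<open>PSL(2,H)\<close> is the preimage of \<open>A\<^sub>3 \<times> {1}\<close>.\<close>

subsection \<open>Groups of self-maps of the half-space\<close>

text \<open>Inverses are required inside \<open>S\<close> itself, so that the generated group
  consists of words in \<open>S\<close> and induction over it needs no case for inverses.\<close>

definition inv_closed :: "(quat \<Rightarrow> quat) set \<Rightarrow> bool" where
  "inv_closed S \<longleftrightarrow> (\<forall>f\<in>S. f ` HH \<subseteq> HH \<and> (\<exists>f'\<in>S. \<forall>q\<in>HH. f' (f q) = q \<and> f (f' q) = q))"

text \<open>Elements of \<open>BH\<close> are extensional, that is, undefined off \<open>HH\<close>,
  whereas the concrete isometries are total functions. Going through \<open>mem\<close> lets all
  computations use the total functions.\<close>

definition mem :: "(quat \<Rightarrow> quat) set \<Rightarrow> (quat \<Rightarrow> quat) \<Rightarrow> bool" where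
  "mem G f \<longleftrightarrow> restrict f HH \<in> G"

lemma inv_closed_Bij:
  assumes "inv_closed S" "f \<in> S"
  shows "restrict f HH \<in> Bij HH"
proof -
  obtain f' where f': "f' \<in> S" "\<forall>q\<in>HH. f' (f q) = q \<and> f (f' q) = q"
    using assms unfolding inv_closed_def by blast
  have "f' ` HH \<subseteq> HH" "f ` HH \<subseteq> HH" using assms f' unfolding inv_closed_def by blast+
  then have "bij_betw f HH HH"
    using f'(2) by (intro bij_betwI[where g = f'] funcsetI) blast+
  then show ?thesis by (simp add: Bij_def)
qed

lemma mult_BH: "f \<in> Bij HH \<Longrightarrow> g \<in> Bij HH \<Longrightarrow> f \<otimes>\<^bsub>BH\<^esub> g = compose HH f g"
  by (simp add: BijGroup_def)

lemma gen_grp_subset: "inv_closed S \<Longrightarrow> (\<lambda>f. restrict f HH) ` S \<subseteq> carrier BH"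
  using inv_closed_Bij by (auto simp: BijGroup_def)

lemma gen_grp_subgroup: "inv_closed S \<Longrightarrow> subgroup (gen_grp S) BH"
  unfolding gen_grp_def
  using group.generate_is_subgroup[OF group_BijGroup gen_grp_subset] .

lemma subgroup_BH_Bij: "subgroup G BH \<Longrightarrow> g \<in> G \<Longrightarrow> g \<in> Bij HH"
  using subgroup.mem_carrier[of G BH g] by (simp add: BijGroup_def)

lemma Bij_HH: "g \<in> Bij HH \<Longrightarrow> q \<in> HH \<Longrightarrow> g q \<in> HH"
  by (auto simp: Bij_def bij_betw_def)

lemma mem_gen: "f \<in> S \<Longrightarrow> mem (gen_grp S) f"
  unfolding mem_def gen_grp_def by (intro generate.incl) auto

lemma mem_cong: "mem G f \<Longrightarrow> (\<And>q. q \<in> HH \<Longrightarrow> f q = g q) \<Longrightarrow> mem G g"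
  unfolding mem_def by (metis (mono_tags, lifting) restrict_ext)

lemma mem_id: "subgroup G BH \<Longrightarrow> mem G (\<lambda>q. q)"
  using subgroup.one_closed[of G BH] by (simp add: mem_def BijGroup_def)

lemma mem_HH: "subgroup G BH \<Longrightarrow> mem G f \<Longrightarrow> q \<in> HH \<Longrightarrow> f q \<in> HH"
  using Bij_HH[OF subgroup_BH_Bij, of G "restrict f HH" q] unfolding mem_def by simp

lemma mem_comp:
  assumes "subgroup G BH" "mem G f" "mem G g"
  shows "mem G (\<lambda>q. f (g q))"
proof -
  have "restrict f HH \<otimes>\<^bsub>BH\<^esub> restrict g HH \<in> G"
    using assms subgroup.m_closed unfolding mem_def by metis
  also have "restrict f HH \<otimes>\<^bsub>BH\<^esub> restrict g HH = compose HH (restrict f HH) (restrict g HH)"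
    using assms subgroup_BH_Bij unfolding mem_def by (intro mult_BH) auto
  also have "\<dots> = restrict (\<lambda>q. f (g q)) HH"
    using mem_HH[OF assms(1,3)] by (auto simp: compose_def restrict_def)
  finally show ?thesis by (simp only: mem_def)
qed

lemma subgroup_mem: "subgroup G BH \<Longrightarrow> g \<in> G \<Longrightarrow> mem G g"
  using subgroup_BH_Bij[of G g] by (simp add: mem_def Bij_def extensional_restrict)

lemma subgroup_inv_apply:
  assumes "subgroup G BH" "g \<in> G"
  shows "inv\<^bsub>BH\<^esub> g \<in> G" "q \<in> HH \<Longrightarrow> (inv\<^bsub>BH\<^esub> g) (g q) = q" "q \<in> HH \<Longrightarrow> g ((inv\<^bsub>BH\<^esub> g) q) = q"
proof -
  show i: "inv\<^bsub>BH\<^esub> g \<in> G" using assms by (simp add: subgroup.m_inv_closed)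
  have B: "g \<in> Bij HH" "inv\<^bsub>BH\<^esub> g \<in> Bij HH" using subgroup_BH_Bij assms i by auto
  then have c: "g \<in> carrier BH" by (simp add: BijGroup_def)
  have 1: "compose HH (inv\<^bsub>BH\<^esub> g) g = (\<lambda>x\<in>HH. x)"
    using group.l_inv[OF group_BijGroup c] B by (simp add: mult_BH) (simp add: BijGroup_def)
  have 2: "compose HH g (inv\<^bsub>BH\<^esub> g) = (\<lambda>x\<in>HH. x)"
    using group.r_inv[OF group_BijGroup c] B by (simp add: mult_BH) (simp add: BijGroup_def)
  show "q \<in> HH \<Longrightarrow> (inv\<^bsub>BH\<^esub> g) (g q) = q" using fun_cong[OF 1, of q] by (simp add: compose_def)
  show "q \<in> HH \<Longrightarrow> g ((inv\<^bsub>BH\<^esub> g) q) = q" using fun_cong[OF 2, of q] by (simp add: compose_def)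
qed

lemma gen_grp_induct [consumes 2, case_names one step]:
  assumes S: "inv_closed S" and x: "x \<in> gen_grp S"
    and one: "P (\<lambda>q\<in>HH. q)"
    and step: "\<And>f g. f \<in> S \<Longrightarrow> g \<in> gen_grp S \<Longrightarrow> P g \<Longrightarrow> P (\<lambda>q\<in>HH. f (g q))"
  shows "P x"
proof -
  interpret B: group BH by (rule group_BijGroup)
  have sg: "subgroup (gen_grp S) BH" using gen_grp_subgroup S .
  have left: "P (restrict f HH \<otimes>\<^bsub>BH\<^esub> g)" if "f \<in> S" "g \<in> gen_grp S" "P g" for f g
  proof -
    have B: "restrict f HH \<in> Bij HH" "g \<in> Bij HH"
      using inv_closed_Bij[OF S] subgroup_BH_Bij[OF sg] that by auto
    then have "restrict f HH \<otimes>\<^bsub>BH\<^esub> g = (\<lambda>q\<in>HH. f (g q))"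
      using Bij_HH by (auto simp: mult_BH compose_def restrict_def)
    then show ?thesis using step[OF that] by simp
  qed
  have invS: "\<exists>f'\<in>S. inv\<^bsub>BH\<^esub> (restrict f HH) = restrict f' HH" if f: "f \<in> S" for f
  proof -
    obtain f' where f': "f' \<in> S" "\<forall>q\<in>HH. f' (f q) = q \<and> f (f' q) = q"
      using S f unfolding inv_closed_def by blast
    have B: "restrict f HH \<in> Bij HH" "restrict f' HH \<in> Bij HH"
      using inv_closed_Bij[OF S] f f' by auto
    then have "restrict f' HH \<otimes>\<^bsub>BH\<^esub> restrict f HH = \<one>\<^bsub>BH\<^esub>"
      using Bij_HH[OF B(1)] f' by (auto simp: mult_BH compose_def BijGroup_def restrict_def)
    then have "inv\<^bsub>BH\<^esub> (restrict f HH) = restrict f' HH"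
      using B by (intro B.inv_equality) (auto simp: BijGroup_def)
    then show ?thesis using f' by blast
  qed
  \<comment> \<open>Generalised to products with an arbitrary right factor, which is what the
    product case needs; the claim is the instance with the identity.\<close>
  have "\<forall>g\<in>gen_grp S. P g \<longrightarrow> P (x \<otimes>\<^bsub>BH\<^esub> g)"
    using x unfolding gen_grp_def
  proof (induction rule: generate.induct)
    case one
    then show ?case
      using subgroup.mem_carrier[OF sg] unfolding gen_grp_def[symmetric] by simp
  next
    case (incl h)
    then show ?case using left unfolding gen_grp_def[symmetric] by blast
  next
    case (inv h)
    then obtain f where f: "f \<in> S" "h = restrict f HH" by blast
    obtain f' where f': "f' \<in> S" "inv\<^bsub>BH\<^esub> (restrict f HH) = restrict f' HH" using invS[OF f(1)] by blast
    show ?case unfolding gen_grp_def[symmetric] f(2) f'(2) using left[OF f'(1)] by blast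
  next
    case (eng h1 h2)
    have "h1 \<otimes>\<^bsub>BH\<^esub> h2 \<otimes>\<^bsub>BH\<^esub> g = h1 \<otimes>\<^bsub>BH\<^esub> (h2 \<otimes>\<^bsub>BH\<^esub> g)" if "g \<in> gen_grp S" for g
      using eng(1,2) that sg unfolding gen_grp_def[symmetric]
      by (intro B.m_assoc) (auto intro: subgroup.mem_carrier)
    moreover have "h2 \<otimes>\<^bsub>BH\<^esub> g \<in> gen_grp S" if "g \<in> gen_grp S" for g
      using eng(2) that sg unfolding gen_grp_def[symmetric] by (simp add: subgroup.m_closed)
    ultimately show ?case using eng unfolding gen_grp_def[symmetric] by simp
  qed
  moreover have "(\<lambda>q\<in>HH. q) \<in> gen_grp S" using mem_id[OF sg] by (simp add: mem_def)
  moreover have "x \<otimes>\<^bsub>BH\<^esub> \<one>\<^bsub>BH\<^esub> = x"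
    using subgroup.mem_carrier[OF sg x] by (rule B.r_one)
  moreover have "\<one>\<^bsub>BH\<^esub> = (\<lambda>q\<in>HH. q)" by (simp add: BijGroup_def)
  ultimately show ?thesis using one by auto
qed

lemma gen_grp_least:
  assumes "inv_closed S" "subgroup G BH" "\<And>f. f \<in> S \<Longrightarrow> mem G f"
  shows "gen_grp S \<subseteq> G"
  unfolding gen_grp_def
  by (intro group.generate_subgroup_incl[OF group_BijGroup _ assms(2)]) (use assms(3) in \<open>auto simp: mem_def\<close>)

text \<open>The invariant only has to separate right cosets; no group structure on its values
  enters. Hence it may be contravariant, and it may be coarsened by taking signs.\<close>

lemma grp_index_eq_card_image:
  assumes G: "subgroup G BH" and H: "subgroup H BH" and HG: "H \<subseteq> G"
    and \<phi>: "\<And>x y. x \<in> G \<Longrightarrow> y \<in> G \<Longrightarrow> \<phi> x = \<phi> y \<longleftrightarrow> x \<otimes>\<^bsub>BH\<^esub> inv\<^bsub>BH\<^esub> y \<in> H"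
  shows "grp_index G H = card (\<phi> ` G)"
proof -
  interpret B: group BH by (rule group_BijGroup)
  let ?K = "BH\<lparr>carrier := G\<rparr>"
  interpret K: group ?K by (rule B.subgroup_imp_group[OF G])
  have HK: "subgroup H ?K"
    using B.subgroup_incl[OF H G HG] .
  have eq: "H #>\<^bsub>?K\<^esub> x = H #>\<^bsub>?K\<^esub> y \<longleftrightarrow> \<phi> x = \<phi> y" if xy: "x \<in> G" "y \<in> G" for x y
  proof -
    have inv: "inv\<^bsub>?K\<^esub> y = inv\<^bsub>BH\<^esub> y" using B.m_inv_consistent[OF G xy(2)] .
    have "H #>\<^bsub>?K\<^esub> x = H #>\<^bsub>?K\<^esub> y \<longleftrightarrow> x \<in> H #>\<^bsub>?K\<^esub> y"
    proof
      assume "H #>\<^bsub>?K\<^esub> x = H #>\<^bsub>?K\<^esub> y"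
      then show "x \<in> H #>\<^bsub>?K\<^esub> y" using K.rcos_self[OF _ HK, of x] xy(1) by simp
    next
      assume "x \<in> H #>\<^bsub>?K\<^esub> y"
      then have "H #>\<^bsub>?K\<^esub> y = H #>\<^bsub>?K\<^esub> x"
        by (rule K.repr_independence[OF _ _ HK]) (simp add: xy)
      then show "H #>\<^bsub>?K\<^esub> x = H #>\<^bsub>?K\<^esub> y" by simp
    qed
    also have "\<dots> \<longleftrightarrow> x \<otimes>\<^bsub>?K\<^esub> inv\<^bsub>?K\<^esub> y \<in> H"
      using subgroup.rcos_module[OF HK K.group_axioms, of y x] xy by simp
    finally show ?thesis using \<phi>[OF xy] inv by simp
  qed
  \<comment> \<open>The value on a coset is read off at a chosen representative; \<open>eq\<close>
    makes it independent of the choice.\<close>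
  define F where "F C = \<phi> (SOME x. x \<in> G \<and> C = H #>\<^bsub>?K\<^esub> x)" for C
  have F: "F (H #>\<^bsub>?K\<^esub> x) = \<phi> x" if "x \<in> G" for x
  proof -
    let ?s = "SOME y. y \<in> G \<and> H #>\<^bsub>?K\<^esub> x = H #>\<^bsub>?K\<^esub> y"
    have "?s \<in> G \<and> H #>\<^bsub>?K\<^esub> x = H #>\<^bsub>?K\<^esub> ?s"
      by (rule someI[of "\<lambda>y. y \<in> G \<and> H #>\<^bsub>?K\<^esub> x = H #>\<^bsub>?K\<^esub> y" x]) (use that in auto)
    then have "\<phi> x = \<phi> ?s" using eq[OF that, of ?s] by blast
    then show ?thesis unfolding F_def by (rule sym)
  qed
  have R: "rcosets\<^bsub>?K\<^esub> H = (\<lambda>x. H #>\<^bsub>?K\<^esub> x) ` G"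
    by (auto simp: RCOSETS_def)
  have "bij_betw F (rcosets\<^bsub>?K\<^esub> H) (\<phi> ` G)"
  proof (rule bij_betw_imageI)
    show "inj_on F (rcosets\<^bsub>?K\<^esub> H)" unfolding R inj_on_def using F eq by auto
    show "F ` (rcosets\<^bsub>?K\<^esub> H) = \<phi> ` G" unfolding R image_image using F by (intro image_cong) auto
  qed
  then show ?thesis unfolding grp_index_def by (rule bij_betw_same_card)
qed

subsection \<open>Coordinates and the Lorentz lift\<close>

datatype axis = AX | AY | AZ

lemma UNIV_axis: "UNIV = {AX, AY, AZ}"
  by (auto intro: axis.exhaust)

instance axis :: finite
  by standard (simp add: UNIV_axis)

datatype coord = CA | CB | CV axis

lemma UNIV_coord: "UNIV = insert CA (insert CB (range CV))"
  by (auto intro: coord.exhaust)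

instance coord :: finite
  by standard (simp add: UNIV_coord)

lemma sum_axis: "(\<Sum>i\<in>UNIV. f i) = f AX + f AY + f AZ" for f :: "axis \<Rightarrow> 'a::comm_monoid_add"
  by (simp add: UNIV_axis add.assoc)

lemma prod_axis: "(\<Prod>i\<in>UNIV. f i) = f AX * f AY * f AZ" for f :: "axis \<Rightarrow> 'a::comm_monoid_mult"
  by (simp add: UNIV_axis mult.assoc)

lemma sum_coord: "(\<Sum>c\<in>UNIV. f c) = f CA + f CB + (\<Sum>i\<in>UNIV. f (CV i))"
  for f :: "coord \<Rightarrow> 'a::comm_monoid_add"
proof -
  have "(\<Sum>c\<in>range CV. f c) = (\<Sum>i\<in>UNIV. f (CV i))"
    by (simp add: sum.reindex inj_on_def)
  then show ?thesis
    unfolding UNIV_coord by (subst sum.insert; auto simp: add.assoc)+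
qed

lemma all_axis: "(\<forall>i. P i) \<longleftrightarrow> P AX \<and> P AY \<and> P AZ"
  by (metis axis.exhaust)

lemma all_coord: "(\<forall>c. P c) \<longleftrightarrow> P CA \<and> P CB \<and> (\<forall>i. P (CV i))"
  by (metis coord.exhaust)

fun qim :: "quat \<Rightarrow> axis \<Rightarrow> real" where
  "qim q AX = Im (fst q)"
| "qim q AY = Re (snd q)"
| "qim q AZ = Im (snd q)"

definition mkq :: "real \<Rightarrow> (axis \<Rightarrow> real) \<Rightarrow> quat" where
  "mkq t v = quat_of t (v AX) (v AY) (v AZ)"

lemma qRe_mkq [simp]: "qRe (mkq t v) = t"
  by (simp add: mkq_def quat_of_def qRe_def)

lemma qim_mkq [simp]: "qim (mkq t v) i = v i"
  by (cases i) (simp_all add: mkq_def quat_of_def)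

lemma quat_eqI: "qRe p = qRe q \<Longrightarrow> (\<And>i. qim p i = qim q i) \<Longrightarrow> p = q"
  by (metis complex_eqI prod_eqI qRe_def qim.simps)

lemma norm_quat: "(norm q)\<^sup>2 = (qRe q)\<^sup>2 + (\<Sum>i\<in>UNIV. (qim q i)\<^sup>2)" for q :: quat
  by (cases q) (simp add: norm_Pair sum_axis qRe_def cmod_power2)

lemma qRe_add [simp]: "qRe (p + q) = qRe p + qRe q"
  and qRe_diff [simp]: "qRe (p - q) = qRe p - qRe q"
  and qRe_scaleR [simp]: "qRe (c *\<^sub>R q) = c * qRe q"
  and qRe_zero [simp]: "qRe 0 = 0"
  by (simp_all add: qRe_def)

lemma qim_add [simp]: "qim (p + q) i = qim p i + qim q i"
  and qim_diff [simp]: "qim (p - q) i = qim p i - qim q i"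
  and qim_scaleR [simp]: "qim (c *\<^sub>R q) i = c * qim q i"
  and qim_zero [simp]: "qim 0 i = 0"
  by (cases i; simp)+

declare qim.simps [simp del]

lemma quat_eqI3:
  "qRe p = qRe q \<Longrightarrow> qim p AX = qim q AX \<Longrightarrow> qim p AY = qim q AY \<Longrightarrow> qim p AZ = qim q AZ \<Longrightarrow> p = q"
  by (rule quat_eqI) (auto intro: axis.induct)

lemma HH_iff [simp]: "q \<in> HH \<longleftrightarrow> qRe q > 0"
  by (simp add: HH_def)

lemma norm_pos_HH: "q \<in> HH \<Longrightarrow> norm q > 0"
  by auto

text \<open>The hyperboloid model for the quadratic form \<open>|v|\<^sup>2 - a b\<close>.\<close>
fun lift :: "quat \<Rightarrow> coord \<Rightarrow> real" where
  "lift q CA = 1 / qRe q"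
| "lift q CB = (norm q)\<^sup>2 / qRe q"
| "lift q (CV i) = qim q i / qRe q"

lemma lift_inject:
  assumes "p \<in> HH" "q \<in> HH" "\<And>c. lift p c = lift q c"
  shows "p = q"
proof (rule quat_eqI)
  show *: "qRe p = qRe q" using assms(3)[of CA] by simp
  show "qim p i = qim q i" for i using assms(3)[of "CV i"] assms(1,2) * by simp
qed

text \<open>The linear relation is demanded only at lifted points; since these span the whole
  5-dimensional space, the matrix is still unique (\<open>acts_unique\<close>).\<close>

definition acts :: "(quat \<Rightarrow> quat) \<Rightarrow> int^coord^coord \<Rightarrow> bool" where
  "acts g M \<longleftrightarrow> (\<forall>q\<in>HH. g q \<in> HH \<and> (\<forall>c. lift (g q) c = (\<Sum>d\<in>UNIV. of_int (M$c$d) * lift q d)))"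

lemma acts_cong: "acts f M \<Longrightarrow> (\<And>q. q \<in> HH \<Longrightarrow> f q = g q) \<Longrightarrow> acts g M"
  by (simp add: acts_def)

lemma acts_comp: "acts f M \<Longrightarrow> acts g N \<Longrightarrow> acts (\<lambda>q. f (g q)) (M ** N)"
proof -
  assume f: "acts f M" and g: "acts g N"
  have "lift (f (g q)) c = (\<Sum>d\<in>UNIV. of_int ((M ** N)$c$d) * lift q d)" if q: "q \<in> HH" for q c
  proof -
    have "lift (f (g q)) c = (\<Sum>d\<in>UNIV. of_int (M$c$d) * (\<Sum>e\<in>UNIV. of_int (N$d$e) * lift q e))"
    proof -
      have "g q \<in> HH" using g q unfolding acts_def by blast
      then have "lift (f (g q)) c = (\<Sum>d\<in>UNIV. of_int (M$c$d) * lift (g q) d)"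
        using f unfolding acts_def by blast
      moreover have "lift (g q) d = (\<Sum>e\<in>UNIV. of_int (N$d$e) * lift q e)" for d
        using g q unfolding acts_def by blast
      ultimately show ?thesis by simp
    qed
    also have "\<dots> = (\<Sum>e\<in>UNIV. (\<Sum>d\<in>UNIV. of_int (M$c$d) * of_int (N$d$e)) * lift q e)"
      unfolding sum_distrib_left sum_distrib_right by (subst sum.swap) (simp add: mult.assoc)
    finally show ?thesis by (simp add: matrix_matrix_mult_def)
  qed
  then show ?thesis using f g by (simp add: acts_def)
qed

lemma acts_id: "acts (\<lambda>q. q) (mat 1)"
  by (simp add: acts_def mat_def if_distrib if_distribR sum.delta cong: if_cong)

lemma acts_faithful: "acts f M \<Longrightarrow> acts g M \<Longrightarrow> q \<in> HH \<Longrightarrow> f q = g q"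
  by (rule lift_inject) (auto simp: acts_def)

definition base :: "real \<Rightarrow> quat" where "base t = mkq t (\<lambda>_. 0)"
definition side :: "axis \<Rightarrow> quat" where "side i = mkq 1 (\<lambda>j. if j = i then 1 else 0)"

text \<open>An entry of the matrix of \<open>g\<close> is a fixed linear combination of values of \<open>lift \<circ> g\<close>
  at the five points \<open>1\<close>, \<open>2\<close>, \<open>1 + \<i>\<close>, \<open>1 + \<j>\<close>, \<open>1 + \<k>\<close>; this yields both the uniqueness
  of the matrix and the discreteness of the group.\<close>
fun entry :: "(quat \<Rightarrow> quat) \<Rightarrow> coord \<Rightarrow> coord \<Rightarrow> real" where
  "entry g c CB = (2 * lift (g (base 2)) c - lift (g (base 1)) c) / 3"
| "entry g c CA = lift (g (base 1)) c - (2 * lift (g (base 2)) c - lift (g (base 1)) c) / 3"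
| "entry g c (CV i) = lift (g (side i)) c - lift (g (base 1)) c
      - (2 * lift (g (base 2)) c - lift (g (base 1)) c) / 3"

lemma acts_entry:
  assumes "acts g M"
  shows "of_int (M$c$d) = entry g c d"
proof -
  have H: "base 1 \<in> HH" "base 2 \<in> HH" "\<And>i. side i \<in> HH"
    by (simp_all add: base_def side_def)
  have L: "\<And>q. q \<in> HH \<Longrightarrow> lift (g q) c = of_int (M$c$CA) * lift q CA + of_int (M$c$CB) * lift q CB
      + (\<Sum>i\<in>UNIV. of_int (M$c$(CV i)) * lift q (CV i))"
    using assms by (simp add: acts_def sum_coord)
  have b: "lift (g (base 1)) c = of_int (M$c$CA) + of_int (M$c$CB)"
    "lift (g (base 2)) c = of_int (M$c$CA) / 2 + of_int (M$c$CB) * 2"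
    using L[OF H(1)] L[OF H(2)] by (simp_all add: base_def norm_quat)
  have s: "lift (g (side i)) c = of_int (M$c$CA) + of_int (M$c$CB) * 2 + of_int (M$c$(CV i))" for i
    using L[OF H(3)] by (cases i; simp add: side_def norm_quat sum_axis)
  show ?thesis
    by (cases d) (simp_all add: b s field_simps)
qed

lemma acts_unique: "acts g M \<Longrightarrow> acts g N \<Longrightarrow> M = N"
  unfolding vec_eq_iff by (metis acts_entry of_int_eq_iff)

subsection \<open>Integral Lorentz matrices and the type of an element\<close>

text \<open>The inverse of the Gram matrix of |v|^2 - a b, whence -2 in place of -1/2. It is the
  form on rows, and preserving it is equivalent to preserving the original form on points.\<close>

definition Jm :: "int^coord^coord" where
  "Jm = (\<chi> c d. case (c, d) of (CA, CB) \<Rightarrow> -2 | (CB, CA) \<Rightarrow> -2 | (CV i, CV j) \<Rightarrow> of_bool (i = j) | _ \<Rightarrow> 0)"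

definition bil :: "int^coord \<Rightarrow> int^coord \<Rightarrow> int" where
  "bil m n = (\<Sum>i\<in>UNIV. m$(CV i) * n$(CV i)) - 2 * (m$CA * n$CB + m$CB * n$CA)"

definition lorentz :: "int^coord^coord \<Rightarrow> bool" where
  "lorentz M \<longleftrightarrow> M ** Jm ** transpose M = Jm"

lemma mult_Jm: "(M ** Jm ** transpose M)$c$d = bil (M$c) (M$d)"
proof -
  have 1: "(M ** Jm)$c$CA = -2 * M$c$CB" "(M ** Jm)$c$CB = -2 * M$c$CA"
    "(M ** Jm)$c$(CV i) = M$c$(CV i)" for i
    by (simp_all add: matrix_matrix_mult_def Jm_def sum_coord of_bool_def sum.delta if_distrib cong: if_cong)
  show ?thesis
    by (simp only: matrix_matrix_mult_def[of "M ** Jm"]) (simp add: sum_coord 1 transpose_def bil_def)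
qed

lemma lorentz_iff: "lorentz M \<longleftrightarrow> (\<forall>c d. bil (M$c) (M$d) = Jm$c$d)"
  by (simp add: lorentz_def vec_eq_iff mult_Jm)

lemma lorentz_mult: "lorentz M \<Longrightarrow> lorentz N \<Longrightarrow> lorentz (M ** N)"
  unfolding lorentz_def by (metis matrix_mul_assoc matrix_transpose_mul)

text \<open>Squares are 0 or 1 modulo 4, and three of them cannot reach 4 by ones alone. With four
  summands this would fail.\<close>

lemma even_sq_sum3: "even x \<and> even y \<and> even z" if "x*x + y*y + z*z = 4 * (k::int)" for x y z k
proof -
  have sq: "(n*n) mod 4 = (if even n then 0 else 1)" for n :: int
  proof (cases "even n")
    case False
    then obtain m where "n = 2*m+1" by (rule oddE)
    then have "n*n = 4*(m*m+m)+1" by (simp add: algebra_simps)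
    then have "n*n mod 4 = 1" by presburger
    then show ?thesis using False by simp
  qed (auto elim!: evenE)
  have "(x*x + y*y + z*z) mod 4 = 0" using that by simp
  then have "((x*x) mod 4 + (y*y) mod 4 + (z*z) mod 4) mod 4 = 0"
    by presburger
  then show ?thesis unfolding sq by (auto split: if_splits)
qed

text \<open>The rows of the two null coordinates are null vectors of \<open>bil\<close>, so their
  spatial parts satisfy |v|^2 = 4 A B.\<close>

lemma lorentz_null_even:
  assumes "lorentz M" "c = CA \<or> c = CB"
  shows "even (M$c$(CV i))"
proof -
  have "bil (M$c) (M$c) = 0" using assms unfolding lorentz_iff by (auto simp: Jm_def)
  then have "M$c$(CV AX) * M$c$(CV AX) + M$c$(CV AY) * M$c$(CV AY) + M$c$(CV AZ) * M$c$(CV AZ)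
      = 4 * (M$c$CA * M$c$CB)"
    by (simp add: bil_def sum_axis algebra_simps)
  from even_sq_sum3[OF this] show ?thesis by (cases i) auto
qed

text \<open>Modulo 2 the spatial block of a Lorentz matrix of the group is a permutation matrix;
  this works because the entries linking the two null coordinates to the spatial ones are even.\<close>
definition adm :: "int^coord^coord \<Rightarrow> (axis \<Rightarrow> axis) \<Rightarrow> bool" where
  "adm M p \<longleftrightarrow> lorentz M \<and> bij p \<and> (\<forall>i j. odd (M$(CV i)$(CV j)) \<longleftrightarrow> j = p i)"

lemma adm_unique: "adm M p \<Longrightarrow> adm M r \<Longrightarrow> p = r"
  by (auto simp: adm_def)

text \<open>The part of the product that passes through the null coordinates uses the null rows of
  \<open>N\<close>, whose spatial entries are even. Modulo 2 only the spatial blocks multiply: row i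
  leads to \<open>p i\<close>, then to \<open>r (p i)\<close>, which reverses the order of
  composition.\<close>

lemma adm_mult:
  assumes M: "adm M p" and N: "adm N r"
  shows "adm (M ** N) (r \<circ> p)"
proof -
  have "odd ((M ** N)$(CV i)$(CV j)) \<longleftrightarrow> j = r (p i)" for i j
  proof -
    have e: "even (N$CA$(CV j))" "even (N$CB$(CV j))"
      using N lorentz_null_even unfolding adm_def by blast+
    have "even (M$(CV i)$(CV k) * N$(CV k)$(CV j) - of_bool (k = p i \<and> j = r k))" for k
    proof -
      have "odd (M$(CV i)$(CV k)) \<longleftrightarrow> k = p i" "odd (N$(CV k)$(CV j)) \<longleftrightarrow> j = r k"
        using M N unfolding adm_def by blast+
      then show ?thesis by (cases "k = p i"; cases "j = r k"; simp)
    qed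
    then have "even (\<Sum>k\<in>UNIV. M$(CV i)$(CV k) * N$(CV k)$(CV j) - of_bool (k = p i \<and> j = r k))"
      by (intro dvd_sum) auto
    moreover have "(\<Sum>k\<in>UNIV. of_bool (k = p i \<and> j = r k)) = (of_bool (j = r (p i)) :: int)"
    proof -
      have "(\<Sum>k\<in>UNIV. of_bool (k = p i \<and> j = r k)) = (\<Sum>k\<in>UNIV. if k = p i then of_bool (j = r k) else (0::int))"
        by (intro sum.cong) auto
      then show ?thesis by (simp add: sum.delta)
    qed
    ultimately have "even ((\<Sum>k\<in>UNIV. M$(CV i)$(CV k) * N$(CV k)$(CV j)) - of_bool (j = r (p i)))"
      by (simp add: sum_subtractf)
    then have "odd (\<Sum>k\<in>UNIV. M$(CV i)$(CV k) * N$(CV k)$(CV j)) \<longleftrightarrow> j = r (p i)"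
      by (auto simp: of_bool_def split: if_splits)
    then show ?thesis
      using e by (simp add: matrix_matrix_mult_def sum_coord)
  qed
  then show ?thesis
    using M N unfolding adm_def by (auto intro: lorentz_mult bij_comp)
qed

definition has_type :: "(quat \<Rightarrow> quat) \<Rightarrow> (axis \<Rightarrow> axis) \<Rightarrow> int \<Rightarrow> bool" where
  "has_type g p \<delta> \<longleftrightarrow> (\<exists>M. acts g M \<and> adm M p \<and> det M = \<delta>)"

lemma has_type_unique: "has_type g p \<delta> \<Longrightarrow> has_type g r \<epsilon> \<Longrightarrow> p = r \<and> \<delta> = \<epsilon>"
  unfolding has_type_def using acts_unique adm_unique by blast

lemma has_type_comp: "has_type f p \<delta> \<Longrightarrow> has_type g r \<epsilon> \<Longrightarrow> has_type (\<lambda>q. f (g q)) (r \<circ> p) (\<delta> * \<epsilon>)"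
  unfolding has_type_def using acts_comp adm_mult det_mul by blast

lemma has_type_cong: "has_type f p \<delta> \<Longrightarrow> (\<And>q. q \<in> HH \<Longrightarrow> f q = g q) \<Longrightarrow> has_type g p \<delta>"
  unfolding has_type_def using acts_cong by blast

lemma has_type_id: "has_type (\<lambda>q. q) id 1"
proof -
  have "adm (mat 1) id"
    unfolding adm_def by (intro conjI) (simp_all add: lorentz_def transpose_mat, auto simp: mat_def)
  then show ?thesis unfolding has_type_def using acts_id det_I by blast
qed

lemma has_type_bij: "has_type g p \<delta> \<Longrightarrow> bij p"
  by (auto simp: has_type_def adm_def)

lemma has_type_inverse:
  assumes "has_type f p \<delta>" "has_type g r \<epsilon>" "\<And>q. q \<in> HH \<Longrightarrow> f (g q) = q"
  shows "r \<circ> p = id" "\<delta> * \<epsilon> = 1"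
  using has_type_unique[OF has_type_cong[OF has_type_comp[OF assms(1,2)]] has_type_id] assms(3) by auto

subsection \<open>The elementary isometries\<close>

definition sinv :: "quat \<Rightarrow> quat" where
  "sinv q = (1 / (norm q)\<^sup>2) *\<^sub>R q"

definition sgnv :: "(axis \<Rightarrow> int) \<Rightarrow> bool" where
  "sgnv \<epsilon> \<longleftrightarrow> (\<forall>i. \<epsilon> i = 1 \<or> \<epsilon> i = -1)"

text \<open>The new coordinate i is read from the old coordinate \<open>p i\<close>, so composing
  maps reverses the permutations, in agreement with the row convention of
  \<open>adm\<close>.\<close>

definition sperm :: "(axis \<Rightarrow> int) \<Rightarrow> (axis \<Rightarrow> axis) \<Rightarrow> quat \<Rightarrow> quat" where
  "sperm \<epsilon> p q = mkq (qRe q) (\<lambda>i. of_int (\<epsilon> i) * qim q (p i))"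

definition lat :: "(axis \<Rightarrow> int) \<Rightarrow> quat" where
  "lat w = mkq 0 (\<lambda>i. of_int (w i))"

lemma qRe_lat [simp]: "qRe (lat w) = 0"
  and qim_lat [simp]: "qim (lat w) i = of_int (w i)"
  by (simp_all add: lat_def)

lemma qRe_sperm [simp]: "qRe (sperm \<epsilon> p q) = qRe q"
  and qim_sperm [simp]: "qim (sperm \<epsilon> p q) i = of_int (\<epsilon> i) * qim q (p i)"
  by (simp_all add: sperm_def)

lemma lattice_L_eq: "lattice_L = range lat"
proof
  show "lattice_L \<subseteq> range lat"
  proof
    fix x assume "x \<in> lattice_L"
    then obtain b c d where "x = quat_of 0 (of_int b) (of_int c) (of_int d)"
      unfolding lattice_L_def by blast
    then have "x = lat (\<lambda>i. case i of AX \<Rightarrow> b | AY \<Rightarrow> c | AZ \<Rightarrow> d)"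
      by (simp add: lat_def mkq_def)
    then show "x \<in> range lat" by blast
  qed
qed (auto simp: lattice_L_def lat_def mkq_def)

lemma sgnv_sq: "sgnv \<epsilon> \<Longrightarrow> \<epsilon> i * \<epsilon> i = 1"
  unfolding sgnv_def by (metis mult_1 mult_minus1 minus_minus)

lemma sgnv_sq_real: "sgnv \<epsilon> \<Longrightarrow> (of_int (\<epsilon> i))\<^sup>2 = (1::real)"
  unfolding sgnv_def by (metis of_int_1 of_int_minus one_power2 power2_minus)

lemma norm_sperm: "sgnv \<epsilon> \<Longrightarrow> bij p \<Longrightarrow> (norm (sperm \<epsilon> p q))\<^sup>2 = (norm q)\<^sup>2"
  using sum.reindex_bij_betw[of p UNIV UNIV "\<lambda>i. (qim q i)\<^sup>2"]
  by (simp add: norm_quat power_mult_distrib sgnv_sq_real)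

lemma qRe_sinv: "qRe (sinv q) = qRe q / (norm q)\<^sup>2"
  and qim_sinv: "qim (sinv q) i = qim q i / (norm q)\<^sup>2"
  by (simp_all add: sinv_def)

lemma norm_sinv: "q \<in> HH \<Longrightarrow> (norm (sinv q))\<^sup>2 = 1 / (norm q)\<^sup>2"
  using norm_pos_HH[of q] by (simp add: sinv_def power2_eq_square)

lemma sinv_HH: "q \<in> HH \<Longrightarrow> sinv q \<in> HH"
  using norm_pos_HH[of q] by (simp add: qRe_sinv)

lemma sinv_sinv: "q \<in> HH \<Longrightarrow> sinv (sinv q) = q"
  using norm_pos_HH[of q] by (intro quat_eqI) (simp_all add: qRe_sinv qim_sinv norm_sinv)

lemma sperm_sperm: "sperm \<epsilon> p (sperm \<eta> r q) = sperm (\<lambda>i. \<epsilon> i * \<eta> (p i)) (r \<circ> p) q"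
  by (rule quat_eqI) simp_all

lemma sperm_one: "sperm (\<lambda>_. 1) id q = q"
  by (rule quat_eqI) simp_all

lemma sperm_sinv: "sgnv \<epsilon> \<Longrightarrow> bij p \<Longrightarrow> sperm \<epsilon> p (sinv q) = sinv (sperm \<epsilon> p q)"
  by (rule quat_eqI) (simp_all add: qRe_sinv qim_sinv norm_sperm)

lemma sperm_add_lat: "sperm \<epsilon> p (q + lat w) = sperm \<epsilon> p q + lat (\<lambda>i. \<epsilon> i * w (p i))"
  by (rule quat_eqI) (simp_all add: algebra_simps)

lemma qinv_sinv: "qinv q = sinv (sperm (\<lambda>_. -1) id q)"
proof -
  have s: "sgnv (\<lambda>_. -1)" by (simp add: sgnv_def)
  have c: "qRe (qconj q) = qRe q" "qim (qconj q) i = - qim q i" for i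
    by (simp add: qconj_def qRe_def) (cases i; simp add: qconj_def qim.simps)
  show ?thesis
    by (rule quat_eqI) (simp_all add: qinv_def qRe_sinv qim_sinv norm_sperm[OF s bij_id] c)
qed

section \<open>Matrices of the elementary isometries\<close>

definition MR :: "int^coord^coord" where
  "MR = (\<chi> c d. case (c, d) of (CA, CB) \<Rightarrow> 1 | (CB, CA) \<Rightarrow> 1 | (CV i, CV j) \<Rightarrow> of_bool (i = j) | _ \<Rightarrow> 0)"

definition MB :: "(axis \<Rightarrow> int) \<Rightarrow> (axis \<Rightarrow> axis) \<Rightarrow> int^coord^coord" where
  "MB \<epsilon> p = (\<chi> c d. case (c, d) of (CA, CA) \<Rightarrow> 1 | (CB, CB) \<Rightarrow> 1
     | (CV i, CV j) \<Rightarrow> \<epsilon> i * of_bool (j = p i) | _ \<Rightarrow> 0)"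

text \<open>The \<open>CB\<close> row expresses |q + w|^2 = |q|^2 + 2 w.v + |w|^2. The entries live
  in an arbitrary ring because the determinant is found by halving w over the reals.\<close>

definition MT :: "(axis \<Rightarrow> 'a) \<Rightarrow> 'a::comm_ring_1^coord^coord" where
  "MT w = (\<chi> c d. case (c, d) of (CA, CA) \<Rightarrow> 1 | (CB, CB) \<Rightarrow> 1
     | (CB, CA) \<Rightarrow> (\<Sum>i\<in>UNIV. w i * w i) | (CB, CV i) \<Rightarrow> 2 * w i
     | (CV i, CA) \<Rightarrow> w i | (CV i, CV j) \<Rightarrow> of_bool (i = j) | _ \<Rightarrow> 0)"

lemma sum_of_bool_mult:
  "(\<Sum>j\<in>UNIV. of_bool (j = i) * f j) = f i" "(\<Sum>j\<in>UNIV. of_bool (i = j) * f j) = f i"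
  "(\<Sum>j\<in>UNIV. f j * of_bool (j = i)) = f i" "(\<Sum>j\<in>UNIV. f j * of_bool (i = j)) = f i"
  for f :: "axis \<Rightarrow> 'a::comm_ring_1" and i :: axis
  by (simp_all add: of_bool_def if_distrib if_distribR sum.delta sum.delta' cong: if_cong)

lemma acts_sinv: "acts sinv MR"
proof -
  have "lift (sinv q) c = (\<Sum>d\<in>UNIV. of_int (MR$c$d) * lift q d)" if q: "q \<in> HH" for q c
    using norm_pos_HH[OF q] q
    by (cases c) (simp_all add: sum_coord MR_def qRe_sinv qim_sinv norm_sinv sum_of_bool_mult flip: sum_divide_distrib)
  then show ?thesis using sinv_HH by (simp add: acts_def)
qed

lemma acts_sperm: 
  assumes "sgnv \<epsilon>" "bij p"
  shows "acts (sperm \<epsilon> p) (MB \<epsilon> p)"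
proof -
  have "lift (sperm \<epsilon> p q) c = (\<Sum>d\<in>UNIV. of_int (MB \<epsilon> p$c$d) * lift q d)" if q: "q \<in> HH" for q c
  proof (cases c)
    case (CV i)
    have "(\<Sum>j\<in>UNIV. of_int (\<epsilon> i * of_bool (j = p i)) * lift q (CV j))
        = (\<Sum>j\<in>UNIV. of_bool (j = p i) * (of_int (\<epsilon> i) * lift q (CV j)))"
      by (intro sum.cong) auto
    then show ?thesis
      unfolding sum_of_bool_mult by (simp add: CV sum_coord MB_def)
  qed (use assms in \<open>simp_all add: sum_coord MB_def norm_sperm\<close>)
  then show ?thesis by (simp add: acts_def)
qed

lemma acts_add_lat: "acts (\<lambda>q. q + lat w) (MT w)"
proof -
  have "lift (q + lat w) c = (\<Sum>d\<in>UNIV. of_int (MT w$c$d) * lift q d)" if q: "q \<in> HH" for q c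
  proof (cases c)
    case CB
    have "(norm (q + lat w))\<^sup>2 = (norm q)\<^sup>2 + 2 * (\<Sum>i\<in>UNIV. of_int (w i) * qim q i) + (\<Sum>i\<in>UNIV. (of_int (w i * w i)))"
      unfolding norm_quat by (simp add: sum_axis power2_eq_square algebra_simps)
    then show ?thesis
      using q by (simp add: CB sum_coord MT_def add_divide_distrib sum_divide_distrib sum_distrib_left mult.assoc)
  qed (use q in \<open>simp_all add: sum_coord MT_def sum_of_bool_mult add_divide_distrib flip: sum_divide_distrib\<close>)
  then show ?thesis by (simp add: acts_def)
qed

lemma lorentz_MR: "lorentz MR"
  unfolding lorentz_iff by (auto simp: all_coord bil_def MR_def Jm_def sum_of_bool_mult)

lemma lorentz_MB:
  assumes "sgnv \<epsilon>" "bij p"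
  shows "lorentz (MB \<epsilon> p)"
proof -
  have "(\<Sum>k\<in>UNIV. \<epsilon> i * of_bool (k = p i) * (\<epsilon> j * of_bool (k = p j))) = of_bool (i = j)" for i j
  proof -
    have "(\<Sum>k\<in>UNIV. \<epsilon> i * of_bool (k = p i) * (\<epsilon> j * of_bool (k = p j)))
        = (\<Sum>k\<in>UNIV. of_bool (k = p i) * (\<epsilon> i * \<epsilon> j * of_bool (k = p j)))"
      by (intro sum.cong) auto
    also have "\<dots> = \<epsilon> i * \<epsilon> j * of_bool (p i = p j)"
      unfolding sum_of_bool_mult ..
    also have "\<dots> = of_bool (i = j)"
      using sgnv_sq[OF assms(1), of i] bij_is_inj[OF assms(2)] by (auto simp: inj_def)
    finally show ?thesis .
  qed
  then show ?thesis
    unfolding lorentz_iff by (auto simp: all_coord bil_def MB_def Jm_def)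
qed

lemma lorentz_MT: "lorentz (MT w)"
  unfolding lorentz_iff by (simp add: all_coord all_axis bil_def MT_def Jm_def sum_axis algebra_simps)

lemma adm_MR: "adm MR id"
  unfolding adm_def using lorentz_MR by (auto simp: MR_def)

lemma adm_MB: 
  assumes "sgnv \<epsilon>" "bij p"
  shows "adm (MB \<epsilon> p) p"
proof -
  have "odd (\<epsilon> i)" for i using assms(1) unfolding sgnv_def by (metis even_minus odd_one)
  then show ?thesis
    unfolding adm_def using lorentz_MB[OF assms] assms(2) by (auto simp: MB_def)
qed

lemma adm_MT: "adm (MT w) id"
  unfolding adm_def using lorentz_MT by (auto simp: MT_def)

lemma MT_add: "MT w ** MT u = MT (\<lambda>i. w i + u i)"
  by (simp add: vec_eq_iff all_coord all_axis matrix_matrix_mult_def sum_coord MT_def sum_axis algebra_simps)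

lemma MT_zero: "MT (\<lambda>_. 0) = mat 1"
proof -
  have "MT (\<lambda>_. 0)$c$d = (mat 1 :: 'a^coord^coord)$c$d" for c d
    by (cases c; cases d) (simp_all add: MT_def mat_def)
  then show ?thesis by (simp add: vec_eq_iff)
qed

section \<open>Determinants and types of the elementary isometries\<close>

lemma det_of_int: "det (\<chi> i j. real_of_int (M$i$j)) = of_int (det M)"
  by (simp add: det_def)

text \<open>Halving the translation vector shows that the determinant is a real square.\<close>
lemma det_MT: "det (MT w :: int^coord^coord) = 1"
proof -
  let ?w = "\<lambda>i. real_of_int (w i)"
  have "(\<chi> i j. real_of_int (MT w$i$j)) = MT ?w"
    by (simp add: vec_eq_iff all_coord MT_def)
  also have "\<dots> = MT (\<lambda>i. ?w i / 2) ** MT (\<lambda>i. ?w i / 2)"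
    by (simp add: MT_add)
  finally have "real_of_int (det (MT w)) = det (MT (\<lambda>i. ?w i / 2)) * det (MT (\<lambda>i. ?w i / 2))"
    by (simp add: det_mul flip: det_of_int)
  then have "real_of_int (det (MT w)) \<ge> 0" by simp
  moreover have "det (MT w) * det (MT (\<lambda>i. - w i)) = 1"
    by (simp add: det_I MT_zero MT_add flip: det_mul)
  ultimately show ?thesis
    by (auto simp: zmult_eq_1_iff)
qed

text \<open>The inversion exchanges the two null coordinates and fixes the spatial ones, so its
  matrix is the identity with two rows swapped.\<close>

lemma det_MR: "det MR = -1"
proof -
  let ?p = "Transposition.transpose CA CB"
  have "MR = (\<chi> i. (mat 1 :: int^coord^coord)$(?p i))"
    by (simp add: vec_eq_iff all_coord MR_def mat_def Transposition.transpose_def)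
  also have "det \<dots> = of_int (sign ?p) * det (mat 1 :: int^coord^coord)"
    by (intro det_permute_rows permutes_swap_id) auto
  finally show ?thesis by (simp add: sign_swap_id det_I)
qed

lemma has_type_sinv: "has_type sinv id (-1)"
  unfolding has_type_def using acts_sinv adm_MR det_MR by blast

lemma has_type_add_lat: "has_type (\<lambda>q. q + lat w) id 1"
  unfolding has_type_def using acts_add_lat adm_MT det_MT by blast

lemma has_type_sperm: "sgnv \<epsilon> \<Longrightarrow> bij p \<Longrightarrow> has_type (sperm \<epsilon> p) p (det (MB \<epsilon> p))"
  unfolding has_type_def using acts_sperm adm_MB by blast

lemma has_type_sign: 
  assumes "sgnv \<epsilon>"
  shows "has_type (sperm \<epsilon> id) id (\<Prod>i\<in>UNIV. \<epsilon> i)"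
proof -
  have "det (MB \<epsilon> id) = (\<Prod>c\<in>UNIV. MB \<epsilon> id$c$c)"
    by (intro det_diagonal) (auto simp: MB_def split: coord.split)
  also have "\<dots> = (\<Prod>i\<in>UNIV. \<epsilon> i)"
    unfolding UNIV_coord by (subst prod.insert; (subst prod.insert)?; auto simp: MB_def prod.reindex inj_on_def)
  finally show ?thesis using has_type_sperm[OF assms bij_id] by simp
qed

text \<open>The three sign changes of conjugation contribute (-1)^3, which cancels the -1 of
  \<open>sinv\<close>.\<close>

lemma has_type_qinv: "has_type qinv id 1"
proof -
  have "has_type (\<lambda>q. sinv (sperm (\<lambda>_. -1) id q)) (id \<circ> id) (-1 * (\<Prod>i::axis\<in>UNIV. -1))"
    by (intro has_type_comp has_type_sinv has_type_sign) (simp add: sgnv_def)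
  then show ?thesis unfolding prod_axis qinv_sinv[symmetric] by simp
qed

fun cyc :: "axis \<Rightarrow> axis" where
  "cyc AX = AY" | "cyc AY = AZ" | "cyc AZ = AX"

lemma cyc3: "cyc \<circ> cyc \<circ> cyc = id"
proof
  show "(cyc \<circ> cyc \<circ> cyc) i = id i" for i by (cases i) simp_all
qed

lemma bij_cyc: "bij cyc"
  using cyc3 by (intro o_bij[of "cyc \<circ> cyc"]) (simp_all add: o_assoc)

text \<open>The map has order three, so its determinant is an integer with cube 1; no determinant
  has to be expanded.\<close>

lemma has_type_cyc: "has_type (sperm (\<lambda>_. 1) cyc) cyc 1"
proof -
  let ?d = "det (MB (\<lambda>_. 1) cyc)"
  have t: "has_type (sperm (\<lambda>_. 1) cyc) cyc ?d"
    by (rule has_type_sperm) (simp_all add: sgnv_def bij_cyc)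
  have "has_type (\<lambda>q. q) ((cyc \<circ> cyc) \<circ> cyc) (?d * (?d * ?d))"
    by (rule has_type_cong[OF has_type_comp[OF t has_type_comp[OF t t]]])
      (simp add: sperm_sperm cyc3 sperm_one)
  then have "?d * (?d * ?d) = 1" using has_type_unique[OF _ has_type_id] by blast
  then have "?d = 1" by (metis zmult_eq_1_iff mult_minus1 minus_one_mult_self mult_1 zero_neq_neg_one one_neq_neg_one)
  then show ?thesis using t by simp
qed

lemma has_type_even:
  assumes "sgnv \<epsilon>" "p \<in> {id, cyc, cyc \<circ> cyc}"
  shows "has_type (sperm \<epsilon> p) p (\<Prod>i\<in>UNIV. \<epsilon> i)"
proof -
  have p: "has_type (sperm (\<lambda>_. 1) p) p 1"
    using assms(2) has_type_cyc has_type_comp[OF has_type_cyc has_type_cyc]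
      has_type_sign[of "\<lambda>_. 1"]
    by (auto simp: sperm_sperm sgnv_def)
  show ?thesis
    using has_type_comp[OF has_type_sign[OF assms(1)] p] by (simp add: sperm_sperm)
qed

subsection \<open>The face reflections of the simplex\<close>

definition unitv :: "axis \<Rightarrow> axis \<Rightarrow> int" where "unitv i j = (if j = i then 1 else 0)"
definition neg1 :: "axis \<Rightarrow> axis \<Rightarrow> int" where "neg1 i j = (if j = i then -1 else 1)"
definition tXY :: "axis \<Rightarrow> axis" where "tXY = Transposition.transpose AX AY"
definition tYZ :: "axis \<Rightarrow> axis" where "tYZ = Transposition.transpose AY AZ"

text \<open>\<open>s1\<close> to \<open>s4\<close> are the reflections in x = 1/2, x = y, y = z and
  z = 0, the faces opposite \<open>vA\<close>, \<open>vB\<close>, \<open>vC\<close>,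
  \<open>vD\<close>; the face opposite infinity belongs to \<open>sinv\<close>.\<close>

definition s1 :: "quat \<Rightarrow> quat" where "s1 q = sperm (neg1 AX) id q + lat (unitv AX)"
definition s2 :: "quat \<Rightarrow> quat" where "s2 = sperm (\<lambda>_. 1) tXY"
definition s3 :: "quat \<Rightarrow> quat" where "s3 = sperm (\<lambda>_. 1) tYZ"
definition s4 :: "quat \<Rightarrow> quat" where "s4 = sperm (neg1 AZ) id"

lemma tXY_simps [simp]: "tXY AX = AY" "tXY AY = AX" "tXY AZ = AZ"
  and tYZ_simps [simp]: "tYZ AX = AX" "tYZ AY = AZ" "tYZ AZ = AY"
  by (simp_all add: tXY_def tYZ_def Transposition.transpose_def)

lemma bij_tXY: "bij tXY" and bij_tYZ: "bij tYZ"
  by (simp_all add: tXY_def tYZ_def)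

lemma inner_quat: "inner p q = qRe p * qRe q + (\<Sum>i\<in>UNIV. qim p i * qim q i)" for p q :: quat
  by (simp add: inner_prod_def inner_complex_def sum_axis qRe_def qim.simps)

lemma vertex_mkq:
  "qRe vA = 1" "qim vA AX = 0" "qim vA AY = 0" "qim vA AZ = 0"
  "qRe vB = sqrt 3 / 2" "qim vB AX = 1/2" "qim vB AY = 0" "qim vB AZ = 0"
  "qRe vC = 1 / sqrt 2" "qim vC AX = 1/2" "qim vC AY = 1/2" "qim vC AZ = 0"
  "qRe vD = 1/2" "qim vD AX = 1/2" "qim vD AY = 1/2" "qim vD AZ = 1/2"
  by (simp_all add: vA_def vB_def vC_def vD_def quat_of_def qRe_def qim.simps)

lemma vertices_distinct: "vA \<noteq> vB" "vA \<noteq> vC" "vA \<noteq> vD" "vB \<noteq> vC" "vB \<noteq> vD" "vC \<noteq> vD"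
  using vertex_mkq by force+

lemma norm_vertex: "norm vA = 1" "norm vB = 1" "norm vC = 1" "norm vD = 1"
proof -
  have "(norm vA)\<^sup>2 = 1" "(norm vB)\<^sup>2 = 1" "(norm vC)\<^sup>2 = 1" "(norm vD)\<^sup>2 = 1"
    by (simp_all add: norm_quat sum_axis vertex_mkq power_divide)
  then show "norm vA = 1" "norm vB = 1" "norm vC = 1" "norm vD = 1"
    by (metis abs_norm_cancel power2_eq_1_iff abs_1 abs_minus_cancel)+
qed

lemma on_VPlane: "on_hplane (Fin p) (VPlane n c) \<longleftrightarrow> p \<in> HH \<and> inner n p = c"
  by auto

lemma vertices_HH: "vA \<in> HH" "vB \<in> HH" "vC \<in> HH" "vD \<in> HH"
  by (simp_all add: vertex_mkq)

lemma refl_VPlane: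
  assumes "qRe n = 0"
  shows "qRe (hrefl (VPlane n c) q) = qRe q"
    "qim (hrefl (VPlane n c) q) i = qim q i - 2 * (inner n q - c) / (norm n)\<^sup>2 * qim n i"
  using assms by simp_all

lemma hrefl_s0: "hrefl (HSphere 0 1) = sinv"
  by (rule ext) (simp add: sinv_def)

text \<open>A vertical hyperplane is described by every multiple of its normal. The reflection does
  not change under this scaling, so \<open>n\<close> remains arbitrary here and in the three lemmas
  that follow.\<close>

lemma hrefl_s1:
  assumes "qRe n = 0" "n \<noteq> 0" "qim n AY = 0" "qim n AZ = 0" "c = qim n AX / 2"
  shows "hrefl (VPlane n c) = s1"
proof
  fix q
  have "qim n AX \<noteq> 0" using assms quat_eqI3[of n 0] by auto
  then show "hrefl (VPlane n c) q = s1 q"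
    using assms
    by (intro quat_eqI3;
      simp add: s1_def refl_VPlane inner_quat norm_quat sum_axis neg1_def unitv_def del: hrefl.simps)
      (simp add: field_simps power2_eq_square)
qed

lemma hrefl_s2:
  assumes "qRe n = 0" "n \<noteq> 0" "qim n AZ = 0" "qim n AX + qim n AY = 0"
  shows "hrefl (VPlane n 0) = s2"
proof
  fix q
  have y: "qim n AY = - qim n AX" using assms by simp
  then have "qim n AX \<noteq> 0" using assms quat_eqI3[of n 0] by auto
  then show "hrefl (VPlane n 0) q = s2 q"
    using assms(1,3) y
    by (intro quat_eqI3;
      simp add: s2_def refl_VPlane inner_quat norm_quat sum_axis del: hrefl.simps)
      (simp_all add: field_simps power2_eq_square)
qed

lemma hrefl_s3:
  assumes "qRe n = 0" "n \<noteq> 0" "qim n AX = 0" "qim n AY + qim n AZ = 0"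
  shows "hrefl (VPlane n 0) = s3"
proof
  fix q
  have y: "qim n AZ = - qim n AY" using assms by simp
  then have "qim n AY \<noteq> 0" using assms quat_eqI3[of n 0] by auto
  then show "hrefl (VPlane n 0) q = s3 q"
    using assms(1,3) y
    by (intro quat_eqI3;
      simp add: s3_def refl_VPlane inner_quat norm_quat sum_axis del: hrefl.simps)
      (simp_all add: field_simps power2_eq_square)
qed

lemma hrefl_s4:
  assumes "qRe n = 0" "n \<noteq> 0" "qim n AX = 0" "qim n AY = 0"
  shows "hrefl (VPlane n 0) = s4"
proof
  fix q
  have "qim n AZ \<noteq> 0" using assms quat_eqI3[of n 0] by auto
  then show "hrefl (VPlane n 0) q = s4 q"
    using assms
    by (intro quat_eqI3;
      simp add: s4_def refl_VPlane inner_quat norm_quat sum_axis neg1_def del: hrefl.simps)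
      (simp_all add: field_simps power2_eq_square)
qed

lemma inner_vertex:
  assumes "qRe n = 0"
  shows "inner n vA = 0" "inner n vB = qim n AX / 2" "inner n vC = (qim n AX + qim n AY) / 2"
    "inner n vD = (qim n AX + qim n AY + qim n AZ) / 2"
  using assms by (simp_all add: inner_quat sum_axis vertex_mkq field_simps)

text \<open>All four vertices have norm 1, so the squared distances to c differ only by terms linear
  in c. Equal distances therefore force the centre to be 0.\<close>

lemma dist_vertex:
  assumes "qRe c = 0"
  shows "(dist vA c)\<^sup>2 = 1 + (norm c)\<^sup>2" "(dist vB c)\<^sup>2 = 1 + (norm c)\<^sup>2 - qim c AX"
    "(dist vC c)\<^sup>2 = 1 + (norm c)\<^sup>2 - qim c AX - qim c AY"
    "(dist vD c)\<^sup>2 = 1 + (norm c)\<^sup>2 - qim c AX - qim c AY - qim c AZ"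
  unfolding dist_norm norm_quat using assms
  by (simp_all add: sum_axis vertex_mkq power2_diff power_divide field_simps)

lemma face_reflections_eq: "face_reflections Delta_L = {sinv, s1, s2, s3, s4}"
proof
  let ?V = "Delta_L"
  have V: "w \<in> ?V \<longleftrightarrow> w = Fin vA \<or> w = Fin vB \<or> w = Fin vC \<or> w = Fin vD \<or> w = Infty" for w
    by (auto simp: Delta_L_def)
  show "face_reflections ?V \<subseteq> {sinv, s1, s2, s3, s4}"
  proof
    fix f assume "f \<in> face_reflections ?V"
    then obtain H v where f: "f = hrefl H" and v: "v \<in> ?V" and wf: "wf_hplane H"
      and on: "\<And>w. w \<in> ?V \<Longrightarrow> w \<noteq> v \<Longrightarrow> on_hplane w H"
      unfolding face_reflections_def by blast
    have on': "on_hplane (Fin p) H" if "p \<in> {vA, vB, vC, vD}" "v \<noteq> Fin p" for p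
    proof -
      have "Fin p \<in> ?V" using that(1) by (auto simp: V)
      then show ?thesis using on that(2) by blast
    qed
    show "f \<in> {sinv, s1, s2, s3, s4}"
    proof (cases H)
      case (HSphere c r)
      \<comment> \<open>A hemisphere misses infinity, so infinity must be the omitted
        vertex.\<close>
      have "v = Infty" using on[of Infty] HSphere by (auto simp: V)
      then have d: "dist vA c = r" "dist vB c = r" "dist vC c = r" "dist vD c = r"
        using on' HSphere by auto
      have c0: "qRe c = 0" and r: "r > 0" using wf HSphere by auto
      have z: "qim c AX = 0" "qim c AY = 0" "qim c AZ = 0"
        using dist_vertex[OF c0] d by auto
      have "c = 0" by (rule quat_eqI3) (use c0 z in auto)
      moreover have "r = 1" using dist_vertex(1)[OF c0] d(1) r \<open>c = 0\<close>
        by (simp add: power2_eq_1_iff)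
      ultimately show ?thesis using f HSphere hrefl_s0 by simp
    next
      case (VPlane n c)
      have n: "n \<noteq> 0" "qRe n = 0" using wf VPlane by auto
      have A: "v \<noteq> Fin vA \<Longrightarrow> c = 0" and B: "v \<noteq> Fin vB \<Longrightarrow> c = qim n AX / 2"
        and C: "v \<noteq> Fin vC \<Longrightarrow> c = (qim n AX + qim n AY) / 2"
        and D: "v \<noteq> Fin vD \<Longrightarrow> c = (qim n AX + qim n AY + qim n AZ) / 2"
        using on'[of vA] on'[of vB] on'[of vC] on'[of vD] unfolding VPlane on_VPlane inner_vertex[OF n(2)]
        by (simp_all only: insert_iff simp_thms)
      consider "v = Fin vA" | "v = Fin vB" | "v = Fin vC" | "v = Fin vD" | "v = Infty"
        using v V by blast
      then show ?thesis
      proof cases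
        case 1
        then have "hrefl (VPlane n c) = s1"
          using B C D n vertices_distinct by (intro hrefl_s1) auto
        then show ?thesis using f VPlane by simp
      next
        case 2
        then have "c = 0" "hrefl (VPlane n 0) = s2"
          using A C D n vertices_distinct by (auto intro!: hrefl_s2)
        then show ?thesis using f VPlane by simp
      next
        case 3
        then have "c = 0" "hrefl (VPlane n 0) = s3"
          using A B D n vertices_distinct by (auto intro!: hrefl_s3)
        then show ?thesis using f VPlane by simp
      next
        case 4
        then have "c = 0" "hrefl (VPlane n 0) = s4"
          using A B C n vertices_distinct by (auto intro!: hrefl_s4)
        then show ?thesis using f VPlane by simp
      next
        \<comment> \<open>No vertical hyperplane contains all four finite vertices: the equations
          leave only the zero normal.\<close>
        case 5
        then have "qim n AX = 0" "qim n AY = 0" "qim n AZ = 0" using A B C D by auto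
        then have "n = 0" using n by (intro quat_eqI3) auto
        then show ?thesis using n by blast
      qed
    qed
  qed
  have I: "hrefl H \<in> face_reflections ?V" if "v \<in> ?V" "wf_hplane H"
    "v \<noteq> Fin vA \<Longrightarrow> on_hplane (Fin vA) H" "v \<noteq> Fin vB \<Longrightarrow> on_hplane (Fin vB) H"
    "v \<noteq> Fin vC \<Longrightarrow> on_hplane (Fin vC) H" "v \<noteq> Fin vD \<Longrightarrow> on_hplane (Fin vD) H"
    "v \<noteq> Infty \<Longrightarrow> on_hplane Infty H" for v H
  proof -
    have "on_hplane w H" if "w \<in> ?V - {v}" for w
      using V[of w] that \<open>v \<noteq> Fin vA \<Longrightarrow> _\<close> \<open>v \<noteq> Fin vB \<Longrightarrow> _\<close> \<open>v \<noteq> Fin vC \<Longrightarrow> _\<close>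
        \<open>v \<noteq> Fin vD \<Longrightarrow> _\<close> \<open>v \<noteq> Infty \<Longrightarrow> _\<close> by (metis Diff_iff singletonI)
    then show ?thesis unfolding face_reflections_def using that(1,2) by blast
  qed
  let ?n = "\<lambda>x y z. mkq 0 (\<lambda>i. case i of AX \<Rightarrow> x | AY \<Rightarrow> y | AZ \<Rightarrow> z)"
  have nz: "?n x y z \<noteq> 0" if "x \<noteq> 0 \<or> y \<noteq> 0 \<or> z \<noteq> 0" for x y z
    using that qim_mkq[of 0 "\<lambda>i. case i of AX \<Rightarrow> x | AY \<Rightarrow> y | AZ \<Rightarrow> z"] qim_zero
    by (metis axis.case)
  have "sinv \<in> face_reflections ?V"
    unfolding hrefl_s0[symmetric]
    by (rule I[of Infty]) (use vertices_HH norm_vertex in \<open>auto simp: V\<close>)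
  moreover have "s1 \<in> face_reflections ?V"
  proof -
    have "hrefl (VPlane (?n 1 0 0) (1/2)) \<in> face_reflections ?V"
      by (rule I[of "Fin vA"]) (use vertices_HH nz in \<open>auto simp: V inner_vertex\<close>)
    then show ?thesis by (subst (asm) hrefl_s1) (use nz in auto)
  qed
  moreover have "s2 \<in> face_reflections ?V"
  proof -
    have "hrefl (VPlane (?n 1 (-1) 0) 0) \<in> face_reflections ?V"
      by (rule I[of "Fin vB"]) (use vertices_HH nz in \<open>auto simp: V inner_vertex\<close>)
    then show ?thesis by (subst (asm) hrefl_s2) (use nz in auto)
  qed
  moreover have "s3 \<in> face_reflections ?V"
  proof -
    have "hrefl (VPlane (?n 0 1 (-1)) 0) \<in> face_reflections ?V"
      by (rule I[of "Fin vC"]) (use vertices_HH nz in \<open>auto simp: V inner_vertex\<close>)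
    then show ?thesis by (subst (asm) hrefl_s3) (use nz in auto)
  qed
  moreover have "s4 \<in> face_reflections ?V"
  proof -
    have "hrefl (VPlane (?n 0 0 1) 0) \<in> face_reflections ?V"
      by (rule I[of "Fin vD"]) (use vertices_HH nz in \<open>auto simp: V inner_vertex\<close>)
    then show ?thesis by (subst (asm) hrefl_s4) (use nz in auto)
  qed
  ultimately show "{sinv, s1, s2, s3, s4} \<subseteq> face_reflections ?V" by blast
qed

subsection \<open>Conjugation by Hurwitz units\<close>

definition qconjug :: "quat \<Rightarrow> quat \<Rightarrow> quat" where
  "qconjug u q = qmult (qmult u q) (qinv u)"

text \<open>The Euler-Rodrigues matrix of the rotation given by a unit quaternion.\<close>

lemma qconjug_coords:
  fixes a b c d :: real
  defines "u \<equiv> quat_of a b c d"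
  assumes u: "a\<^sup>2 + b\<^sup>2 + c\<^sup>2 + d\<^sup>2 = 1"
  shows "qRe (qconjug u q) = qRe q"
    "qim (qconjug u q) AX = (a*a + b*b - c*c - d*d) * qim q AX + 2*(b*c - a*d) * qim q AY + 2*(b*d + a*c) * qim q AZ"
    "qim (qconjug u q) AY = 2*(b*c + a*d) * qim q AX + (a*a - b*b + c*c - d*d) * qim q AY + 2*(c*d - a*b) * qim q AZ"
    "qim (qconjug u q) AZ = 2*(b*d - a*c) * qim q AX + 2*(c*d + a*b) * qim q AY + (a*a - b*b - c*c + d*d) * qim q AZ"
proof -
  have "(norm u)\<^sup>2 = 1"
    using u by (simp add: norm_quat sum_axis u_def quat_of_def qRe_def qim.simps)
  then have i: "qinv u = qconj u" by (simp add: qinv_def)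
  have "qRe (qconjug u q) = (a\<^sup>2 + b\<^sup>2 + c\<^sup>2 + d\<^sup>2) * qRe q"
    unfolding qconjug_def i
    by (simp add: qmult_def qconj_def u_def quat_of_def qRe_def power2_eq_square algebra_simps)
  then show "qRe (qconjug u q) = qRe q" using u by simp
  show "qim (qconjug u q) AX = (a*a + b*b - c*c - d*d) * qim q AX + 2*(b*c - a*d) * qim q AY + 2*(b*d + a*c) * qim q AZ"
    "qim (qconjug u q) AY = 2*(b*c + a*d) * qim q AX + (a*a - b*b + c*c - d*d) * qim q AY + 2*(c*d - a*b) * qim q AZ"
    "qim (qconjug u q) AZ = 2*(b*d - a*c) * qim q AX + 2*(c*d + a*b) * qim q AY + (a*a - b*b - c*c + d*d) * qim q AZ"
    unfolding qconjug_def i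
    by (simp_all add: qmult_def qconj_def u_def quat_of_def qim.simps algebra_simps)
qed

text \<open>The alternating group on the three axes.\<close>

definition eperm :: "(axis \<Rightarrow> axis) set" where "eperm = {id, cyc, cyc \<circ> cyc}"

definition signs :: "int \<Rightarrow> int \<Rightarrow> int \<Rightarrow> axis \<Rightarrow> int" where
  "signs x y z i = (case i of AX \<Rightarrow> x | AY \<Rightarrow> y | AZ \<Rightarrow> z)"

lemma signs_simps [simp]: "signs x y z AX = x" "signs x y z AY = y" "signs x y z AZ = z"
  by (simp_all add: signs_def)

lemma sgnv_signs: "sgnv (signs x y z) \<longleftrightarrow> x \<in> {1, -1} \<and> y \<in> {1, -1} \<and> z \<in> {1, -1}"
  by (auto simp: sgnv_def all_axis)

lemma hurwitz_cases:
  assumes "u \<in> hurwitz_units"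
  obtains (lipschitz) a b c d where "u = quat_of a b c d"
      "(a, b, c, d) \<in> {(1,0,0,0), (-1,0,0,0), (0,1,0,0), (0,-1,0,0), (0,0,1,0), (0,0,-1,0), (0,0,0,1), (0,0,0,-1)}"
  | (half) a b c d :: int where "u = quat_of (a/2) (b/2) (c/2) (d/2)"
      "a \<in> {1,-1}" "b \<in> {1,-1}" "c \<in> {1,-1}" "d \<in> {1,-1}"
proof -
  consider a b c d :: real where "u = quat_of a b c d" "{a, b, c, d} \<subseteq> {-1, 0, 1}" "a\<^sup>2 + b\<^sup>2 + c\<^sup>2 + d\<^sup>2 = 1"
    | a b c d :: real where "u = quat_of a b c d" "{a, b, c, d} \<subseteq> {-1/2, 1/2}"
    using assms unfolding hurwitz_units_def by blast
  then show ?thesis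
  proof cases
    case 1
    then have "a = -1 \<or> a = 0 \<or> a = 1" "b = -1 \<or> b = 0 \<or> b = 1" "c = -1 \<or> c = 0 \<or> c = 1" "d = -1 \<or> d = 0 \<or> d = 1"
      by auto
    then have "(a, b, c, d) \<in> {(1,0,0,0), (-1,0,0,0), (0,1,0,0), (0,-1,0,0), (0,0,1,0), (0,0,-1,0), (0,0,0,1), (0,0,0,-1)}"
      using 1(3) by (elim disjE; simp)
    then show ?thesis using 1(1) lipschitz by blast
  next
    case 2
    have e: "\<exists>k::int. x = k/2 \<and> k \<in> {1,-1::int}" if "x \<in> {-1/2, 1/2}" for x :: real
      using that by (auto intro: exI[of _ 1] exI[of _ "-1"])
    have m: "a \<in> {-1/2, 1/2}" "b \<in> {-1/2, 1/2}" "c \<in> {-1/2, 1/2}" "d \<in> {-1/2, 1/2}"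
      using 2(2) by simp_all
    obtain a' :: int where a: "a = a'/2 \<and> a' \<in> {1,-1::int}" using e[OF m(1)] by (rule exE)
    obtain b' :: int where b: "b = b'/2 \<and> b' \<in> {1,-1::int}" using e[OF m(2)] by (rule exE)
    obtain c' :: int where c: "c = c'/2 \<and> c' \<in> {1,-1::int}" using e[OF m(3)] by (rule exE)
    obtain d' :: int where d: "d = d'/2 \<and> d' \<in> {1,-1::int}" using e[OF m(4)] by (rule exE)
    show ?thesis using half[of a' b' c' d'] 2(1) a b c d by simp
  qed
qed

text \<open>For a half unit the diagonal of the rotation matrix vanishes, and the off-diagonal
  entries are (bc - ad)/2, (bd + ac)/2 and so on, each being 0 or a sign. Whether
  \<open>a*b*c*d\<close> is -1 or 1 decides which entry of each row survives, hence which of the two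
  3-cycles occurs.\<close>

lemma qconjug_half:
  fixes a b c d :: int
  assumes "a \<in> {1,-1}" "b \<in> {1,-1}" "c \<in> {1,-1}" "d \<in> {1,-1}"
  shows "qconjug (quat_of (a/2) (b/2) (c/2) (d/2)) q =
    (if a*b*c*d = -1 then sperm (signs (b*c) (c*d) (b*d)) cyc q
     else sperm (signs (b*d) (b*c) (c*d)) (cyc \<circ> cyc) q)"
proof -
  have n: "(a/2)\<^sup>2 + (b/2)\<^sup>2 + (c/2)\<^sup>2 + (d/2)\<^sup>2 = (1::real)"
    using assms by (auto simp: power_divide)
  show ?thesis
    using assms
    by (intro quat_eqI3; simp only: qconjug_coords[OF n]) (auto simp: sgnv_def)
qed

lemma qconjug_hurwitz:
  assumes "u \<in> hurwitz_units"
  obtains \<epsilon> p where "sgnv \<epsilon>" "p \<in> eperm" "(\<Prod>i\<in>UNIV. \<epsilon> i) = 1" "qconjug u = sperm \<epsilon> p"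
  using assms
proof (cases rule: hurwitz_cases)
  case (lipschitz a b c d)
  have n: "a\<^sup>2 + b\<^sup>2 + c\<^sup>2 + d\<^sup>2 = 1" using lipschitz(2) by auto
  have q: "\<exists>x y z. x \<in> {1,-1} \<and> y \<in> {1,-1} \<and> z \<in> {1,-1} \<and> x*y*z = 1 \<and>
      (\<forall>q. qconjug u q = sperm (signs x y z) id q)"
  proof -
    \<comment> \<open>A coordinate keeps its sign exactly if the unit is real or lies on the same
      imaginary axis; the other two imaginary units reverse it.\<close>
    let ?x = "if a = 0 \<and> b = 0 then -1 else 1::int" and ?y = "if a = 0 \<and> c = 0 then -1 else 1::int"
      and ?z = "if a = 0 \<and> d = 0 then -1 else 1::int"
    have "qconjug u q = sperm (signs ?x ?y ?z) id q" for q
      unfolding lipschitz(1) using lipschitz(2)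
      by (intro quat_eqI3; simp only: qconjug_coords[OF n]) auto
    moreover have "?x * ?y * ?z = 1" using lipschitz(2) by auto
    ultimately show ?thesis by (intro exI[of _ ?x] exI[of _ ?y] exI[of _ ?z]) auto
  qed
  then obtain x y z where "sgnv (signs x y z)" "x*y*z = 1" "qconjug u = sperm (signs x y z) id"
    by (auto simp: sgnv_signs fun_eq_iff)
  then show ?thesis using that[of "signs x y z" id] by (simp add: prod_axis eperm_def)
next
  case (half a b c d)
  show ?thesis
  proof (cases "a*b*c*d = -1")
    case True
    then have "qconjug u = sperm (signs (b*c) (c*d) (b*d)) cyc"
      using qconjug_half[OF half(2-5)] half(1) by auto
    then show ?thesis
      using half(2-5) by (intro that[of "signs (b*c) (c*d) (b*d)" cyc]) (auto simp: sgnv_signs prod_axis eperm_def)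
  next
    case False
    then have "qconjug u = sperm (signs (b*d) (b*c) (c*d)) (cyc \<circ> cyc)"
      using qconjug_half[OF half(2-5)] half(1) by auto
    then show ?thesis
      using half(2-5)
      by (intro that[of "signs (b*d) (b*c) (c*d)" "cyc \<circ> cyc"]) (auto simp: sgnv_signs prod_axis eperm_def)
  qed
qed

lemma qconj_hurwitz: "u \<in> hurwitz_units \<Longrightarrow> qconj u \<in> hurwitz_units"
proof -
  assume u: "u \<in> hurwitz_units"
  have q: "qconj (quat_of a b c d) = quat_of a (-b) (-c) (-d)" for a b c d
    by (simp add: qconj_def quat_of_def complex_eq_iff)
  consider a b c d :: real where "u = quat_of a b c d" "{a, b, c, d} \<subseteq> {-1, 0, 1}" "a\<^sup>2 + b\<^sup>2 + c\<^sup>2 + d\<^sup>2 = 1"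
    | a b c d :: real where "u = quat_of a b c d" "{a, b, c, d} \<subseteq> {-1/2, 1/2}"
    using u unfolding hurwitz_units_def by blast
  then show ?thesis
  proof cases
    case 1
    then have "{a, -b, -c, -d} \<subseteq> {-1, 0, 1}" "a\<^sup>2 + (-b)\<^sup>2 + (-c)\<^sup>2 + (-d)\<^sup>2 = 1" by auto
    then show ?thesis unfolding 1(1) q hurwitz_units_def by blast
  next
    case 2
    then have "{a, -b, -c, -d} \<subseteq> {-1/2, 1/2}" by auto
    then show ?thesis unfolding 2(1) q hurwitz_units_def by blast
  qed
qed

lemma hurwitz_norm: "u \<in> hurwitz_units \<Longrightarrow> (norm u)\<^sup>2 = 1"
  by (erule hurwitz_cases) (auto simp: norm_quat sum_axis quat_of_def qRe_def qim.simps power_divide)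

lemma qmult_assoc: "qmult (qmult p q) r = qmult p (qmult q r)"
  by (simp add: qmult_def algebra_simps)

lemma qmult_conj: "(norm u)\<^sup>2 = 1 \<Longrightarrow> qmult u (qconj u) = (1, 0) \<and> qmult (qconj u) u = (1, 0)"
  unfolding norm_quat
  by (auto simp: sum_axis qRe_def qim.simps qmult_def qconj_def complex_eq_iff power2_eq_square algebra_simps)

lemma qmult_one: "qmult (1, 0) q = q" "qmult q (1, 0) = q"
  by (simp_all add: qmult_def)

lemma qconjug_inverse:
  assumes "u \<in> hurwitz_units"
  shows "qconjug (qconj u) (qconjug u q) = q" "qconjug u (qconjug (qconj u) q) = q"
proof -
  have n: "(norm u)\<^sup>2 = 1" "(norm (qconj u))\<^sup>2 = 1" using hurwitz_norm assms qconj_hurwitz by auto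
  have c: "qconj (qconj u) = u" by (simp add: qconj_def)
  have i: "qinv u = qconj u" "qinv (qconj u) = u" using n c by (simp_all add: qinv_def)
  have a: "qmult u (qmult (qconj u) x) = x" "qmult (qconj u) (qmult u x) = x" for x
    using qmult_conj[OF n(1)] qmult_one by (simp_all flip: qmult_assoc)
  show "qconjug (qconj u) (qconjug u q) = q" "qconjug u (qconjug (qconj u) q) = q"
    using qmult_conj[OF n(1)] unfolding qconjug_def i by (simp_all add: qmult_assoc a qmult_one)
qed

subsection \<open>The three groups\<close>

definition gens_L :: "(quat \<Rightarrow> quat) set" where
  "gens_L = {qinv} \<union> range (\<lambda>w q. q + lat w)"

definition gens_H :: "(quat \<Rightarrow> quat) set" where
  "gens_H = gens_L \<union> qconjug ` hurwitz_units"

lemma translations_eq: "{(\<lambda>q. q + \<omega>) | \<omega>. \<omega> \<in> lattice_L} = range (\<lambda>w q. q + lat w)"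
  unfolding lattice_L_eq by blast

lemma PSL2_L_eq: "PSL2_L = gen_grp gens_L"
  by (simp only: PSL2_L_def gens_L_def translations_eq)

lemma PSL2_H_eq: "PSL2_H = gen_grp gens_H"
proof -
  have "{(\<lambda>q. qmult (qmult u q) (qinv u)) | u. u \<in> hurwitz_units} = qconjug ` hurwitz_units"
    unfolding qconjug_def[abs_def] by blast
  then show ?thesis by (simp only: PSL2_H_def gens_H_def gens_L_def translations_eq)
qed

lemma Gamma_eq: "Gamma_3434 = gen_grp {sinv, s1, s2, s3, s4}"
  by (simp add: Gamma_3434_def face_reflections_eq)

lemma sgnv_one: "sgnv (\<lambda>_. 1)" and sgnv_minus: "sgnv (\<lambda>_. -1)" and sgnv_neg1: "sgnv (neg1 i)"
  by (simp_all add: sgnv_def neg1_def)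

lemma qinv_HH: "q \<in> HH \<Longrightarrow> qinv q \<in> HH"
  unfolding qinv_sinv by (rule sinv_HH) simp

lemma sperm_minus_minus: "sperm (\<lambda>_. -1) id (sperm (\<lambda>_. -1) id q) = q"
  by (rule quat_eqI) simp_all

lemma qinv_qinv: "q \<in> HH \<Longrightarrow> qinv (qinv q) = q"
  unfolding qinv_sinv sperm_sinv[OF sgnv_minus bij_id] sperm_minus_minus by (rule sinv_sinv)

lemma inv_closed_Un: "inv_closed A \<Longrightarrow> inv_closed B \<Longrightarrow> inv_closed (A \<union> B)"
  unfolding inv_closed_def by (metis UnE UnI1 UnI2)

lemma inv_closed_involution:
  assumes "\<And>q. q \<in> HH \<Longrightarrow> f q \<in> HH" "\<And>q. q \<in> HH \<Longrightarrow> f (f q) = q"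
  shows "inv_closed {f}"
  using assms unfolding inv_closed_def by blast

lemma inv_closed_image:
  assumes "\<And>i q. i \<in> I \<Longrightarrow> q \<in> HH \<Longrightarrow> F i q \<in> HH" "\<And>i. i \<in> I \<Longrightarrow> j i \<in> I"
    "\<And>i q. i \<in> I \<Longrightarrow> q \<in> HH \<Longrightarrow> F (j i) (F i q) = q \<and> F i (F (j i) q) = q"
  shows "inv_closed (F ` I)"
  unfolding inv_closed_def
proof (intro ballI conjI)
  fix f assume "f \<in> F ` I"
  then obtain i where i: "i \<in> I" "f = F i" by blast
  show "f ` HH \<subseteq> HH" using assms(1) i by blast
  show "\<exists>f'\<in>F ` I. \<forall>q\<in>HH. f' (f q) = q \<and> f (f' q) = q"
    by (rule bexI[of _ "F (j i)"]) (use assms(2,3) i in blast)+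
qed

lemma inv_closed_L: "inv_closed gens_L"
  unfolding gens_L_def
proof (rule inv_closed_Un)
  show "inv_closed {qinv}" by (rule inv_closed_involution[OF qinv_HH qinv_qinv])
  show "inv_closed (range (\<lambda>w q. q + lat w))"
    by (rule inv_closed_image[where j = "\<lambda>w i. - w i"]) (auto intro!: quat_eqI)
qed

lemma inv_closed_H: "inv_closed gens_H"
  unfolding gens_H_def
proof (rule inv_closed_Un[OF inv_closed_L inv_closed_image[where j = qconj]])
  show "qconjug u q \<in> HH" if "u \<in> hurwitz_units" "q \<in> HH" for u q
    using that(2) by (rule_tac qconjug_hurwitz[OF that(1)]) simp
qed (simp_all add: qconjug_inverse qconj_hurwitz)

lemma inv_closed_refl: "inv_closed {sinv, s1, s2, s3, s4}"
proof -
  have "s1 (s1 q) = q" "s2 (s2 q) = q" "s3 (s3 q) = q" "s4 (s4 q) = q" for q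
    by (rule quat_eqI3; simp add: s1_def s2_def s3_def s4_def neg1_def unitv_def)+
  moreover have "q \<in> HH \<Longrightarrow> s1 q \<in> HH" "q \<in> HH \<Longrightarrow> s2 q \<in> HH" "q \<in> HH \<Longrightarrow> s3 q \<in> HH" "q \<in> HH \<Longrightarrow> s4 q \<in> HH" for q
    by (auto simp: s1_def s2_def s3_def s4_def)
  ultimately have "inv_closed ({sinv} \<union> ({s1} \<union> ({s2} \<union> ({s3} \<union> {s4}))))"
    using sinv_HH sinv_sinv by (intro inv_closed_Un inv_closed_involution)
  then show ?thesis by (simp add: insert_commute)
qed

lemma subgroup_L: "subgroup PSL2_L BH"
  and subgroup_H: "subgroup PSL2_H BH"
  and subgroup_Gamma: "subgroup Gamma_3434 BH"
  unfolding PSL2_L_eq PSL2_H_eq Gamma_eq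
  using gen_grp_subgroup inv_closed_L inv_closed_H inv_closed_refl by blast+

lemmas comp_Gamma = mem_comp[OF subgroup_Gamma]
lemmas comp_L = mem_comp[OF subgroup_L]
lemmas comp_H = mem_comp[OF subgroup_H]

lemma refl_Gamma: "mem Gamma_3434 sinv" "mem Gamma_3434 s1" "mem Gamma_3434 s2" "mem Gamma_3434 s3" "mem Gamma_3434 s4"
  unfolding Gamma_eq by (rule mem_gen; simp)+

section \<open>Signed permutations and translations in the reflection group\<close>

lemma bij_axis_cases:
  assumes "bij p"
  shows "p \<in> {id, cyc, cyc \<circ> cyc, tXY, tYZ, tXY \<circ> tYZ \<circ> tXY}"
proof -
  have "p AX \<noteq> p AY" "p AY \<noteq> p AZ" "p AX \<noteq> p AZ"
    using bij_is_inj[OF assms] by (auto simp: inj_def)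
  then show ?thesis
    by (cases "p AX"; cases "p AY"; cases "p AZ") (simp_all add: fun_eq_iff all_axis)
qed

lemma cyc_transp: "cyc = tXY \<circ> tYZ" "cyc \<circ> cyc = tYZ \<circ> tXY"
  by (simp_all add: fun_eq_iff all_axis)

lemma perm_Gamma:
  assumes "bij p"
  shows "mem Gamma_3434 (sperm (\<lambda>_. 1) p)"
proof -
  have c: "mem Gamma_3434 (sperm (\<lambda>_. 1) (r \<circ> p))"
    if "mem Gamma_3434 (sperm (\<lambda>_. 1) p)" "mem Gamma_3434 (sperm (\<lambda>_. 1) r)" for p r
    using comp_Gamma[OF that] by (simp add: sperm_sperm)
  have t: "mem Gamma_3434 (sperm (\<lambda>_. 1) tXY)" "mem Gamma_3434 (sperm (\<lambda>_. 1) tYZ)"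
    using refl_Gamma by (simp_all add: s2_def s3_def)
  have "mem Gamma_3434 (sperm (\<lambda>_. 1) id)"
    using mem_id[OF subgroup_Gamma] by (rule mem_cong) (simp add: sperm_one)
  then show ?thesis
    using bij_axis_cases[OF assms] c t unfolding cyc_transp by auto
qed

lemma neg1_Gamma: "mem Gamma_3434 (sperm (neg1 i) id)"
proof -
  define r where "r = Transposition.transpose i AZ"
  have r: "bij r" "r \<circ> r = id" by (simp_all add: r_def)
  have "mem Gamma_3434 (\<lambda>q. sperm (\<lambda>_. 1) r (s4 (sperm (\<lambda>_. 1) r q)))"
    by (rule comp_Gamma[OF perm_Gamma[OF r(1)] comp_Gamma[OF refl_Gamma(5) perm_Gamma[OF r(1)]]])
  then show ?thesis
    by (rule mem_cong) 
      (auto simp: s4_def sperm_sperm r r_def neg1_def Transposition.transpose_def fun_eq_iff intro!: arg_cong[where f = "\<lambda>f. sperm f id _"])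
qed

lemma sperm_Gamma:
  assumes "sgnv \<epsilon>" "bij p"
  shows "mem Gamma_3434 (sperm \<epsilon> p)"
proof -
  define f where "f i = (if \<epsilon> i = 1 then (\<lambda>_. 1) else neg1 i)" for i
  have f: "mem Gamma_3434 (sperm (f i) id)" for i
    using neg1_Gamma perm_Gamma[OF bij_id] by (simp add: f_def)
  have "(\<lambda>i. f AX i * f AY i * f AZ i) = \<epsilon>"
    using assms(1) by (auto simp: fun_eq_iff all_axis f_def neg1_def sgnv_def)
  moreover have "mem Gamma_3434 (\<lambda>q. sperm (f AX) id (sperm (f AY) id (sperm (f AZ) id (sperm (\<lambda>_. 1) p q))))"
    by (rule comp_Gamma[OF f[of AX] comp_Gamma[OF f[of AY] comp_Gamma[OF f[of AZ] perm_Gamma[OF assms(2)]]]])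
  ultimately show ?thesis by (simp add: sperm_sperm mult.assoc)
qed

lemma lat_add: "q + lat w + lat u = q + lat (\<lambda>i. w i + u i)"
  by (rule quat_eqI) simp_all

lemma translation_Gamma: "mem Gamma_3434 (\<lambda>q. q + lat w)"
proof -
  let ?W = "\<lambda>w. mem Gamma_3434 (\<lambda>q. q + lat w)"
  have add: "?W (\<lambda>i. w i + u i)" if "?W w" "?W u" for w u
    using comp_Gamma[OF that(2,1)] by (simp add: lat_add)
  have conj: "?W (\<lambda>i. \<epsilon> i * w (p i))" if "?W w" "sgnv \<epsilon>" "bij p" for w \<epsilon> p
  proof -
    define pi where "pi = inv_into UNIV p"
    have r: "bij pi" "p \<circ> pi = id" "\<And>i. p (pi i) = i" "\<And>i. pi (p i) = i"
      using that(3) by (auto simp: pi_def bij_imp_bij_inv bij_is_surj surj_iff bij_is_inj surj_f_inv_f)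
    \<comment> \<open>Signs of the inverse map: \<open>sperm ?\<eta> pi\<close> undoes
      \<open>sperm \<epsilon> p\<close>, so the conjugated translation is again a
      translation.\<close>
    let ?\<eta> = "\<lambda>i. \<epsilon> (pi i)"
    have "sgnv ?\<eta>" using that(2) by (simp add: sgnv_def)
    from comp_Gamma[OF sperm_Gamma[OF that(2,3)] comp_Gamma[OF that(1) sperm_Gamma[OF this r(1)]]]
    have "mem Gamma_3434 (\<lambda>q. sperm \<epsilon> p (sperm ?\<eta> pi q + lat w))" .
    then show ?thesis
      by (rule mem_cong) (rule quat_eqI; simp add: r algebra_simps sgnv_sq[OF that(2)] flip: of_int_mult mult.assoc)
  qed
  \<comment> \<open>The product of the parallel mirrors x = 0 and x = 1/2: 1 - (-x) = x + 1.\<close>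
  have "?W (unitv AX)"
    using comp_Gamma[OF refl_Gamma(2) neg1_Gamma[of AX]]
    by (rule mem_cong) (rule quat_eqI3; simp add: s1_def neg1_def)
  then have "?W (\<lambda>i. 1 * unitv AX (Transposition.transpose AX j i))" for j
    by (rule conj) (simp_all add: sgnv_one)
  moreover have "(\<lambda>i. 1 * unitv AX (Transposition.transpose AX j i)) = unitv j" for j
    by (auto simp: unitv_def Transposition.transpose_def)
  ultimately have u: "?W (unitv j)" for j by simp
  have zero: "?W (\<lambda>_. 0)"
    using mem_id[OF subgroup_Gamma] by (rule mem_cong) (simp add: lat_def mkq_def quat_of_def flip: zero_complex.code zero_prod_def)
  have n: "?W (\<lambda>i. int n * unitv j i)" for n j
  proof (induction n)
    case (Suc n)
    then show ?case using add[OF Suc u[of j]] by (simp add: algebra_simps)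
  qed (simp add: zero)
  have z: "?W (\<lambda>i. k * unitv j i)" for k j
  proof (cases "k \<ge> 0")
    case True
    then show ?thesis using n[of "nat k" j] by simp
  next
    case False
    then show ?thesis using conj[OF n[of "nat (-k)" j] sgnv_minus bij_id] by simp
  qed
  have "w = (\<lambda>i. w AX * unitv AX i + w AY * unitv AY i + w AZ * unitv AZ i)"
    by (auto simp: fun_eq_iff all_axis unitv_def)
  then show ?thesis using add[OF add[OF z z] z] by metis
qed

lemma qinv_Gamma: "mem Gamma_3434 qinv"
  using comp_Gamma[OF refl_Gamma(1) sperm_Gamma[OF sgnv_minus bij_id]] by (simp flip: qinv_sinv)

lemma bij_eperm: "p \<in> eperm \<Longrightarrow> bij p"
  using bij_cyc by (auto simp: eperm_def intro: bij_comp)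

section \<open>The inclusions between the three groups\<close>

lemma gens_mem_L: "mem PSL2_L qinv" "mem PSL2_L (\<lambda>q. q + lat w)"
  unfolding PSL2_L_eq by (rule mem_gen; simp add: gens_L_def)+

lemma gens_mem_H: "mem PSL2_H qinv" "mem PSL2_H (\<lambda>q. q + lat w)" "u \<in> hurwitz_units \<Longrightarrow> mem PSL2_H (qconjug u)"
  unfolding PSL2_H_eq by (rule mem_gen; simp add: gens_H_def gens_L_def)+

lemma L_subset_H: "PSL2_L \<subseteq> PSL2_H"
  unfolding PSL2_L_eq
  by (rule gen_grp_least[OF inv_closed_L subgroup_H]) (use gens_mem_H in \<open>auto simp: gens_L_def\<close>)

lemma H_subset_Gamma: "PSL2_H \<subseteq> Gamma_3434"
  unfolding PSL2_H_eq
proof (rule gen_grp_least[OF inv_closed_H subgroup_Gamma])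
  fix f assume "f \<in> gens_H"
  then consider "f = qinv" | w where "f = (\<lambda>q. q + lat w)" | u where "u \<in> hurwitz_units" "f = qconjug u"
    unfolding gens_H_def gens_L_def by blast
  then show "mem Gamma_3434 f"
  proof cases
    case 3
    show ?thesis by (rule qconjug_hurwitz[OF 3(1)]) (use 3(2) sperm_Gamma bij_eperm in auto)
  qed (simp_all add: qinv_Gamma translation_Gamma)
qed

subsection \<open>Types of group elements and the kernel description\<close>

text \<open>\<open>A\<close> is a submonoid of the possible types. It will be the trivial one,
  \<open>eperm\<close> with determinant 1, and everything, for the three groups in turn.\<close>

lemma gen_grp_type:
  assumes S: "inv_closed S" and g: "g \<in> gen_grp S"
    and gens: "\<And>f. f \<in> S \<Longrightarrow> \<exists>p \<delta>. has_type f p \<delta> \<and> (p, \<delta>) \<in> A"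
    and A: "(id, 1) \<in> A" "\<And>p \<delta> r \<epsilon>. (p, \<delta>) \<in> A \<Longrightarrow> (r, \<epsilon>) \<in> A \<Longrightarrow> (r \<circ> p, \<delta> * \<epsilon>) \<in> A"
  shows "\<exists>p \<delta>. has_type g p \<delta> \<and> (p, \<delta>) \<in> A"
  using S g
proof (induction rule: gen_grp_induct)
  case one
  have "has_type (\<lambda>q\<in>HH. q) id 1"
    by (rule has_type_cong[OF has_type_id]) simp
  then show ?case using A(1) by blast
next
  case (step f g)
  obtain p \<delta> where 1: "has_type f p \<delta>" "(p, \<delta>) \<in> A" using gens[OF step(1)] by blast
  obtain r \<epsilon> where 2: "has_type g r \<epsilon>" "(r, \<epsilon>) \<in> A" using step(3) by blast
  have "has_type (\<lambda>q\<in>HH. f (g q)) (r \<circ> p) (\<delta> * \<epsilon>)"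
    by (rule has_type_cong[OF has_type_comp[OF 1(1) 2(1)]]) simp
  then show ?case using A(2)[OF 1(2) 2(2)] by blast
qed

lemma type_L: "g \<in> PSL2_L \<Longrightarrow> has_type g id 1"
  using gen_grp_type[OF inv_closed_L, of g "{(id, 1)}"] has_type_qinv has_type_add_lat
  unfolding PSL2_L_eq by (auto simp: gens_L_def)

lemma eperm_comp: "p \<in> eperm \<Longrightarrow> r \<in> eperm \<Longrightarrow> r \<circ> p \<in> eperm"
proof -
  have "cyc \<circ> (cyc \<circ> cyc) = id" "cyc \<circ> cyc \<circ> (cyc \<circ> cyc) = cyc"
    using cyc3 by (simp_all add: o_assoc)
  then show "p \<in> eperm \<Longrightarrow> r \<in> eperm \<Longrightarrow> r \<circ> p \<in> eperm"
    using cyc3 by (auto simp: eperm_def)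
qed

lemma type_H:
  assumes "g \<in> PSL2_H"
  obtains p where "has_type g p 1" "p \<in> eperm"
proof -
  have "\<exists>p \<delta>. has_type g p \<delta> \<and> (p, \<delta>) \<in> eperm \<times> {1}"
  proof (rule gen_grp_type[OF inv_closed_H assms[unfolded PSL2_H_eq]])
    fix f assume "f \<in> gens_H"
    then consider "f = qinv" | w where "f = (\<lambda>q. q + lat w)" | u where "u \<in> hurwitz_units" "f = qconjug u"
      unfolding gens_H_def gens_L_def by blast
    then show "\<exists>p \<delta>. has_type f p \<delta> \<and> (p, \<delta>) \<in> eperm \<times> {1}"
    proof cases
      case 3
      obtain \<epsilon> p where e: "sgnv \<epsilon>" "p \<in> eperm" "(\<Prod>i\<in>UNIV. \<epsilon> i) = 1" "qconjug u = sperm \<epsilon> p"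
        using qconjug_hurwitz[OF 3(1)] .
      then have "has_type f p 1"
        using has_type_even[OF e(1)] unfolding 3(2) eperm_def by metis
      then show ?thesis using e(2) by blast
    qed (use has_type_qinv has_type_add_lat in \<open>auto simp: eperm_def\<close>)
  qed (auto intro: eperm_comp, simp add: eperm_def)
  then show ?thesis using that by auto
qed

lemma type_Gamma:
  assumes "g \<in> Gamma_3434"
  obtains p \<delta> where "has_type g p \<delta>"
proof -
  have "\<exists>p \<delta>. has_type g p \<delta> \<and> (p, \<delta>) \<in> UNIV"
  proof (rule gen_grp_type[OF inv_closed_refl assms[unfolded Gamma_eq]])
    have sp: "\<exists>p \<delta>. has_type (sperm \<epsilon> p') p \<delta>" if "sgnv \<epsilon>" "bij p'" for \<epsilon> p'
      using has_type_sperm[OF that] by blast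
    fix f assume "f \<in> {sinv, s1, s2, s3, s4}"
    then consider "f = sinv" | "f = s1" | "f = s2" | "f = s3" | "f = s4" by blast
    then show "\<exists>p \<delta>. has_type f p \<delta> \<and> (p, \<delta>) \<in> UNIV"
    proof cases
      case 2
      have "has_type s1 (id \<circ> id) (1 * (\<Prod>i\<in>UNIV. neg1 AX i))"
        unfolding s1_def[abs_def]
        by (rule has_type_comp[OF has_type_add_lat has_type_sign[OF sgnv_neg1]])
      then show ?thesis using 2 by blast
    qed (use sp bij_tXY bij_tYZ sgnv_one sgnv_neg1 has_type_sinv in \<open>auto simp: s2_def s3_def s4_def\<close>)
  qed auto
  then show ?thesis using that by auto
qed

text \<open>A signed permutation commutes with \<open>qinv\<close> and turns a lattice translation
  into a lattice translation, so it can be moved past every word in the generators.\<close>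

lemma sperm_normalizes_L:
  assumes "h \<in> PSL2_L" "sgnv \<epsilon>" "bij p"
  shows "\<exists>h'. mem PSL2_L h' \<and> (\<forall>q\<in>HH. sperm \<epsilon> p (h q) = h' (sperm \<epsilon> p q))"
  using inv_closed_L assms(1)[unfolded PSL2_L_eq]
proof (induction rule: gen_grp_induct)
  case one
  show ?case by (rule exI[of _ "\<lambda>q. q"]) (simp add: mem_id[OF subgroup_L])
next
  case (step f g)
  obtain g' where g': "mem PSL2_L g'" "\<forall>q\<in>HH. sperm \<epsilon> p (g q) = g' (sperm \<epsilon> p q)"
    using step(3) by blast
  have "\<exists>f'. mem PSL2_L f' \<and> (\<forall>q. sperm \<epsilon> p (f q) = f' (sperm \<epsilon> p q))"
  proof -
    consider "f = qinv" | w where "f = (\<lambda>q. q + lat w)"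
      using step(1) unfolding gens_L_def by blast
    then show ?thesis
    proof cases
      case 1
      have "sperm \<epsilon> p (qinv q) = qinv (sperm \<epsilon> p q)" for q
        unfolding qinv_sinv using sperm_sinv[OF assms(2,3)] by (simp add: sperm_sperm o_def)
      then show ?thesis using 1 gens_mem_L(1) by blast
    next
      case 2
      then show ?thesis
        using gens_mem_L(2)[of "\<lambda>i. \<epsilon> i * w (p i)"] sperm_add_lat[of \<epsilon> p _ w] by blast
    qed
  qed
  then obtain f' where f': "mem PSL2_L f'" "\<And>q. sperm \<epsilon> p (f q) = f' (sperm \<epsilon> p q)" by blast
  have "mem PSL2_L (\<lambda>q. f' (g' q))" by (rule comp_L[OF f'(1) g'(1)])
  moreover have "\<forall>q\<in>HH. sperm \<epsilon> p ((\<lambda>q\<in>HH. f (g q)) q) = f' (g' (sperm \<epsilon> p q))"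
    using f'(2) g'(2) by simp
  ultimately show ?case by blast
qed

lemma mem_restrict: "mem G h \<Longrightarrow> restrict h HH \<in> G"
  by (simp only: mem_def)

text \<open>Each face reflection is itself an element of \<open>PSL2_L\<close> after a signed
  permutation. In a longer word the signed permutations are pushed to the right with
  \<open>sperm_normalizes_L\<close> and merged.\<close>

lemma Gamma_decomp:
  assumes "g \<in> Gamma_3434"
  obtains h \<epsilon> p where "mem PSL2_L h" "sgnv \<epsilon>" "bij p" "\<forall>q\<in>HH. g q = h (sperm \<epsilon> p q)"
proof -
  have "\<exists>h \<epsilon> p. mem PSL2_L h \<and> sgnv \<epsilon> \<and> bij p \<and> (\<forall>q\<in>HH. g q = h (sperm \<epsilon> p q))"
    using inv_closed_refl assms[unfolded Gamma_eq]
  proof (induction rule: gen_grp_induct)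
    case one
    show ?case
      using mem_id[OF subgroup_L] sgnv_one bij_id sperm_one by force
  next
    case (step f g)
    obtain h \<epsilon> p where h: "mem PSL2_L h" "sgnv \<epsilon>" "bij p" "\<forall>q\<in>HH. g q = h (sperm \<epsilon> p q)"
      using step(3) by blast
    have "\<exists>k \<eta> r. mem PSL2_L k \<and> sgnv \<eta> \<and> bij r \<and> (\<forall>q\<in>HH. f q = k (sperm \<eta> r q))"
    proof -
      consider "f = sinv" | "f = s1" | "f = s2" | "f = s3" | "f = s4" using step(1) by blast
      then show ?thesis
      proof cases
        case 1
        have "sinv q = qinv (sperm (\<lambda>_. -1) id q)" for q
          by (simp add: qinv_sinv sperm_minus_minus)
        then show ?thesis using 1 gens_mem_L(1) sgnv_minus bij_id by blast
      next
        case 2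
        then show ?thesis using gens_mem_L(2) sgnv_neg1 bij_id s1_def by metis
      next
        case 3
        then show ?thesis using mem_id[OF subgroup_L] sgnv_one bij_tXY s2_def by metis
      next
        case 4
        then show ?thesis using mem_id[OF subgroup_L] sgnv_one bij_tYZ s3_def by metis
      next
        case 5
        then show ?thesis using mem_id[OF subgroup_L] sgnv_neg1 bij_id s4_def by metis
      qed
    qed
    then obtain k \<eta> r where k: "mem PSL2_L k" "sgnv \<eta>" "bij r" "\<forall>q\<in>HH. f q = k (sperm \<eta> r q)"
      by blast
    obtain h' where h': "mem PSL2_L h'" "\<forall>q\<in>HH. sperm \<eta> r (restrict h HH q) = h' (sperm \<eta> r q)"
      using sperm_normalizes_L[OF mem_restrict[OF h(1)] k(2,3)] by blast
    have "(\<lambda>q\<in>HH. f (g q)) q = k (h' (sperm (\<lambda>i. \<eta> i * \<epsilon> (r i)) (p \<circ> r) q))" if q: "q \<in> HH" for q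
    proof -
      have s: "sperm \<epsilon> p q \<in> HH" using q by simp
      have "g q = h (sperm \<epsilon> p q)" "g q \<in> HH" using h(4) q mem_HH[OF subgroup_L h(1) s] by auto
      then have "f (g q) = k (sperm \<eta> r (restrict h HH (sperm \<epsilon> p q)))"
        using k(4) s by simp
      also have "\<dots> = k (h' (sperm \<eta> r (sperm \<epsilon> p q)))" using h'(2) s by simp
      finally show ?thesis using q by (simp add: sperm_sperm)
    qed
    moreover have "mem PSL2_L (\<lambda>q. k (h' q))" by (rule comp_L[OF k(1) h'(1)])
    moreover have "sgnv (\<lambda>i. \<eta> i * \<epsilon> (r i))" using k(2) h(2) unfolding sgnv_def by (metis mult_minus1 mult_1 minus_minus)
    moreover have "bij (p \<circ> r)" using k(3) h(3) by (rule bij_comp)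
    ultimately show ?case by blast
  qed
  then show ?thesis using that by blast
qed

definition flip :: "axis \<Rightarrow> axis \<Rightarrow> int" where "flip i j = (if j = i then 1 else -1)"

text \<open>\<open>(T \<tau>\<^sub>i)\<^sup>3\<close> is conjugation by the \<open>i\<close>-th imaginary unit; in lifted coordinates this is a linear identity.\<close>
lemma flip_L: "mem PSL2_L (sperm (flip i) id)"
proof -
  define f where "f q = qinv (q + lat (unitv i))" for q
  have f: "mem PSL2_L f" unfolding f_def[abs_def] by (rule comp_L[OF gens_mem_L])
  have fH: "f q \<in> HH" if "q \<in> HH" for q using mem_HH[OF subgroup_L f that] .
  have l: "lift (f q) CA = lift q CB + 2 * lift q (CV i) + lift q CA" "lift (f q) CB = lift q CA"
    "lift (f q) (CV j) = - (lift q (CV j) + (if j = i then lift q CA else 0))" if q: "q \<in> HH" for q j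
  proof -
    have T: "q + lat (unitv i) \<in> HH" "lift (q + lat (unitv i)) c = (\<Sum>d\<in>UNIV. of_int (MT (unitv i)$c$d) * lift q d)" for c
      using acts_add_lat[of "unitv i"] q unfolding acts_def by blast+
    have P: "lift (sperm (\<lambda>_. -1) id (q + lat (unitv i))) c = (\<Sum>d\<in>UNIV. of_int (MB (\<lambda>_. -1) id$c$d) * lift (q + lat (unitv i)) d)" for c
      using acts_sperm[OF sgnv_minus bij_id] T(1) unfolding acts_def by blast
    have S: "lift (f q) c = (\<Sum>d\<in>UNIV. of_int (MR$c$d) * lift (sperm (\<lambda>_. -1) id (q + lat (unitv i))) d)" for c
      using acts_sinv T(1) unfolding acts_def f_def qinv_sinv by simp
    show "lift (f q) CA = lift q CB + 2 * lift q (CV i) + lift q CA" "lift (f q) CB = lift q CA"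
      "lift (f q) (CV j) = - (lift q (CV j) + (if j = i then lift q CA else 0))"
      unfolding S P T(2)
      by (cases i; cases j; simp add: sum_coord sum_axis MR_def MB_def MT_def unitv_def del: lift.simps)+
  qed
  have "f (f (f q)) = sperm (flip i) id q" if q: "q \<in> HH" for q
  proof (rule lift_inject)
    show "f (f (f q)) \<in> HH" "sperm (flip i) id q \<in> HH" using fH q by simp_all
    have "sgnv (flip i)" by (simp add: sgnv_def flip_def)
    then have R: "lift (sperm (flip i) id q) c = (\<Sum>d\<in>UNIV. of_int (MB (flip i) id$c$d) * lift q d)" for c
      using acts_sperm[OF _ bij_id] q unfolding acts_def by blast
    show "lift (f (f (f q))) c = lift (sperm (flip i) id q) c" for c
    proof -
      note l3 = l[OF q] l[OF fH[OF q]] l[OF fH[OF fH[OF q]]]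
      have "lift (f (f (f q))) (CV j) = lift (sperm (flip i) id q) (CV j)" for j
        unfolding R by (cases i; cases j; simp add: l3 sum_coord sum_axis MB_def flip_def del: lift.simps)
      moreover have "lift (f (f (f q))) CA = lift (sperm (flip i) id q) CA"
        "lift (f (f (f q))) CB = lift (sperm (flip i) id q) CB"
        unfolding R by (simp_all add: l3 sum_coord MB_def del: lift.simps)
      ultimately show ?thesis by (metis coord.exhaust)
    qed
  qed
  then show ?thesis
    using comp_L[OF f comp_L[OF f f]] by (rule_tac mem_cong)
qed

text \<open>Apart from the identity, three signs with product 1 contain exactly two minus signs,
  which is a \<open>flip\<close>.\<close>

lemma even_signs_L:
  assumes "sgnv \<epsilon>" "(\<Prod>i\<in>UNIV. \<epsilon> i) = 1"
  shows "mem PSL2_L (sperm \<epsilon> id)"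
proof -
  have "\<epsilon> = (\<lambda>_. 1) \<or> (\<exists>i. \<epsilon> = flip i)"
  proof -
    have e: "\<epsilon> AX \<in> {1,-1}" "\<epsilon> AY \<in> {1,-1}" "\<epsilon> AZ \<in> {1,-1}" "\<epsilon> AX * \<epsilon> AY * \<epsilon> AZ = 1"
      using assms by (auto simp: sgnv_def prod_axis)
    then have "(\<forall>i. \<epsilon> i = 1) \<or> (\<forall>i. \<epsilon> i = flip AX i) \<or> (\<forall>i. \<epsilon> i = flip AY i) \<or> (\<forall>i. \<epsilon> i = flip AZ i)"
      unfolding all_axis flip_def by auto
    then show ?thesis by (auto simp: fun_eq_iff)
  qed
  moreover have "mem PSL2_L (sperm (\<lambda>_. 1) id)"
    using mem_id[OF subgroup_L] by (rule mem_cong) (simp add: sperm_one)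
  ultimately show ?thesis using flip_L by auto
qed

lemma even_perm_H: "p \<in> eperm \<Longrightarrow> mem PSL2_H (sperm (\<lambda>_. 1) p)"
proof -
  \<comment> \<open>For (-1 + i + j + k)/2 the product of the four signs is -1 and those of the last
    three are all 1, so \<open>qconjug_half\<close> gives the 3-cycle without sign changes.\<close>
  have u: "quat_of ((-1::int)/2) ((1::int)/2) ((1::int)/2) ((1::int)/2) \<in> hurwitz_units" (is "?u \<in> _")
    unfolding hurwitz_units_def
    by (rule UnI2, rule CollectI, rule exI[of _ "-1/2"], (rule exI[of _ "1/2"])+) simp
  have "qconjug ?u = sperm (signs 1 1 1) cyc"
    by (rule ext, subst qconjug_half) simp_all
  also have "signs 1 1 1 = (\<lambda>_. 1)" by (simp add: fun_eq_iff all_axis)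
  finally have c: "mem PSL2_H (sperm (\<lambda>_. 1) cyc)" using gens_mem_H(3)[OF u] by simp
  have "mem PSL2_H (sperm (\<lambda>_. 1) (cyc \<circ> cyc))" using comp_H[OF c c] by (simp add: sperm_sperm)
  moreover have "mem PSL2_H (sperm (\<lambda>_. 1) id)"
    using mem_id[OF subgroup_H] by (rule mem_cong) (simp add: sperm_one)
  ultimately show "p \<in> eperm \<Longrightarrow> mem PSL2_H (sperm (\<lambda>_. 1) p)" using c by (auto simp: eperm_def)
qed

text \<open>In g = h o \<open>sperm \<epsilon> r\<close> the factor h has trivial type, so the type
  of g is that of the signed permutation. Determinant 1 together with an even permutation forces an
  even number of minus signs; these lie in \<open>PSL2_L\<close>, and the even permutation lies in
  \<open>PSL2_H\<close>.\<close>

lemma PSL2_iff_type: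
  assumes g: "g \<in> Gamma_3434"
  shows "g \<in> PSL2_H \<longleftrightarrow> (\<exists>p\<in>eperm. has_type g p 1)"
    and "g \<in> PSL2_L \<longleftrightarrow> has_type g id 1"
proof -
  have key: "(p \<in> eperm \<longrightarrow> g \<in> PSL2_H) \<and> (p = id \<longrightarrow> g \<in> PSL2_L)" if t: "has_type g p 1" "p \<in> eperm" for p
  proof -
    obtain h \<epsilon> r where h: "mem PSL2_L h" "sgnv \<epsilon>" "bij r" "\<forall>q\<in>HH. g q = h (sperm \<epsilon> r q)"
      using Gamma_decomp[OF g] .
    have "has_type h id 1"
      using type_L[OF mem_restrict[OF h(1)]] by (rule has_type_cong) simp
    then have "has_type g (r \<circ> id) (1 * det (MB \<epsilon> r))"
      using has_type_cong[OF has_type_comp[OF _ has_type_sperm[OF h(2,3)]]] h(4) by metis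
    then have r: "r = p" "det (MB \<epsilon> r) = 1" using has_type_unique[OF t(1)] by auto
    then have "(\<Prod>i\<in>UNIV. \<epsilon> i) = 1"
      using has_type_unique[OF has_type_sperm[OF h(2,3)] has_type_even[OF h(2)]] t(2) by (auto simp: eperm_def)
    then have e: "mem PSL2_L (sperm \<epsilon> id)" using even_signs_L h(2) by blast
    have gm: "mem G (\<lambda>q. h (sperm \<epsilon> p q)) \<Longrightarrow> g \<in> G" if "subgroup G BH" for G
    proof -
      assume "mem G (\<lambda>q. h (sperm \<epsilon> p q))"
      then have "mem G g" by (rule mem_cong) (simp add: h(4) r)
      moreover have "g \<in> extensional HH"
        using subgroup_BH_Bij[OF subgroup_Gamma g] by (simp add: Bij_def)
      ultimately show "g \<in> G" by (simp add: mem_def extensional_restrict)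
    qed
    have LH: "mem PSL2_L f \<Longrightarrow> mem PSL2_H f" for f using L_subset_H by (auto simp: mem_def)
    have "mem PSL2_H (\<lambda>q. h (sperm \<epsilon> id (sperm (\<lambda>_. 1) p q)))"
      by (rule comp_H[OF LH[OF h(1)] comp_H[OF LH[OF e] even_perm_H[OF t(2)]]])
    then have "g \<in> PSL2_H" by (intro gm[OF subgroup_H]) (simp add: sperm_sperm)
    moreover have "g \<in> PSL2_L" if "p = id"
      using comp_L[OF h(1) e] gm[OF subgroup_L] that by simp
    ultimately show ?thesis by blast
  qed
  show "g \<in> PSL2_H \<longleftrightarrow> (\<exists>p\<in>eperm. has_type g p 1)"
    using key type_H by metis
  show "g \<in> PSL2_L \<longleftrightarrow> has_type g id 1"
    using key[of id] type_L by (auto simp: eperm_def)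
qed

subsection \<open>The indices\<close>

definition gtype :: "(quat \<Rightarrow> quat) \<Rightarrow> (axis \<Rightarrow> axis) \<times> int" where
  "gtype g = (THE (p, \<delta>). has_type g p \<delta>)"

lemma gtype_eq: "has_type g p \<delta> \<Longrightarrow> gtype g = (p, \<delta>)"
  unfolding gtype_def by (rule the_equality) (auto dest: has_type_unique)

lemma mult_inv_type:
  assumes x: "x \<in> Gamma_3434" and y: "y \<in> Gamma_3434"
    and tx: "has_type x p \<delta>" and ty: "has_type y r \<epsilon>"
  obtains s \<zeta> where "has_type (x \<otimes>\<^bsub>BH\<^esub> inv\<^bsub>BH\<^esub> y) (s \<circ> p) (\<delta> * \<zeta>)" "bij s" "s \<circ> r = id" "\<epsilon> * \<zeta> = 1"
    "x \<otimes>\<^bsub>BH\<^esub> inv\<^bsub>BH\<^esub> y \<in> Gamma_3434"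
proof -
  note i = subgroup_inv_apply[OF subgroup_Gamma y]
  obtain s \<zeta> where s: "has_type (inv\<^bsub>BH\<^esub> y) s \<zeta>" using type_Gamma[OF i(1)] .
  have "x \<otimes>\<^bsub>BH\<^esub> inv\<^bsub>BH\<^esub> y = compose HH x (inv\<^bsub>BH\<^esub> y)"
    by (intro mult_BH subgroup_BH_Bij[OF subgroup_Gamma] x i)
  then have "has_type (x \<otimes>\<^bsub>BH\<^esub> inv\<^bsub>BH\<^esub> y) (s \<circ> p) (\<delta> * \<zeta>)"
    using has_type_cong[OF has_type_comp[OF tx s], of "compose HH x (inv\<^bsub>BH\<^esub> y)"] by (simp add: compose_def)
  moreover have "s \<circ> r = id" "\<epsilon> * \<zeta> = 1" using has_type_inverse[OF ty s] i(3) by blast+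
  moreover have "x \<otimes>\<^bsub>BH\<^esub> inv\<^bsub>BH\<^esub> y \<in> Gamma_3434"
    by (rule subgroup.m_closed[OF subgroup_Gamma x i(1)])
  ultimately show ?thesis using that has_type_bij[OF s] by blast
qed

lemma gtype_eq_iff:
  assumes "x \<in> Gamma_3434" "y \<in> Gamma_3434"
  shows "gtype x = gtype y \<longleftrightarrow> x \<otimes>\<^bsub>BH\<^esub> inv\<^bsub>BH\<^esub> y \<in> PSL2_L"
proof -
  obtain p \<delta> where x: "has_type x p \<delta>" using type_Gamma[OF assms(1)] .
  obtain r \<epsilon> where y: "has_type y r \<epsilon>" using type_Gamma[OF assms(2)] .
  obtain s \<zeta> where s: "has_type (x \<otimes>\<^bsub>BH\<^esub> inv\<^bsub>BH\<^esub> y) (s \<circ> p) (\<delta> * \<zeta>)" "bij s" "s \<circ> r = id" "\<epsilon> * \<zeta> = 1"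
    "x \<otimes>\<^bsub>BH\<^esub> inv\<^bsub>BH\<^esub> y \<in> Gamma_3434"
    using mult_inv_type[OF assms x y] .
  have "x \<otimes>\<^bsub>BH\<^esub> inv\<^bsub>BH\<^esub> y \<in> PSL2_L \<longleftrightarrow> s \<circ> p = id \<and> \<delta> * \<zeta> = 1"
    using PSL2_iff_type(2)[OF s(5)] s(1) has_type_unique by metis
  also have "s \<circ> p = id \<longleftrightarrow> p = r"
    using s(3) bij_is_inj[OF s(2)] by (metis fun.inj_map_strong injD comp_apply ext)
  also have "\<delta> * \<zeta> = 1 \<longleftrightarrow> \<delta> = \<epsilon>"
    using s(4) by (metis mult_cancel_right mult_zero_right zero_neq_one)
  finally show ?thesis using gtype_eq[OF x] gtype_eq[OF y] by auto
qed

lemma gtype_restrict: "has_type f p \<delta> \<Longrightarrow> gtype (restrict f HH) = (p, \<delta>)"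
  by (rule gtype_eq, erule has_type_cong) simp

lemma gtype_sperm: "sgnv \<epsilon> \<Longrightarrow> bij p \<Longrightarrow> gtype (restrict (sperm \<epsilon> p) HH) = (p, det (MB \<epsilon> p))"
  by (rule gtype_restrict[OF has_type_sperm])

text \<open>The inverse map also acts by an integral matrix, so the determinant is a unit of the
  integers.\<close>

lemma det_MB_pm: 
  assumes "sgnv \<epsilon>" "bij p" 
  shows "det (MB \<epsilon> p) \<in> {1, -1}"
proof -
  have m: "restrict (sperm \<epsilon> p) HH \<in> Gamma_3434"
    by (rule mem_restrict[OF sperm_Gamma[OF assms]])
  have t: "has_type (restrict (sperm \<epsilon> p) HH) p (det (MB \<epsilon> p))"
    by (rule has_type_cong[OF has_type_sperm[OF assms]]) simp
  obtain s \<zeta> where "det (MB \<epsilon> p) * \<zeta> = 1" using mult_inv_type[OF m m t t] by blast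
  then show ?thesis by (auto simp: zmult_eq_1_iff)
qed

lemma gtype_image_Gamma: "gtype ` Gamma_3434 = {p. bij p} \<times> {1, -1}"
proof
  show "gtype ` Gamma_3434 \<subseteq> {p. bij p} \<times> {1, -1}"
  proof
    fix t assume "t \<in> gtype ` Gamma_3434"
    then obtain g where g: "g \<in> Gamma_3434" "t = gtype g" by blast
    obtain p \<delta> where p: "has_type g p \<delta>" using type_Gamma g by blast
    obtain s \<zeta> where "\<delta> * \<zeta> = 1" using mult_inv_type[OF g(1) g(1) p p] by blast
    then have "\<delta> \<in> {1, -1}" by (auto simp: zmult_eq_1_iff)
    then show "t \<in> {p. bij p} \<times> {1, -1}"
      using g(2) gtype_eq[OF p] has_type_bij[OF p] by simp
  qed
  show "{p. bij p} \<times> {1, -1} \<subseteq> gtype ` Gamma_3434"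
  proof
    fix t :: "(axis \<Rightarrow> axis) \<times> int" assume "t \<in> {p. bij p} \<times> {1, -1}"
    then obtain p \<delta> where t: "t = (p, \<delta>)" "bij p" "\<delta> \<in> {1, -1}" by blast
    let ?d = "det (MB (\<lambda>_. 1) p)"
    have d: "?d \<in> {1, -1}" using det_MB_pm sgnv_one t(2) by blast
    \<comment> \<open>Negating all three coordinates keeps the permutation and reverses the
      determinant, so both values occur whichever sign \<open>?d\<close> has.\<close>
    have "has_type (\<lambda>q. sperm (\<lambda>_. -1) id (sperm (\<lambda>_. 1) p q)) (p \<circ> id) ((\<Prod>i\<in>(UNIV::axis set). -1) * ?d)"
      by (intro has_type_comp[OF has_type_sign has_type_sperm] sgnv_minus sgnv_one t)
    then have "has_type (sperm (\<lambda>_. -1) p) p (- ?d)"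
      by (simp add: sperm_sperm prod_axis del: prod_constant)
    then have "gtype (restrict (sperm (\<lambda>_. -1) p) HH) = (p, - ?d)"
      by (rule gtype_restrict)
    moreover have "gtype (restrict (sperm (\<lambda>_. 1) p) HH) = (p, ?d)"
      by (rule gtype_sperm[OF sgnv_one t(2)])
    moreover have "restrict (sperm (\<lambda>_. -1) p) HH \<in> Gamma_3434" "restrict (sperm (\<lambda>_. 1) p) HH \<in> Gamma_3434"
      using sperm_Gamma sgnv_one sgnv_minus t(2) by (auto intro!: mem_restrict)
    ultimately have calc: "gtype (restrict (sperm (\<lambda>_. -1) p) HH) = (p, - ?d)" "gtype (restrict (sperm (\<lambda>_. 1) p) HH) = (p, ?d)"
      "restrict (sperm (\<lambda>_. -1) p) HH \<in> Gamma_3434" "restrict (sperm (\<lambda>_. 1) p) HH \<in> Gamma_3434"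
      by blast+
    show "t \<in> gtype ` Gamma_3434"
    proof -
      have "\<delta> = ?d \<or> \<delta> = - ?d" using d t(3) by auto
      then show ?thesis using calc t(1) by (metis image_eqI)
    qed
  qed
qed

lemma index_Gamma_L: "grp_index Gamma_3434 PSL2_L = 12"
proof -
  have "{p :: axis \<Rightarrow> axis. bij p} = {p. p permutes UNIV}"
    by (simp add: bij_iff permutes_univ)
  moreover have "card (UNIV :: axis set) = 3" by (simp add: UNIV_axis)
  ultimately have "card {p :: axis \<Rightarrow> axis. bij p} = 6"
    using card_permutations[of "UNIV :: axis set" 3] by (simp add: fact_numeral)
  then have "card (gtype ` Gamma_3434) = 12"
    unfolding gtype_image_Gamma by (simp add: card_cartesian_product)
  then show ?thesis
    using grp_index_eq_card_image[OF subgroup_Gamma subgroup_L _ gtype_eq_iff] L_subset_H H_subset_Gamma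
    by auto
qed

lemma index_H_L: "grp_index PSL2_H PSL2_L = 3"
proof -
  have "gtype ` PSL2_H = eperm \<times> {1}"
  proof
    show "gtype ` PSL2_H \<subseteq> eperm \<times> {1}"
    proof
      fix t assume "t \<in> gtype ` PSL2_H"
      then obtain g where g: "g \<in> PSL2_H" "t = gtype g" by blast
      obtain p where "has_type g p 1" "p \<in> eperm" using type_H[OF g(1)] .
      then show "t \<in> eperm \<times> {1}" using gtype_eq g(2) by simp
    qed
    show "eperm \<times> {1} \<subseteq> gtype ` PSL2_H"
    proof
      fix t :: "(axis \<Rightarrow> axis) \<times> int" assume "t \<in> eperm \<times> {1}"
      then obtain p where p: "t = (p, 1)" "p \<in> eperm" by blast
      have "has_type (sperm (\<lambda>_. 1) p) p 1"
        using has_type_even[OF sgnv_one p(2)[unfolded eperm_def]] by simp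
      then show "t \<in> gtype ` PSL2_H"
        using p(1) gtype_restrict mem_restrict[OF even_perm_H[OF p(2)]] by (metis image_eqI)
    qed
  qed
  moreover have "card eperm = 3"
  proof -
    have "id \<noteq> cyc" "id \<noteq> cyc \<circ> cyc" "cyc \<noteq> cyc \<circ> cyc"
      by (auto simp: fun_eq_iff all_axis)
    then show ?thesis by (simp add: eperm_def)
  qed
  ultimately have "card (gtype ` PSL2_H) = 3" by (simp add: card_cartesian_product)
  then show ?thesis
    using grp_index_eq_card_image[OF subgroup_H subgroup_L L_subset_H gtype_eq_iff] H_subset_Gamma
    by auto
qed

lemma permutation_axis: "bij p \<Longrightarrow> permutation p" for p :: "axis \<Rightarrow> axis"
  unfolding permutation_permutes using bij_imp_permutes[of p UNIV] by auto

lemma eperm_iff_sign: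
  assumes "bij p"
  shows "p \<in> eperm \<longleftrightarrow> sign p = 1"
proof -
  have t: "sign tXY = -1" "sign tYZ = -1" by (simp_all add: tXY_def tYZ_def sign_swap_id)
  have "permutation tXY" "permutation tYZ" "permutation (tXY \<circ> tYZ)"
    using permutation_axis bij_tXY bij_tYZ bij_comp by blast+
  then have s: "sign cyc = 1" "sign (cyc \<circ> cyc) = 1" "sign (tXY \<circ> tYZ \<circ> tXY) = -1"
    unfolding cyc_transp by (simp_all add: sign_compose t)
  have "tXY \<notin> eperm" "tYZ \<notin> eperm" "tXY \<circ> tYZ \<circ> tXY \<notin> eperm"
    by (auto simp: eperm_def fun_eq_iff all_axis)
  moreover have "p \<in> eperm \<or> p = tXY \<or> p = tYZ \<or> p = tXY \<circ> tYZ \<circ> tXY"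
    using bij_axis_cases[OF assms] by (auto simp: eperm_def)
  moreover have "p \<in> eperm \<Longrightarrow> sign p = 1" using s by (auto simp: eperm_def)
  ultimately show ?thesis using t s(3) by force
qed

text \<open>Cosets of \<open>PSL2_H\<close> forget everything about the permutation except its sign,
  so two independent signs remain.\<close>

lemma index_Gamma_H: "grp_index Gamma_3434 PSL2_H = 4"
proof -
  define \<phi> where "\<phi> g = map_prod sign id (gtype g)" for g
  have "\<phi> x = \<phi> y \<longleftrightarrow> x \<otimes>\<^bsub>BH\<^esub> inv\<^bsub>BH\<^esub> y \<in> PSL2_H" if xy: "x \<in> Gamma_3434" "y \<in> Gamma_3434" for x y
  proof -
    obtain p \<delta> where x: "has_type x p \<delta>" using type_Gamma[OF xy(1)] .
    obtain r \<epsilon> where y: "has_type y r \<epsilon>" using type_Gamma[OF xy(2)] .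
    obtain s \<zeta> where s: "has_type (x \<otimes>\<^bsub>BH\<^esub> inv\<^bsub>BH\<^esub> y) (s \<circ> p) (\<delta> * \<zeta>)" "bij s" "s \<circ> r = id" "\<epsilon> * \<zeta> = 1"
      "x \<otimes>\<^bsub>BH\<^esub> inv\<^bsub>BH\<^esub> y \<in> Gamma_3434"
      using mult_inv_type[OF xy x y] .
    have b: "bij p" "bij r" using has_type_bij x y by blast+
    have "x \<otimes>\<^bsub>BH\<^esub> inv\<^bsub>BH\<^esub> y \<in> PSL2_H \<longleftrightarrow> s \<circ> p \<in> eperm \<and> \<delta> * \<zeta> = 1"
      using PSL2_iff_type(1)[OF s(5)] s(1) has_type_unique by metis
    also have "s \<circ> p \<in> eperm \<longleftrightarrow> sign p = sign r"
    proof -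
      have "sign s * sign r = 1"
        using sign_compose[of s r] permutation_axis b s(2,3) by simp
      moreover have "sign (s \<circ> p) = sign s * sign p"
        using sign_compose[of s p] permutation_axis b s(2) by simp
      ultimately show ?thesis
        using eperm_iff_sign[OF bij_comp[OF b(1) s(2)]] by (metis mult_cancel_left mult_zero_left zero_neq_one)
    qed
    also have "\<delta> * \<zeta> = 1 \<longleftrightarrow> \<delta> = \<epsilon>"
      using s(4) by (metis mult_cancel_right mult_zero_right zero_neq_one)
    finally show ?thesis using gtype_eq[OF x] gtype_eq[OF y] by (auto simp: \<phi>_def)
  qed
  moreover have "\<phi> ` Gamma_3434 = {1, -1} \<times> {1, -1}"
  proof -
    have "\<phi> ` Gamma_3434 = map_prod sign id ` ({p :: axis \<Rightarrow> axis. bij p} \<times> {1, -1})"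
      unfolding gtype_image_Gamma[symmetric] by (simp add: \<phi>_def image_image)
    also have "\<dots> = sign ` {p :: axis \<Rightarrow> axis. bij p} \<times> {1, -1}"
      by (simp add: map_prod_surj_on)
    also have "sign ` {p :: axis \<Rightarrow> axis. bij p} = {1, -1}"
    proof
      show "sign ` {p :: axis \<Rightarrow> axis. bij p} \<subseteq> {1, -1}" by (auto simp: sign_def)
      have "sign (id :: axis \<Rightarrow> axis) = 1" "sign tXY = -1"
        by (simp_all add: tXY_def sign_swap_id)
      then show "{1, -1} \<subseteq> sign ` {p :: axis \<Rightarrow> axis. bij p}"
        using bij_tXY bij_id by (metis (mono_tags, lifting) empty_subsetI image_eqI insert_subset mem_Collect_eq)
    qed
    finally show ?thesis .
  qed
  ultimately show ?thesis
    using grp_index_eq_card_image[OF subgroup_Gamma subgroup_H H_subset_Gamma, of \<phi>]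
    by (simp add: card_cartesian_product)
qed

subsection \<open>Discreteness\<close>

lemma Gamma_matrix:
  assumes "g \<in> Gamma_3434"
  obtains M p where "acts g M" "adm M p"
  using type_Gamma[OF assms] unfolding has_type_def by metis

lemma tendsto_lift:
  assumes f: "(f \<longlongrightarrow> q) F" and q: "q \<in> HH"
  shows "((\<lambda>n. lift (f n) c) \<longlongrightarrow> lift q c) F"
proof -
  have r: "((\<lambda>n. qRe (f n)) \<longlongrightarrow> qRe q) F"
    unfolding qRe_def by (intro tendsto_intros f)
  have i: "((\<lambda>n. qim (f n) i) \<longlongrightarrow> qim q i) F" for i
    by (cases i; simp only: qim.simps; intro tendsto_intros f)
  have "qRe q \<noteq> 0" using q by simp
  then show ?thesis
    by (cases c; simp only: lift.simps; intro tendsto_intros r i f)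
qed

text \<open>Convergence at the five test points makes the integral entries converge to those of the
  identity matrix, hence eventually equal them. There are finitely many entries, so some matrix in
  the sequence is the identity, and a matrix determines its map on \<open>HH\<close>.\<close>

lemma discrete_Gamma: "discrete_grp Gamma_3434"
  unfolding discrete_grp_def
proof (rule notI, elim exE conjE)
  fix g :: "nat \<Rightarrow> quat \<Rightarrow> quat"
  assume g: "\<forall>n. g n \<in> Gamma_3434 \<and> g n \<noteq> restrict id HH"
    and lim: "\<forall>K. compact K \<and> K \<subseteq> HH \<longrightarrow> uniform_limit K g id sequentially"
  have pt: "(\<lambda>n. g n q) \<longlonglongrightarrow> q" if "q \<in> HH" for q
  proof -
    have "uniform_limit {q} g id sequentially" using lim that by (metis compact_sing empty_subsetI insert_subset)
    from tendsto_uniform_limitI[OF this, of q] show ?thesis by simp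
  qed
  have "\<exists>M p. acts (g n) M \<and> adm M p" for n
    using Gamma_matrix g by metis
  then obtain M where M: "acts (g n) (M n)" for n by metis
  have H: "base 1 \<in> HH" "base 2 \<in> HH" "side i \<in> HH" for i
    by (simp_all add: base_def side_def)
  note L = tendsto_lift[OF pt[OF H(1)] H(1)] tendsto_lift[OF pt[OF H(2)] H(2)]
    tendsto_lift[OF pt[OF H(3)] H(3)]
  have "(\<lambda>n. entry (g n) c d) \<longlonglongrightarrow> entry (\<lambda>q. q) c d" for c d
    by (cases d; simp only: entry.simps; intro tendsto_intros L) simp_all
  then have "(\<lambda>n. real_of_int (M n$c$d)) \<longlonglongrightarrow> real_of_int (mat 1$c$d)" for c d
    using acts_entry[OF M] acts_entry[OF acts_id] by simp
  then have "\<forall>\<^sub>F n in sequentially. M n$c$d = mat 1$c$d" for c d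
  proof -
    have "\<forall>\<^sub>F n in sequentially. dist (real_of_int (M n$c$d)) (real_of_int (mat 1$c$d)) < 1"
      using \<open>\<And>c d. (\<lambda>n. real_of_int (M n$c$d)) \<longlonglongrightarrow> _\<close> tendstoD zero_less_one by blast
    then show ?thesis
      by (rule eventually_mono) (simp add: dist_real_def flip: of_int_diff of_int_abs)
  qed
  then have "\<forall>\<^sub>F n in sequentially. \<forall>c d. M n$c$d = mat 1$c$d"
    by (intro eventually_all_finite)
  then obtain n where "\<forall>c d. M n$c$d = mat 1$c$d"
    using eventually_happens sequentially_bot by blast
  then have "M n = mat 1" by (simp add: vec_eq_iff)
  then have "g n q = q" if "q \<in> HH" for q
    using acts_faithful[OF _ acts_id that] M[of n] by simp
  moreover have "g n \<in> extensional HH"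
    using subgroup_BH_Bij[OF subgroup_Gamma] g by (simp add: Bij_def)
  ultimately have "g n = restrict id HH"
    by (intro extensionalityI[of _ HH]) auto
  then show False using g by blast
qed

subsection \<open>Heights\<close>

text \<open>\<open>(A, 2m, B)\<close> is the first row of \<open>M\<close>; it is a null vector for the dual form.\<close>
lemma height_row:
  assumes g: "g \<in> Gamma_3434" and M: "acts g M" "adm M p"
  obtains A B :: int and m :: "axis \<Rightarrow> int" where
    "\<forall>q\<in>HH. g q \<in> HH \<and>
       qRe q / qRe (g q) = of_int A + 2 * (\<Sum>i\<in>UNIV. of_int (m i) * qim q i) + of_int B * (norm q)\<^sup>2"
    "(\<Sum>i\<in>UNIV. m i * m i) = A * B" "B \<ge> 0" "A \<ge> 0" "A + B > 0" "A = M$CA$CA" "B = M$CA$CB"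
proof -
  have Lz: "lorentz M" using M(2) by (simp add: adm_def)
  define A where "A = M$CA$CA"
  define B where "B = M$CA$CB"
  define m where "m i = M$CA$(CV i) div 2" for i
  have m: "M$CA$(CV i) = 2 * m i" for i
    using lorentz_null_even[OF Lz, of CA i] by (simp add: m_def)
  have h: "g q \<in> HH \<and> qRe q / qRe (g q) = of_int A + 2 * (\<Sum>i\<in>UNIV. of_int (m i) * qim q i) + of_int B * (norm q)\<^sup>2"
    if q: "q \<in> HH" for q
  proof -
    have "g q \<in> HH" "lift (g q) CA = (\<Sum>d\<in>UNIV. of_int (M$CA$d) * lift q d)"
      using M(1) q unfolding acts_def by blast+
    then show ?thesis using q
      by (simp add: sum_coord m A_def[symmetric] B_def[symmetric] sum_axis field_simps)
  qed
  have "bil (M$CA) (M$CA) = 0" using Lz unfolding lorentz_iff by (simp add: Jm_def)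
  then have n: "(\<Sum>i\<in>UNIV. m i * m i) = A * B"
    by (simp add: bil_def m A_def[symmetric] B_def[symmetric] sum_axis)
  \<comment> \<open>On the vertical ray \<open>base t\<close> the height quotient is A + B t^2. Its
    positivity for large t excludes B < 0, and t = 1 gives A + B > 0.\<close>
  have pos: "of_int A + of_int B * t\<^sup>2 > 0" if "t > 0" for t :: real
  proof -
    have b: "base t \<in> HH" using that by (simp add: base_def)
    have "qRe (base t) / qRe (g (base t)) > 0" using conjunct1[OF h[OF b]] b by (simp only: HH_iff divide_pos_pos)
    then have "of_int A + 2 * (\<Sum>i\<in>UNIV. of_int (m i) * qim (base t) i) + of_int B * (norm (base t))\<^sup>2 > 0"
      using h[OF b] by metis
    then show ?thesis by (simp add: base_def norm_quat)
  qed
  have B: "B \<ge> 0"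
  proof (rule ccontr)
    assume "\<not> B \<ge> 0"
    then have "real_of_int B \<le> -1" by simp
    let ?t = "\<bar>real_of_int A\<bar> + 1"
    have "?t \<le> ?t\<^sup>2" by (simp add: power2_eq_square algebra_simps)
    moreover have "real_of_int B * ?t\<^sup>2 \<le> (-1) * ?t\<^sup>2"
      using \<open>real_of_int B \<le> -1\<close> by (intro mult_right_mono) auto
    ultimately show False using pos[of ?t] by linarith
  qed
  have s: "0 \<le> (\<Sum>i\<in>UNIV. m i * m i)" by (intro sum_nonneg) simp
  have "A + B > 0" using pos[of 1] by (simp flip: of_int_add)
  moreover have "A \<ge> 0"
  proof (cases "B = 0")
    case False
    then show ?thesis using s n B by (simp add: zero_le_mult_iff)
  qed (use \<open>A + B > 0\<close> in simp)
  ultimately show ?thesis using that[of A m B] h n B A_def B_def by blast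
qed

text \<open>The height of an image is determined by an integral row (A, 2m, B), and only finitely
  many rows can give at least the initial height. So the heights of the orbit have a
  maximum.\<close>

lemma max_height:
  assumes q: "q \<in> HH"
  shows "\<exists>g\<in>Gamma_3434. \<forall>h\<in>Gamma_3434. qRe (h q) \<le> qRe (g q)"
proof -
  define t where "t = qRe q"
  have t: "t > 0" using q by (simp add: t_def)
  define V where "V = (\<lambda>(A::int, x::int, y::int, z::int, B::int).
     t / (of_int A + 2 * (of_int x * qim q AX + of_int y * qim q AY + of_int z * qim q AZ) + of_int B * (norm q)\<^sup>2))"
  \<comment> \<open>\<open>c\<close> will bound B, \<open>l\<close> every |m_i|, and 1 + 3 l^2 the
    entry A; \<open>K\<close> dominates all three.\<close>
  define c where "c = 1 / t\<^sup>2"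
  define l where "l = c * (1 + norm q)"
  define K where "K = \<lceil>1 + c + l + 3 * l\<^sup>2\<rceil>"
  have c: "c > 0" using t by (simp add: c_def)
  have l: "l \<ge> 0" using c by (simp add: l_def)
  have qn: "\<bar>qim q i\<bar> \<le> norm q" for i
  proof -
    have "(qim q i)\<^sup>2 \<le> (norm q)\<^sup>2"
      unfolding norm_quat by (cases i) (simp_all add: sum_axis)
    then show ?thesis by (metis abs_le_square_iff abs_norm_cancel)
  qed
  \<comment> \<open>Only heights of at least t are collected: the set is then finite, and the
    identity shows that it is not empty.\<close>
  let ?S = "{s. \<exists>h\<in>Gamma_3434. s = qRe (h q) \<and> t \<le> s}"
  have "?S \<subseteq> V ` ({-K..K} \<times> {-K..K} \<times> {-K..K} \<times> {-K..K} \<times> {-K..K})"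
  proof
    fix s assume "s \<in> ?S"
    then obtain h where h: "h \<in> Gamma_3434" "s = qRe (h q)" "t \<le> s" by blast
    obtain M p where M: "acts h M" "adm M p" using Gamma_matrix[OF h(1)] .
    obtain A B m where R': "\<forall>q\<in>HH. h q \<in> HH \<and>
       qRe q / qRe (h q) = of_int A + 2 * (\<Sum>i\<in>UNIV. of_int (m i) * qim q i) + of_int B * (norm q)\<^sup>2"
      and n: "(\<Sum>i\<in>UNIV. m i * m i) = A * B" and B: "B \<ge> 0" and A: "A \<ge> 0" and AB: "A + B > 0"
      and "A = M$CA$CA" "B = M$CA$CB"
      using height_row[OF h(1) M] .
    have R: "h q \<in> HH"
        "t / s = of_int A + 2 * (\<Sum>i\<in>UNIV. of_int (m i) * qim q i) + of_int B * (norm q)\<^sup>2"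
      using R' q unfolding h(2) t_def by blast+
    have s: "s > 0" using R(1) h(2) by simp
    have "V (A, m AX, m AY, m AZ, B) = t / (t / s)"
      unfolding R(2) by (simp add: V_def sum_axis)
    then have Vs: "s = V (A, m AX, m AY, m AZ, B)" using s t by simp
    have le1: "t / s \<le> 1" using h(3) s by simp
    have bnd: "real_of_int B \<le> c \<and> (\<forall>i. \<bar>real_of_int (m i)\<bar> \<le> l) \<and> real_of_int A \<le> 1 + 3 * l\<^sup>2"
    proof (cases "B = 0")
      case True
      then have "m i = 0" for i
        using n by (cases i) (simp_all add: sum_axis sum_nonneg_eq_0_iff add_nonneg_eq_0_iff)
      then have "real_of_int A \<le> 1" using True R(2) le1 by simp
      then have "real_of_int A \<le> 1 + 3 * l\<^sup>2" using zero_le_power2[of l] by linarith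
      then show ?thesis using \<open>\<And>i. m i = 0\<close> True c l by simp
    next
      case False
      then have B1: "real_of_int B \<ge> 1" using B by simp
      have n': "(\<Sum>i\<in>UNIV. (real_of_int (m i))\<^sup>2) = of_int A * of_int B"
        unfolding of_int_mult[symmetric] n[symmetric] by (simp add: power2_eq_square)
      \<comment> \<open>Completing the square with |m|^2 = A B. As t / s is at most 1, the last
        square bounds B and the others bound m; finally A is at most A B = |m|^2.\<close>
      have "of_int B * (t / s) = (\<Sum>i\<in>UNIV. (of_int (m i) + of_int B * qim q i)\<^sup>2) + (of_int B * t)\<^sup>2"
        unfolding R(2) using n' unfolding norm_quat t_def
        by (simp add: sum_axis power2_eq_square algebra_simps)
      moreover have "of_int B * (t / s) \<le> real_of_int B" using mult_left_mono[OF le1, of "of_int B"] B1 by simp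
      ultimately have le: "(\<Sum>i\<in>UNIV. (of_int (m i) + of_int B * qim q i)\<^sup>2) + (of_int B * t)\<^sup>2 \<le> real_of_int B"
        by simp
      then have "(of_int B * t)\<^sup>2 \<le> real_of_int B"
        using sum_nonneg[of UNIV "\<lambda>i. (of_int (m i) + of_int B * qim q i)\<^sup>2"] by simp
      then have "real_of_int B * (real_of_int B * t\<^sup>2) \<le> real_of_int B * 1"
        by (simp add: power2_eq_square algebra_simps)
      then have "real_of_int B * t\<^sup>2 \<le> 1" using B1 by (simp add: mult_le_cancel_left)
      then have Bc: "real_of_int B \<le> c" using t by (simp add: c_def field_simps)
      have ml: "\<bar>real_of_int (m i)\<bar> \<le> l" for i
      proof -
        have "(of_int (m i) + of_int B * qim q i)\<^sup>2 \<le> real_of_int B"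
          using le by (cases i; simp add: sum_axis; smt (verit) zero_le_power2)
        also have "real_of_int B \<le> (real_of_int B)\<^sup>2" using B1 by (simp add: power2_eq_square)
        finally have "\<bar>of_int (m i) + of_int B * qim q i\<bar> \<le> real_of_int B"
          using B1 by (simp add: abs_le_square_iff[symmetric])
        moreover have "\<bar>of_int B * qim q i\<bar> \<le> real_of_int B * norm q"
          using qn[of i] B1 by (simp add: abs_mult mult_left_mono)
        ultimately have "\<bar>real_of_int (m i)\<bar> \<le> real_of_int B * (1 + norm q)"
          by (simp add: algebra_simps)
        also have "\<dots> \<le> l" unfolding l_def using Bc by (intro mult_right_mono) simp_all
        finally show ?thesis .
      qed
      have "(real_of_int (m i))\<^sup>2 \<le> l\<^sup>2" for i
        using ml[of i] l by (simp add: abs_le_square_iff[symmetric])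
      then have "of_int A * of_int B \<le> 3 * l\<^sup>2"
        unfolding n'[symmetric] sum_axis by (smt (verit))
      moreover have "real_of_int A * 1 \<le> of_int A * of_int B"
        using A B1 by (intro mult_left_mono) simp_all
      ultimately show ?thesis using Bc ml by simp
    qed
    have K: "real_of_int K \<ge> 1 + c + l + 3 * l\<^sup>2" unfolding K_def by (rule le_of_int_ceiling)
    have "real_of_int B \<le> of_int K" "real_of_int A \<le> of_int K" "\<And>i. \<bar>real_of_int (m i)\<bar> \<le> of_int K"
    proof -
      have "c \<le> of_int K" "l \<le> of_int K" "1 + 3 * l\<^sup>2 \<le> of_int K"
        using K c l zero_le_power2[of l] by linarith+
      then show "real_of_int B \<le> of_int K" "real_of_int A \<le> of_int K" "\<And>i. \<bar>real_of_int (m i)\<bar> \<le> of_int K"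
        using bnd by (meson order_trans)+
    qed
    then have K': "B \<le> K" "A \<le> K" "\<And>i. \<bar>m i\<bar> \<le> K"
      unfolding of_int_abs[symmetric] of_int_le_iff by blast+
    have "A \<in> {-K..K}" "B \<in> {-K..K}" using K'(1,2) A B by simp_all
    moreover have "m i \<in> {-K..K}" for i using K'(3)[of i] by (simp add: abs_le_iff)
    ultimately show "s \<in> V ` ({-K..K} \<times> {-K..K} \<times> {-K..K} \<times> {-K..K} \<times> {-K..K})"
      unfolding Vs by (intro imageI SigmaI)
  qed
  then have fin: "finite ?S" by (rule finite_subset) simp
  have "(\<lambda>q\<in>HH. q) \<in> Gamma_3434" using mem_id[OF subgroup_Gamma] by (rule mem_restrict)
  then have ne: "t \<in> ?S" using q by (auto simp: t_def intro!: bexI[of _ "\<lambda>q\<in>HH. q"])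
  then have "Max ?S \<in> ?S" using fin by (intro Max_in) auto
  then obtain g where g: "g \<in> Gamma_3434" "Max ?S = qRe (g q)" by blast
  have "qRe (h q) \<le> qRe (g q)" if "h \<in> Gamma_3434" for h
  proof (cases "t \<le> qRe (h q)")
    case True
    then have S: "qRe (h q) \<in> ?S" using that by blast
    show ?thesis using Max_ge[OF fin S] unfolding g(2) .
  next
    case False
    then show ?thesis using Max_ge[OF fin ne] unfolding g(2) by linarith
  qed
  then show ?thesis using g(1) by blast
qed

text \<open>The simplex, described by the sides of its five mirrors: \<open>sinv\<close> for the
  norm, then \<open>s4\<close>, \<open>s3\<close>, \<open>s2\<close>, \<open>s1\<close> for the
  chain of inequalities.\<close>

definition Delta :: "quat set" where
  "Delta = {q \<in> HH. norm q \<ge> 1 \<and> 0 \<le> qim q AZ \<and> qim q AZ \<le> qim q AY \<and> qim q AY \<le> qim q AX \<and> qim q AX \<le> 1/2}"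

lemma sort_axis: "\<exists>p. bij p \<and> v (p AZ) \<le> v (p AY) \<and> v (p AY) \<le> v (p AX)" for v :: "axis \<Rightarrow> real"
proof -
  let ?P = "\<lambda>p. v (p AZ) \<le> v (p AY) \<and> v (p AY) \<le> v (p AX)"
  have "?P id \<or> ?P cyc \<or> ?P (cyc \<circ> cyc) \<or> ?P tXY \<or> ?P tYZ \<or> ?P (tXY \<circ> tYZ \<circ> tXY)"
    by simp linarith
  moreover have "bij (cyc \<circ> cyc)" "bij (tXY \<circ> tYZ \<circ> tXY)"
    using bij_cyc bij_tXY bij_tYZ by (auto intro: bij_comp)
  ultimately show ?thesis using bij_id bij_cyc bij_tXY bij_tYZ by blast
qed

text \<open>At a point of maximal height, rounding, changing signs and sorting bring the imaginary
  part into place without changing the height. If the norm were then below 1, \<open>sinv\<close>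
  would raise the point further.\<close>

lemma Delta_covers:
  assumes q: "q \<in> HH"
  shows "\<exists>g\<in>Gamma_3434. g q \<in> Delta"
proof -
  obtain g where g: "g \<in> Gamma_3434" "\<And>h. h \<in> Gamma_3434 \<Longrightarrow> qRe (h q) \<le> qRe (g q)"
    using max_height[OF q] by blast
  have gH: "g q \<in> HH" using Bij_HH[OF subgroup_BH_Bij[OF subgroup_Gamma g(1)] q] .
  define w where "w i = - round (qim (g q) i)" for i
  define \<epsilon> where "\<epsilon> i = (if qim (g q) i + of_int (w i) \<ge> 0 then 1 else -1 :: int)" for i
  define v where "v i = \<bar>qim (g q) i + of_int (w i)\<bar>" for i
  have v: "0 \<le> v i" "v i \<le> 1/2" for i
    using of_int_round_abs_le[of "qim (g q) i"] by (simp_all add: v_def w_def abs_minus_commute)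
  obtain p where p: "bij p" "v (p AZ) \<le> v (p AY)" "v (p AY) \<le> v (p AX)" using sort_axis by blast
  define f where "f x = sperm (\<lambda>_. 1) p (sperm \<epsilon> id (x + lat w))" for x
  have "sgnv \<epsilon>" by (simp add: sgnv_def \<epsilon>_def)
  then have f: "mem Gamma_3434 f"
    unfolding f_def[abs_def]
    by (intro comp_Gamma[OF sperm_Gamma[OF sgnv_one p(1)] comp_Gamma[OF sperm_Gamma[OF _ bij_id] translation_Gamma]])
  have fg: "mem Gamma_3434 (\<lambda>x. f (g x))" by (rule comp_Gamma[OF f subgroup_mem[OF subgroup_Gamma g(1)]])
  have im: "qim (f (g q)) i = v (p i)" for i
    by (simp add: f_def v_def \<epsilon>_def)
  have re: "qRe (f (g q)) = qRe (g q)" by (simp add: f_def)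
  have fH: "f (g q) \<in> HH" using gH re by simp
  have "mem Gamma_3434 (\<lambda>x. sinv (f (g x)))" by (rule comp_Gamma[OF refl_Gamma(1) fg])
  from g(2)[OF mem_restrict[OF this]] q have "qRe (sinv (f (g q))) \<le> qRe (f (g q))" by (simp add: re)
  then have "1 \<le> (norm (f (g q)))\<^sup>2"
    using fH norm_pos_HH[OF fH] by (simp add: qRe_sinv divide_le_eq)
  then have "1 \<le> norm (f (g q))" using power2_le_imp_le[of 1 "norm (f (g q))"] by simp
  then have "f (g q) \<in> Delta" using fH v p by (simp add: Delta_def im)
  then show ?thesis using mem_restrict[OF fg] q by (intro bexI[of _ "\<lambda>x\<in>HH. f (g x)"]) simp_all
qed

text \<open>With \<open>0 \<le> v\<^sub>i \<le> 1/2\<close> the height quotient is at least \<open>A + B - \<Sum>|m\<^sub>i|\<close>; here \<open>m\<^sup>2 - B|m| \<ge> - B\<^sup>2/4\<close>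
  settles \<open>B \<ge> 4\<close>, and for \<open>B = 2\<close> the parity of \<open>\<Sum> m\<^sub>i\<^sup>2\<close> is needed.\<close>
lemma height_arith:
  fixes x y z A B :: int
  assumes n: "x*x + y*y + z*z = A * B" and B: "B \<ge> 1"
  shows "A + B \<ge> 1 + \<bar>x\<bar> + \<bar>y\<bar> + \<bar>z\<bar>"
proof -
  let ?f = "\<lambda>k::int. k*k - B * \<bar>k\<bar>"
  \<comment> \<open>This is the claim multiplied by B and rewritten with A B = x^2 + y^2 + z^2, so
    that the three coordinates can be estimated separately.\<close>
  have "?f x + ?f y + ?f z \<ge> B - B*B"
  proof -
    have k2: "\<bar>k\<bar> * \<bar>k\<bar> = k * k" for k :: int by simp
    consider "B = 1" | "B = 2" | "B = 3" | "B \<ge> 4" using B by linarith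
    then show ?thesis
    proof cases
      case 1
      have "k*k - \<bar>k\<bar> \<ge> 0" for k :: int
      proof -
        have "\<bar>k\<bar> * (\<bar>k\<bar> - 1) \<ge> 0" by (cases "k = 0") auto
        then show ?thesis using k2[of k] by (simp add: algebra_simps)
      qed
      from this[of x] this[of y] this[of z] show ?thesis using 1 by simp
    next
      case 2
      have "k*k - 2*\<bar>k\<bar> \<ge> -1" for k :: int
      proof -
        have "(\<bar>k\<bar> - 1) * (\<bar>k\<bar> - 1) \<ge> 0" by simp
        then show ?thesis using k2[of k] by (simp add: algebra_simps)
      qed
      from this[of x] this[of y] this[of z] have "?f x + ?f y + ?f z \<ge> -3" using 2 by simp
      moreover have e: "?f x + ?f y + ?f z = 2 * (A - \<bar>x\<bar> - \<bar>y\<bar> - \<bar>z\<bar>)" using n 2 by simp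
      \<comment> \<open>An even number that is at least -3 is at least -2.\<close>
      ultimately have "A - \<bar>x\<bar> - \<bar>y\<bar> - \<bar>z\<bar> \<ge> -1" by presburger
      then show ?thesis unfolding e using 2 by simp
    next
      case 3
      have "k*k - 3*\<bar>k\<bar> \<ge> -2" for k :: int
      proof -
        have "(\<bar>k\<bar> - 1) * (\<bar>k\<bar> - 2) \<ge> 0" by (cases "\<bar>k\<bar> \<ge> 2") (auto simp: zero_le_mult_iff)
        then show ?thesis using k2[of k] by (simp add: algebra_simps)
      qed
      from this[of x] this[of y] this[of z] show ?thesis using 3 by simp
    next
      case 4
      have "4 * ?f k \<ge> - (B*B)" for k
      proof -
        have "(2*\<bar>k\<bar> - B) * (2*\<bar>k\<bar> - B) \<ge> 0" by simp
        then show ?thesis using k2[of k] by (simp add: algebra_simps)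
      qed
      from this[of x] this[of y] this[of z] have "4 * (?f x + ?f y + ?f z) \<ge> - 3 * (B*B)" by simp
      moreover have "4 * B \<le> B * B" using 4 by (intro mult_right_mono) auto
      ultimately show ?thesis by simp
    qed
  qed
  then have "B * (A + B) \<ge> B * (1 + \<bar>x\<bar> + \<bar>y\<bar> + \<bar>z\<bar>)"
    using n by (simp add: algebra_simps)
  then show ?thesis using B by (simp add: mult_le_cancel_left)
qed

text \<open>V is the quotient of the heights of q and its image, so no group element raises a point
  of \<open>Delta\<close>. As each imaginary coordinate is at most 1/2, a cross term is at least
  -|m_i|; with norm at least 1 the integer inequality \<open>height_arith\<close> finishes the case
  B > 0.\<close>

lemma height_Delta:
  assumes q: "q \<in> Delta"
    and n: "(\<Sum>i\<in>UNIV. m i * m i) = A * B" and B: "B \<ge> 0" and AB: "A + B > 0"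
  defines "V \<equiv> of_int A + 2 * (\<Sum>i\<in>UNIV. of_int (m i) * qim q i) + of_int B * (norm q)\<^sup>2"
  shows "V \<ge> 1" "B > 0 \<Longrightarrow> norm q > 1 \<Longrightarrow> V > 1"
proof -
  have v: "0 \<le> qim q i" "qim q i \<le> 1/2" for i
    using q unfolding Delta_def by (cases i; simp)+
  have mv: "2 * (of_int (m i) * qim q i) \<ge> - of_int \<bar>m i\<bar>" for i
  proof -
    have "\<bar>of_int (m i) * qim q i\<bar> \<le> \<bar>real_of_int (m i)\<bar> * (1/2)"
      unfolding abs_mult using v[of i] by (intro mult_left_mono) auto
    then show ?thesis by simp
  qed
  have W: "1 \<le> of_int A + 2 * (\<Sum>i\<in>UNIV. of_int (m i) * qim q i) + of_int B" if "B > 0"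
  proof -
    have "A + B \<ge> 1 + \<bar>m AX\<bar> + \<bar>m AY\<bar> + \<bar>m AZ\<bar>"
      using height_arith[of "m AX" "m AY" "m AZ" A B] n that by (simp add: sum_axis)
    then have "real_of_int (A + B) \<ge> real_of_int (1 + \<bar>m AX\<bar> + \<bar>m AY\<bar> + \<bar>m AZ\<bar>)"
      unfolding of_int_le_iff .
    then show ?thesis using mv[of AX] mv[of AY] mv[of AZ] by (simp add: sum_axis)
  qed
  have qn: "norm q \<ge> 1" using q by (simp add: Delta_def)
  show "V \<ge> 1"
  proof (cases "B = 0")
    case True
    then have "m i = 0" for i
      using n by (cases i) (simp_all add: sum_axis add_nonneg_eq_0_iff)
    then show ?thesis using True AB by (simp add: V_def)
  next
    case False
    have "of_int B * 1 \<le> of_int B * (norm q)\<^sup>2"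
      using B qn by (intro mult_left_mono) auto
    then show ?thesis using W B False unfolding V_def by linarith
  qed
  show "V > 1" if "B > 0" "norm q > 1"
  proof -
    have "1 < (norm q)\<^sup>2" using that(2) by (simp add: one_less_power)
    then have "of_int B * 1 < of_int B * (norm q)\<^sup>2"
      using that(1) by (intro mult_strict_left_mono) auto
    then show ?thesis using W[OF that(1)] unfolding V_def by linarith
  qed
qed

text \<open>The entry \<open>B\<close> of the first row vanishes iff \<open>g\<close> fixes \<open>\<infinity>\<close>.\<close>
lemma stabilizer_infinity:
  assumes M: "acts g M" "adm M p" and B: "M$CA$CB = 0" and A: "M$CA$CA \<ge> 0"
  obtains \<epsilon> w where "sgnv \<epsilon>" "\<forall>q\<in>HH. qRe (g q) = qRe q \<and> (\<forall>i. qim (g q) i = of_int (\<epsilon> i) * qim q (p i) + of_int (w i))"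
proof -
  have Lz: "\<And>c d. bil (M$c) (M$d) = Jm$c$d" using M(2) unfolding adm_def lorentz_iff by blast
  have "(\<Sum>i\<in>UNIV. M$CA$(CV i) * M$CA$(CV i)) = 0"
    using Lz[of CA CA] B by (simp add: bil_def Jm_def)
  then have v0: "M$CA$(CV i) = 0" for i
    by (cases i) (simp_all add: sum_axis add_nonneg_eq_0_iff)
  have "M$CA$CA * M$CB$CB = 1"
    using Lz[of CA CB] B v0 by (simp add: bil_def Jm_def)
  then have A1: "M$CA$CA = 1" using A by (auto simp: zmult_eq_1_iff)
  have b0: "M$(CV i)$CB = 0" for i
    using Lz[of CA "CV i"] B v0 A1 by (simp add: bil_def Jm_def)
  have orth: "(\<Sum>k\<in>UNIV. M$(CV i)$(CV k) * M$(CV i)$(CV k)) = 1" for i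
    using Lz[of "CV i" "CV i"] b0 by (simp add: bil_def Jm_def)
  define \<epsilon> where "\<epsilon> i = M$(CV i)$(CV (p i))" for i
  \<comment> \<open>An integral row of square norm 1 with an odd, hence nonzero, entry at
    \<open>p i\<close> has no other nonzero entry.\<close>
  have row: "M$(CV i)$(CV k) = \<epsilon> i * of_bool (k = p i) \<and> \<epsilon> i * \<epsilon> i = 1" for i k
  proof -
    have "odd (\<epsilon> i)" using M(2) by (simp add: adm_def \<epsilon>_def)
    then have "\<epsilon> i \<noteq> 0" by auto
    then have "\<epsilon> i * \<epsilon> i \<ge> 1" using not_square_less_zero[of "\<epsilon> i"] by (smt (verit) mult_eq_0_iff)
    moreover have "(\<Sum>k\<in>UNIV. M$(CV i)$(CV k) * M$(CV i)$(CV k)) =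
        \<epsilon> i * \<epsilon> i + (\<Sum>k\<in>UNIV - {p i}. M$(CV i)$(CV k) * M$(CV i)$(CV k))"
      unfolding \<epsilon>_def by (rule sum.remove) simp_all
    moreover have "(\<Sum>k\<in>UNIV - {p i}. M$(CV i)$(CV k) * M$(CV i)$(CV k)) \<ge> 0"
      by (intro sum_nonneg) simp
    ultimately have e: "\<epsilon> i * \<epsilon> i = 1" and z: "(\<Sum>k\<in>UNIV - {p i}. M$(CV i)$(CV k) * M$(CV i)$(CV k)) = 0"
      using orth[of i] by linarith+
    have "\<forall>k\<in>UNIV - {p i}. M$(CV i)$(CV k) * M$(CV i)$(CV k) = 0"
      using z by (subst (asm) sum_nonneg_eq_0_iff) simp_all
    then show ?thesis using e by (auto simp: \<epsilon>_def)
  qed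
  have "sgnv \<epsilon>" using row by (auto simp: sgnv_def zmult_eq_1_iff)
  moreover have "qRe (g q) = qRe q \<and> (\<forall>i. qim (g q) i = of_int (\<epsilon> i) * qim q (p i) + of_int (M$(CV i)$CA))"
    if q: "q \<in> HH" for q
  proof -
    have l: "g q \<in> HH" "lift (g q) c = (\<Sum>d\<in>UNIV. of_int (M$c$d) * lift q d)" for c
      using M(1) q unfolding acts_def by blast+
    have t: "qRe (g q) = qRe q" using l(2)[of CA] A1 B v0 by (simp add: sum_coord)
    have "qim (g q) i / qRe q = (\<Sum>k\<in>UNIV. of_bool (k = p i) * (of_int (\<epsilon> i) * (qim q k / qRe q))) + of_int (M$(CV i)$CA) / qRe q" for i
      using l(2)[of "CV i"] b0 by (simp add: sum_coord t row mult_ac)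
    then have "qim (g q) i / qRe q = of_int (\<epsilon> i) * (qim q (p i) / qRe q) + of_int (M$(CV i)$CA) / qRe q" for i
      unfolding sum_of_bool_mult .
    then have "qim (g q) i = of_int (\<epsilon> i) * qim q (p i) + of_int (M$(CV i)$CA)" for i
      using q by (simp add: field_simps)
    then show ?thesis using t by blast
  qed
  ultimately show ?thesis using that[of \<epsilon> "\<lambda>i. M$(CV i)$CA"] by blast
qed

definition Delta_int :: "quat set" where
  "Delta_int = {q \<in> HH. norm q > 1 \<and> 0 < qim q AZ \<and> qim q AZ < qim q AY \<and> qim q AY < qim q AX \<and> qim q AX < 1/2}"

text \<open>The strict form of \<open>height_Delta\<close> for g and the weak form for its inverse
  contradict each other unless B = 0. What remains is an affine signed permutation, and the open
  inequalities at q rule out all but the identity.\<close>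

lemma Delta_int_rigid:
  assumes g: "g \<in> Gamma_3434" and q: "q \<in> Delta_int" and gq: "g q \<in> Delta" and x: "x \<in> HH"
  shows "g x = x"
proof -
  have qD: "q \<in> Delta" "q \<in> HH" "norm q > 1" using q by (auto simp: Delta_int_def Delta_def)
  obtain M p where M: "acts g M" "adm M p" using Gamma_matrix[OF g] .
  obtain A B m where h: "\<forall>q\<in>HH. g q \<in> HH \<and>
       qRe q / qRe (g q) = of_int A + 2 * (\<Sum>i\<in>UNIV. of_int (m i) * qim q i) + of_int B * (norm q)\<^sup>2"
    and n: "(\<Sum>i\<in>UNIV. m i * m i) = A * B" and B: "B \<ge> 0" and A: "A \<ge> 0" and AB: "A + B > 0"
    and AM: "A = M$CA$CA" "B = M$CA$CB"
    using height_row[OF g M] .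
  have gH: "g q \<in> HH" using h qD by blast
  have pos: "qRe q > 0" "qRe (g q) > 0" using qD gH by simp_all
  have B0: "B = 0"
  proof (rule ccontr)
    assume "B \<noteq> 0"
    then have "qRe q / qRe (g q) > 1"
      using height_Delta(2)[OF qD(1) n B AB] h qD B by simp
    then have lt: "qRe (g q) < qRe q" using pos by simp
    note i = subgroup_inv_apply[OF subgroup_Gamma g]
    obtain M' p' where M': "acts (inv\<^bsub>BH\<^esub> g) M'" "adm M' p'" using Gamma_matrix[OF i(1)] .
    obtain A' B' m' where h': "\<forall>q\<in>HH. (inv\<^bsub>BH\<^esub> g) q \<in> HH \<and>
         qRe q / qRe ((inv\<^bsub>BH\<^esub> g) q) = of_int A' + 2 * (\<Sum>i\<in>UNIV. of_int (m' i) * qim q i) + of_int B' * (norm q)\<^sup>2"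
      and n': "(\<Sum>i\<in>UNIV. m' i * m' i) = A' * B'" "B' \<ge> 0" "A' \<ge> 0" "A' + B' > 0"
        "A' = M'$CA$CA" "B' = M'$CA$CB"
      using height_row[OF i(1) M'] .
    have "qRe (g q) / qRe q \<ge> 1"
      using height_Delta(1)[OF gq n'(1,2,4)] h' gH i(2)[OF qD(2)] by metis
    then show False using lt pos by simp
  qed
  obtain \<epsilon> w where e: "sgnv \<epsilon>"
    and f: "\<forall>q\<in>HH. qRe (g q) = qRe q \<and> (\<forall>i. qim (g q) i = of_int (\<epsilon> i) * qim q (p i) + of_int (w i))"
    using stabilizer_infinity[OF M] A B0 AM by metis
  have v: "0 < qim q i" "qim q i < 1/2" for i
    using q unfolding Delta_int_def by (cases i; simp)+
  have v': "0 \<le> qim (g q) i" "qim (g q) i \<le> 1/2" for i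
    using gq unfolding Delta_def by (cases i; simp)+
  \<comment> \<open>The old coordinate lies strictly between 0 and 1/2 and the new one in the closed
    interval. For sign 1 this gives |w i| < 1, and for sign -1 it would give an integer strictly
    between 0 and 1.\<close>
  have ew: "\<epsilon> i = 1 \<and> w i = 0" for i
  proof -
    have gi: "qim (g q) i = of_int (\<epsilon> i) * qim q (p i) + of_int (w i)" using f qD(2) by blast
    consider "\<epsilon> i = 1" | "\<epsilon> i = -1" using e unfolding sgnv_def by blast
    then show ?thesis
    proof cases
      case 1
      then have "of_int (w i) < (1::real)" "of_int (w i) > (-1::real)"
        using gi v[of "p i"] v'[of i] by auto
      then show ?thesis using 1 by simp
    next
      case 2
      then have "of_int (w i) < (1::real)" "of_int (w i) > (0::real)"
        using gi v[of "p i"] v'[of i] by auto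
      then show ?thesis by simp
    qed
  qed
  have "qim (g q) i = qim q (p i)" for i using f qD(2) ew by simp
  then have "qim q (p AZ) \<le> qim q (p AY)" "qim q (p AY) \<le> qim q (p AX)"
    using gq by (simp_all add: Delta_def)
  moreover have "qim q AZ < qim q AY" "qim q AY < qim q AX" using q by (simp_all add: Delta_int_def)
  moreover have "bij p" using M(2) by (simp add: adm_def)
  \<comment> \<open>Three strictly ordered values stay ordered only under the identity
    permutation.\<close>
  ultimately have "p = id" using bij_axis_cases[of p] by auto
  then show ?thesis using f x ew by (intro quat_eqI) simp_all
qed

subsection \<open>The fundamental domain\<close>

lemma continuous_qRe: "continuous_on S qRe"
  unfolding qRe_def by (intro continuous_intros)

lemma continuous_qim: "continuous_on S (\<lambda>q. qim q i)"
  by (cases i; simp only: qim.simps; intro continuous_intros)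

lemma open_HH: "open HH"
  unfolding HH_def by (intro open_Collect_less continuous_qRe continuous_intros)

lemma linear_sperm: "linear (sperm \<epsilon> p)"
  by (rule linearI) (rule quat_eqI; simp add: algebra_simps)+

lemma differentiable_refl:
  assumes "f \<in> {sinv, s1, s2, s3, s4}"
  shows "f differentiable_on HH"
proof -
  have l: "sperm \<epsilon> p differentiable_on HH" for \<epsilon> p
    by (rule linear_imp_differentiable_on[OF linear_sperm])
  have "sinv differentiable (at q within HH)" if "q \<in> HH" for q
  proof -
    have "q \<noteq> 0" using norm_pos_HH[OF that] by auto
    then have "norm q ^ 2 \<noteq> 0" by simp
    then show ?thesis
      unfolding sinv_def[abs_def] using \<open>q \<noteq> 0\<close>
      by (intro differentiable_scaleR differentiable_divide differentiable_power derivative_intros differentiable_at_withinI[OF differentiable_norm_at]) auto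
  qed
  then have "sinv differentiable_on HH" by (simp add: differentiable_on_def)
  moreover have "s1 differentiable_on HH"
    unfolding s1_def[abs_def] by (intro differentiable_on_add l differentiable_on_const)
  ultimately show ?thesis using assms l by (auto simp: s2_def s3_def s4_def)
qed

text \<open>Continuity is needed for Borel images, and preservation of null sets for the overlaps of
  translates. Both pass from the differentiable generators to words.\<close>

lemma Gamma_regular:
  assumes "g \<in> Gamma_3434"
  shows "continuous_on HH g \<and> (\<forall>N\<subseteq>HH. negligible N \<longrightarrow> negligible (g ` N))"
  using inv_closed_refl assms[unfolded Gamma_eq]
proof (induction rule: gen_grp_induct)
  case one
  have "continuous_on HH (\<lambda>q\<in>HH. q)"
    by (subst continuous_on_cong[OF refl, of _ _ "\<lambda>q. q"]) simp_all
  moreover have "(\<lambda>q\<in>HH. q) ` N = N" if "N \<subseteq> HH" for N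
    using that by force
  ultimately show ?case by simp
next
  case (step f g)
  have gH: "g q \<in> HH" if "q \<in> HH" for q
    using Bij_HH[OF subgroup_BH_Bij[OF gen_grp_subgroup[OF inv_closed_refl] step(2)] that] .
  have d: "f differentiable_on HH" by (rule differentiable_refl[OF step(1)])
  have "continuous_on HH (\<lambda>q. f (g q))"
    by (rule continuous_on_compose2[OF differentiable_imp_continuous_on[OF d]]) (use step(3) gH in auto)
  then have "continuous_on HH (\<lambda>q\<in>HH. f (g q))"
    by (subst continuous_on_cong[OF refl, of _ _ "\<lambda>q. f (g q)"]) simp_all
  moreover have "negligible ((\<lambda>q\<in>HH. f (g q)) ` N)" if N: "N \<subseteq> HH" "negligible N" for N
  proof -
    have "(\<lambda>q\<in>HH. f (g q)) ` N = f ` (g ` N)"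
      unfolding image_image using N(1) by (intro image_cong) auto
    moreover have "negligible (g ` N)" using step(3) N by blast
    moreover have "f differentiable_on g ` N"
      using d by (rule differentiable_on_subset) (use gH N(1) in blast)
    ultimately show ?thesis
      using negligible_differentiable_image_negligible[of "g ` N" f] by simp
  qed
  ultimately show ?case by blast
qed

lemma sets_hvol: "sets hvol = sets borel"
  by (simp add: hvol_def)

lemma density_measurable: "(\<lambda>q. indicator HH q * ennreal (1 / (qRe q) ^ 4)) \<in> borel_measurable lborel"
proof -
  have [measurable]: "qRe \<in> borel_measurable borel"
    by (rule borel_measurable_continuous_onI[OF continuous_qRe])
  have [measurable]: "HH \<in> sets borel" using open_HH by simp
  show ?thesis by measurable
qed

text \<open>The image equals the preimage under the inverse element, which is continuous; so it is
  relatively closed in the open set \<open>HH\<close>.\<close>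

lemma Gamma_image_borel:
  assumes g: "g \<in> Gamma_3434" and C: "closed C"
  shows "g ` (HH \<inter> C) \<in> sets borel"
proof -
  note i = subgroup_inv_apply[OF subgroup_Gamma g]
  let ?h = "inv\<^bsub>BH\<^esub> g"
  have H: "g q \<in> HH" "?h q \<in> HH" if "q \<in> HH" for q
    using Bij_HH subgroup_BH_Bij[OF subgroup_Gamma] g i(1) that by blast+
  have "g ` (HH \<inter> C) = HH \<inter> ?h -` C"
  proof (intro equalityI subsetI)
    fix x assume x: "x \<in> HH \<inter> ?h -` C"
    then have "x = g (?h x)" "?h x \<in> HH \<inter> C" using i(3) H by auto
    then show "x \<in> g ` (HH \<inter> C)" by (rule image_eqI)
  qed (use i(2) H in auto)
  moreover have "closedin (top_of_set HH) (HH \<inter> ?h -` C)"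
    using Gamma_regular[OF i(1)] C by (intro continuous_closedin_preimage) auto
  ultimately obtain T where "closed T" "g ` (HH \<inter> C) = HH \<inter> T"
    by (auto simp: closedin_closed)
  then show ?thesis using open_HH by simp
qed

definition Delta_closure :: "quat set" where
  "Delta_closure = {q. norm q \<ge> 1 \<and> 0 \<le> qim q AZ \<and> qim q AZ \<le> qim q AY \<and> qim q AY \<le> qim q AX \<and> qim q AX \<le> 1/2}"

lemma closed_Delta_closure: "closed Delta_closure"
  unfolding Delta_closure_def
  by (intro closed_Collect_conj closed_Collect_le continuous_qim continuous_intros)

lemma Delta_eq: "Delta = HH \<inter> Delta_closure"
  by (auto simp: Delta_def Delta_closure_def)

lemma negligible_Delta_boundary: "negligible (Delta - Delta_int)"
proof -
  let ?n = "\<lambda>x y z. mkq 0 (\<lambda>i. case i of AX \<Rightarrow> x | AY \<Rightarrow> y | AZ \<Rightarrow> z)"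
  have nz: "?n x y z \<noteq> 0" if "x \<noteq> 0 \<or> y \<noteq> 0 \<or> z \<noteq> 0" for x y z
    using that qim_mkq[of 0 "\<lambda>i. case i of AX \<Rightarrow> x | AY \<Rightarrow> y | AZ \<Rightarrow> z"] qim_zero
    by (metis axis.case)
  have hyp: "negligible {q. ?n x y z \<bullet> q = b}" if "x \<noteq> 0 \<or> y \<noteq> 0 \<or> z \<noteq> 0" for x y z b
    using nz[OF that] by (intro negligible_hyperplane) simp
  have "negligible (sphere 0 1 \<union> ({q. ?n 0 0 1 \<bullet> q = 0} \<union> ({q. ?n 0 1 (-1) \<bullet> q = 0} \<union>
      ({q. ?n 1 (-1) 0 \<bullet> q = 0} \<union> {q. ?n 1 0 0 \<bullet> q = 1/2}))))"
    by (intro negligible_Un negligible_sphere hyp) simp_all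
  then show ?thesis
    by (rule negligible_subset) (auto simp: Delta_def Delta_int_def inner_quat sum_axis)
qed

text \<open>If g a = h b with a in the interior, then h^-1 g takes a into \<open>Delta\<close> and
  is the identity by rigidity. So for g different from h the overlap lies in the image of the
  boundary, which is a null set.\<close>

lemma Delta_fundamental: "fundamental_domain Gamma_3434 Delta"
  unfolding fundamental_domain_def
proof (intro conjI ballI impI)
  show "Delta \<in> sets hvol"
    unfolding sets_hvol Delta_eq using open_HH closed_Delta_closure by simp
  show "Delta \<subseteq> HH" by (auto simp: Delta_def)
  have H: "g q \<in> HH" if "q \<in> HH" "g \<in> Gamma_3434" for g q
    using Bij_HH subgroup_BH_Bij[OF subgroup_Gamma] that by blast
  show "(\<Union>g\<in>Gamma_3434. g ` Delta) = HH"
  proof (intro equalityI subsetI)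
    fix x assume x: "x \<in> HH"
    obtain g where g: "g \<in> Gamma_3434" "g x \<in> Delta" using Delta_covers[OF x] by blast
    note i = subgroup_inv_apply[OF subgroup_Gamma g(1)]
    have "x \<in> (inv\<^bsub>BH\<^esub> g) ` Delta" using i(2)[OF x] g(2) by force
    then show "x \<in> (\<Union>g\<in>Gamma_3434. g ` Delta)" using i(1) by blast
  qed (use H \<open>Delta \<subseteq> HH\<close> in blast)
  fix g h assume g: "g \<in> Gamma_3434" and h: "h \<in> Gamma_3434" and gh: "g \<noteq> h"
  note i = subgroup_inv_apply[OF subgroup_Gamma h]
  have "g ` Delta \<inter> h ` Delta \<subseteq> g ` (Delta - Delta_int)"
  proof
    fix x assume "x \<in> g ` Delta \<inter> h ` Delta"
    then obtain a b where a: "a \<in> Delta" "x = g a" and b: "b \<in> Delta" "x = h b" by blast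
    have "a \<notin> Delta_int"
    proof
      assume "a \<in> Delta_int"
      let ?k = "\<lambda>q. (inv\<^bsub>BH\<^esub> h) (g q)"
      have k: "restrict ?k HH \<in> Gamma_3434"
        by (rule mem_restrict[OF comp_Gamma[OF subgroup_mem subgroup_mem]])
          (use subgroup_Gamma i(1) g in auto)
      have aH: "a \<in> HH" "b \<in> HH" using a b \<open>Delta \<subseteq> HH\<close> by auto
      have "restrict ?k HH a = b" using i(2)[OF aH(2)] a(2) b(2) aH by simp
      then have "restrict ?k HH q = q" if "q \<in> HH" for q
        using Delta_int_rigid[OF k \<open>a \<in> Delta_int\<close> _ that] b(1) by simp
      then have "g q = h q" if "q \<in> HH" for q
        using i(3)[OF H[OF that g]] that by (metis restrict_apply')
      moreover have "g \<in> extensional HH" "h \<in> extensional HH"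
        using subgroup_BH_Bij[OF subgroup_Gamma] g h by (auto simp: Bij_def)
      ultimately have "g = h" by (intro extensionalityI[of g HH h])
      then show False using gh by blast
    qed
    then show "x \<in> g ` (Delta - Delta_int)" using a by blast
  qed
  moreover have "negligible (g ` (Delta - Delta_int))"
    using Gamma_regular[OF g] negligible_Delta_boundary \<open>Delta \<subseteq> HH\<close> by blast
  ultimately have "negligible (g ` Delta \<inter> h ` Delta)"
    using negligible_subset by blast
  \<comment> \<open>Negligible means null for the completed measure, so membership in
    \<open>null_sets lborel\<close> also needs Borel measurability.\<close>
  moreover have "g ` Delta \<inter> h ` Delta \<in> sets lborel"
    unfolding Delta_eq using Gamma_image_borel[OF g closed_Delta_closure] Gamma_image_borel[OF h closed_Delta_closure]
    by simp
  ultimately have "g ` Delta \<inter> h ` Delta \<in> null_sets lborel"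
    by (simp add: negligible_iff_null_sets null_sets_completion_iff)
  then show "g ` Delta \<inter> h ` Delta \<in> null_sets hvol"
    using absolutely_continuousI_density[OF density_measurable]
    unfolding hvol_def absolutely_continuous_def by blast
qed

section \<open>Finite covolume by dyadic slabs\<close>

definition dyadic_box :: "nat \<Rightarrow> quat set" where
  "dyadic_box k = cbox (quat_of (2^k / 2) 0 0 0) (quat_of (2^k) (1/2) (1/2) (1/2))"

lemma dyadic_box_iff:
  "q \<in> dyadic_box k \<longleftrightarrow> 2^k / 2 \<le> qRe q \<and> qRe q \<le> 2^k \<and> (\<forall>i. 0 \<le> qim q i \<and> qim q i \<le> 1/2)"
  by (cases q) (auto simp: dyadic_box_def quat_of_def in_cbox_complex_iff qRe_def all_axis qim.simps)

text \<open>The imaginary part has square norm at most 3/4 while the norm is at least 1, so points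
  of \<open>Delta\<close> have height at least 1/2, where the slab k = 0 begins.\<close>

lemma Delta_dyadic: "Delta \<subseteq> (\<Union>k. dyadic_box k)"
proof
  fix q assume q: "q \<in> Delta"
  have v: "0 \<le> qim q i \<and> qim q i \<le> 1/2" for i using q unfolding Delta_def by (cases i; simp)
  have "(qim q i)\<^sup>2 \<le> 1/4" for i
    using power_mono[of "qim q i" "1/2" 2] v[of i] by (simp add: power_divide)
  from this[of AX] this[of AY] this[of AZ] have s: "(\<Sum>i\<in>UNIV. (qim q i)\<^sup>2) \<le> 3/4"
    unfolding sum_axis by linarith
  have "norm q \<ge> 1" using q by (simp add: Delta_def)
  then have "(norm q)\<^sup>2 \<ge> 1" by simp
  then have "(1/2)\<^sup>2 \<le> (qRe q)\<^sup>2" using s unfolding norm_quat by (simp add: power_divide)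
  moreover have "qRe q > 0" using q by (simp add: Delta_def)
  ultimately have t: "1/2 \<le> qRe q" using power2_le_imp_le by fastforce
  define k where "k = (LEAST k. qRe q \<le> 2^k)"
  have "\<exists>k. qRe q \<le> 2^k" using real_arch_pow[of 2 "qRe q"] by (auto intro: less_imp_le)
  then have 1: "qRe q \<le> 2^k" unfolding k_def by (rule LeastI_ex)
  have "2^k / 2 \<le> qRe q"
  proof (cases k)
    case (Suc j)
    then have "\<not> qRe q \<le> 2^j" using not_less_Least[of j "\<lambda>k. qRe q \<le> 2^k"] unfolding k_def by simp
    then show ?thesis using Suc by simp
  qed (use t in simp)
  then show "q \<in> (\<Union>k. dyadic_box k)" using 1 v by (auto simp: dyadic_box_iff)
qed

lemma emeasure_dyadic_box: "emeasure lborel (dyadic_box k) = ennreal (2^k / 16)"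
proof -
  have "measure lborel (dyadic_box k) = 2^k / 16"
    unfolding dyadic_box_def quat_of_def content_Pair
    by (simp add: measure_lborel_cbox_eq Basis_complex_def inner_complex_def)
  moreover have "emeasure lborel (dyadic_box k) = ennreal (measure lborel (dyadic_box k))"
    unfolding dyadic_box_def by (intro emeasure_eq_ennreal_measure) (simp add: emeasure_lborel_cbox_eq)
  ultimately show ?thesis by simp
qed

text \<open>The slab has Euclidean volume 2^k / 16, and its density is largest at the bottom, namely
  16 / 16^k; the product is a geometric sequence.\<close>

lemma hvol_dyadic_box: "emeasure hvol (dyadic_box k) \<le> ennreal ((1/8)^k)"
proof -
  have s: "dyadic_box k \<in> sets borel" by (simp add: dyadic_box_def)
  have "emeasure hvol (dyadic_box k)
      = (\<integral>\<^sup>+q. indicator HH q * ennreal (1 / (qRe q) ^ 4) * indicator (dyadic_box k) q \<partial>lborel)"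
    unfolding hvol_def by (rule emeasure_density[OF density_measurable]) (simp add: s)
  also have "\<dots> \<le> (\<integral>\<^sup>+q. ennreal (16 / 16^k) * indicator (dyadic_box k) q \<partial>lborel)"
  proof (rule nn_integral_mono)
    fix q
    show "indicator HH q * ennreal (1 / (qRe q) ^ 4) * indicator (dyadic_box k) q
        \<le> ennreal (16 / 16^k) * indicator (dyadic_box k) q"
    proof (cases "q \<in> dyadic_box k")
      case True
      then have t: "2^k / 2 \<le> qRe q" by (simp add: dyadic_box_iff)
      have "(2^k / 2)^4 \<le> (qRe q)^4" using t by (intro power_mono) simp_all
      moreover have "(2^k / 2 :: real)^4 = 16^k / 16"
      proof -
        have "((2::real)^k)^4 = (2^4)^k" by (metis power_mult mult.commute)
        then show ?thesis by (simp add: power_divide)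
      qed
      ultimately have "16^k / 16 \<le> (qRe q)^4" by simp
      moreover have "(0::real) < 16^k / 16" by simp
      ultimately have "1 / (qRe q)^4 \<le> 1 / (16^k / 16)" by (intro frac_le) simp_all
      then show ?thesis using True by (auto simp: indicator_def intro: ennreal_leI)
    qed simp
  qed
  also have "\<dots> = ennreal (16 / 16^k) * emeasure lborel (dyadic_box k)"
    using s by (simp add: nn_integral_cmult_indicator)
  also have "\<dots> = ennreal (16 / 16^k * (2^k / 16))"
    unfolding emeasure_dyadic_box by (rule ennreal_mult[symmetric]) simp_all
  also have "16 / 16^k * (2^k / 16) = (1/8 :: real)^k"
  proof -
    have "(16::real)^k = 2^k * 8^k" by (simp flip: power_mult_distrib)
    then show ?thesis by (simp add: power_divide)
  qed
  finally show ?thesis .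
qed

lemma covolume_Delta: "emeasure hvol Delta < \<infinity>"
proof -
  have b: "range dyadic_box \<subseteq> sets hvol" unfolding sets_hvol by (auto simp: dyadic_box_def)
  have "emeasure hvol Delta \<le> emeasure hvol (\<Union>k. dyadic_box k)"
    by (rule emeasure_mono[OF Delta_dyadic]) (use b in blast)
  also have "\<dots> \<le> (\<Sum>k. emeasure hvol (dyadic_box k))"
    by (rule emeasure_subadditive_countably[OF b])
  also have "\<dots> \<le> (\<Sum>k. ennreal ((1/8)^k))"
    by (intro suminf_le hvol_dyadic_box) simp_all
  also have "\<dots> < \<infinity>"
  proof -
    have "summable (\<lambda>k. (1/8::real)^k)" by (rule summable_geometric) simp
    then have "(\<Sum>k. ennreal ((1/8)^k)) \<noteq> \<infinity>"
      unfolding infinity_ennreal_def by (rule ennreal_suminf_neq_top) simp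
    then show ?thesis unfolding infinity_ennreal_def less_top .
  qed
  finally show ?thesis .
qed

theorem mainTheorem12:
  shows "discrete_grp Gamma_3434 \<and> finite_covolume Gamma_3434 \<and>
         PSL2_L \<subseteq> PSL2_H \<and> PSL2_H \<subseteq> Gamma_3434 \<and>
         grp_index Gamma_3434 PSL2_H = 4 \<and> grp_index Gamma_3434 PSL2_L = 12 \<and>
         grp_index PSL2_H PSL2_L = 3"
  using discrete_Gamma Delta_fundamental covolume_Delta L_subset_H H_subset_Gamma
    index_Gamma_H index_Gamma_L index_H_L
  unfolding finite_covolume_def by blast

end
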